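(* Let $v_1,\ldots,v_n\in V$ be quasiprimary vectors of weights $\mathrm{wt}(v_i)$ inserted at $z_1,\ldots,z_n$. Then $$\mathcal F_V^{(1)}(\boldsymbol v,\boldsymbol z)=Z_V^{\mathrm{Zhu}}(\boldsymbol v,\boldsymbol\zeta;q)\prod_{i=1}^nd\zeta_i^{\mathrm{wt}(v_i)},$$ where $\zeta_i=\log Z_i$ with $Z_i=\dfrac{z_i-W_{-1}}{z_i-W_1}$ for $i=1,\ldots,n$.
   Context: $V=(V,Y,\mathbf 1,\omega)$ is a simple vertex operator algebra over $\mathbb C$ of strong CFT type ($V=\bigoplus_{n\ge0}V_n$, $\dim V_n<\infty$, $V_0=\mathbb C\mathbf 1$, $L(1)V_1=0$), isomorphic to its contragredient module. $Y(\omega,z)=\sum_nL(n)z^{-n-2}$; a homogeneous $v$ is quasiprimary if $L(1)v=0$. $\langle\cdot,\cdot\rangle$ is the unique non-degenerate invariant bilinear form with $\langle\mathbf 1,\mathbf 1\rangle=1$: $\langle Y(u,z)v,w\rangle=\langle v,Y(e^{zL(1)}(-z^{-2})^{L(0)}u,z^{-1})w\rangle$. $Z^{(0)}(v_1,y_1;\ldots;v_n,y_n)=\langle\mathbf 1,Y(v_1,y_1)\cdots Y(v_n,y_n)\mathbf 1\rangle$, extended to a rational function of the $y_k$. **Genus one parameters.** $W_{1},W_{-1}$ and $q$ are the Schottky parameters ($|q|<1$), with $$w_1=\frac{W_1-qW_{-1}}{1-q},\quad w_{-1}=\frac{W_{-1}-qW_1}{1-q},\quad\rho=-\frac{q(W_{-1}-W_1)^2}{(1-q)^2}.$$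 **Genus one correlation form.** With $\{b\}$ a homogeneous basis of $V$ and $\{\overline b\}$ its dual with respect to $\langle\cdot,\cdot\rangle$, $$\mathcal F_V^{(1)}(\boldsymbol v,\boldsymbol z)=\sum_{m\ge0}\rho^m\sum_{b\in V_m}Z^{(0)}(v_1,z_1;\ldots;v_n,z_n;b,w_1;\overline b,w_{-1})\prod_{i=1}^ndz_i^{\mathrm{wt}(v_i)}.$$ **Zhu trace function.** $$Z_V^{\mathrm{Zhu}}(\boldsymbol v,\boldsymbol\zeta;q)=\mathrm{tr}_V\Big(Y(e^{\mathrm{wt}(v_1)\zeta_1}v_1,e^{\zeta_1})\cdots Y(e^{\mathrm{wt}(v_n)\zeta_n}v_n,e^{\zeta_n})q^{L(0)}\Big)$$ (the factor $q^{-C/24}$ is omitted). The identity is understood formally (as formal series in $q$). *)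

theory Defs
  imports "HOL-Complex_Analysis.Complex_Analysis"
begin

text \<open>The underlying vector space of \<open>V\<close> is the whole type \<open>'v\<close>;
  \<open>mode V u n\<close> is the operator \<open>u(n)\<close> in \<open>Y(u,z) = \<Sum>\<^sub>n u(n) z\<^sup>-\<^sup>n\<^sup>-\<^sup>1\<close>.\<close>

record 'v vertex_data =
  smul :: "complex \<Rightarrow> 'v \<Rightarrow> 'v"
  mode :: "'v \<Rightarrow> int \<Rightarrow> 'v \<Rightarrow> 'v"
  vac  :: 'v
  conf :: 'v

text \<open>\<open>L(n) = \<omega>(n+1)\<close>, because \<open>Y(\<omega>,z) = \<Sum>\<^sub>n L(n) z\<^sup>-\<^sup>n\<^sup>-\<^sup>2\<close>.\<close>

definition vir :: "('v, 'm) vertex_data_scheme \<Rightarrow> int \<Rightarrow> 'v \<Rightarrow> 'v" where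
  "vir V n = mode V (conf V) (n + 1)"

definition weight_space :: "('v::ab_group_add, 'm) vertex_data_scheme \<Rightarrow> int \<Rightarrow> 'v set" where
  "weight_space V n = {v. vir V 0 v = smul V (of_int n) v}"

text \<open>The Jacobi identity in component (Borcherds) form.  All three sums over \<open>i \<ge> 0\<close> have only
  finitely many nonzero terms by lower truncation, so the identity is stated for all
  sufficiently long partial sums.\<close>

definition borcherds_identity :: "('v::ab_group_add, 'm) vertex_data_scheme \<Rightarrow> bool" where
  "borcherds_identity V \<longleftrightarrow> (\<forall>u v w. \<forall>l m n :: int. \<forall>\<^sub>F K in sequentially.
     (\<Sum>i<K. smul V (of_int l gchoose i) (mode V (mode V u (n + int i) v) (l + m - int i) w)) =
     (\<Sum>i<K. smul V ((-1) ^ i * (of_int n gchoose i))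
        (mode V u (l + n - int i) (mode V v (m + int i) w)
         - smul V ((-1) powi n) (mode V v (m + n - int i) (mode V u (l + int i) w)))))"

definition voa :: "('v::ab_group_add, 'm) vertex_data_scheme \<Rightarrow> bool" where
  "voa V \<longleftrightarrow>
     vector_space (smul V) \<and>
     (\<forall>u n. Vector_Spaces.linear (smul V) (smul V) (mode V u n)) \<and>
     (\<forall>n v. Vector_Spaces.linear (smul V) (smul V) (\<lambda>u. mode V u n v)) \<and>
     (\<forall>u v. \<exists>N. \<forall>n\<ge>N. mode V u n v = 0) \<and>
     (\<forall>n v. mode V (vac V) n v = (if n = -1 then v else 0)) \<and>
     (\<forall>u. mode V u (-1) (vac V) = u \<and> (\<forall>n\<ge>0. mode V u n (vac V) = 0)) \<and>
     borcherds_identity V \<and>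
     (\<exists>C. \<forall>m n v. vir V m (vir V n v) - vir V n (vir V m v) =
        smul V (of_int (m - n)) (vir V (m + n) v)
        + (if m + n = 0 then smul V (C * of_int (m ^ 3 - m) / 12) v else 0)) \<and>
     (\<forall>u n v. mode V (vir V (-1) u) n v = smul V (- of_int n) (mode V u (n - 1) v)) \<and>
     module.span (smul V) (\<Union>n. weight_space V n) = UNIV \<and>
     (\<forall>n. \<exists>S. finite S \<and> module.span (smul V) S = weight_space V n) \<and>
     (\<exists>N. \<forall>n<N. weight_space V n = {0})"

definition strong_cft_type :: "('v::ab_group_add, 'm) vertex_data_scheme \<Rightarrow> bool" where
  "strong_cft_type V \<longleftrightarrow>
     (\<forall>n<0. weight_space V n = {0}) \<and>
     weight_space V 0 = module.span (smul V) {vac V} \<and>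
     (\<forall>v\<in>weight_space V 1. vir V 1 v = 0)"

definition simple_voa :: "('v::ab_group_add, 'm) vertex_data_scheme \<Rightarrow> bool" where
  "simple_voa V \<longleftrightarrow> (UNIV :: 'v set) \<noteq> {0} \<and>
     (\<forall>I. module.subspace (smul V) I \<and> (\<forall>u n. \<forall>v\<in>I. mode V u n v \<in> I) \<longrightarrow> I = {0} \<or> I = UNIV)"

text \<open>For \<open>u\<close> of weight \<open>k\<close>, \<open>adj_mode V k u n\<close> is the coefficient of \<open>z\<^sup>-\<^sup>n\<^sup>-\<^sup>1\<close> in
  \<open>Y(e\<^sup>z\<^sup>L\<^sup>(\<^sup>1\<^sup>) (-z\<^sup>-\<^sup>2)\<^sup>L\<^sup>(\<^sup>0\<^sup>) u, z\<^sup>-\<^sup>1)\<close>, namely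
  \<open>(-1)\<^sup>k \<Sum>\<^sub>j (L(1)\<^sup>j u)(2k - n - j - 2) / j!\<close>.  The set of \<open>j\<close> is finite as the grading is
  bounded below.  Homogeneous \<open>u\<close> span \<open>V\<close>, so it is enough to treat these.\<close>

definition adj_mode :: "('v::ab_group_add, 'm) vertex_data_scheme \<Rightarrow> int \<Rightarrow> 'v \<Rightarrow> int \<Rightarrow> 'v \<Rightarrow> 'v" where
  "adj_mode V k u n w =
     (\<Sum>j | (vir V 1 ^^ j) u \<noteq> 0.
        smul V ((-1) powi k / fact j) (mode V ((vir V 1 ^^ j) u) (2 * k - n - int j - 2) w))"

definition graded_dual :: "('v::ab_group_add, 'm) vertex_data_scheme \<Rightarrow> ('v \<Rightarrow> complex) set" where
  "graded_dual V = {f. Vector_Spaces.linear (smul V) (*) f \<and> finite {n. \<exists>v\<in>weight_space V n. f v \<noteq> 0}}"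

text \<open>An isomorphism \<open>\<phi>\<close> of \<open>V\<close>-modules from \<open>V\<close> onto its contragredient: the graded dual, on which
  \<open>u(n)\<close> acts by \<open>f \<mapsto> f \<circ> adj_mode V k u n\<close>.\<close>

definition self_contragredient :: "('v::ab_group_add, 'm) vertex_data_scheme \<Rightarrow> bool" where
  "self_contragredient V \<longleftrightarrow> (\<exists>\<phi>. bij_betw \<phi> UNIV (graded_dual V) \<and>
     (\<forall>w. Vector_Spaces.linear (smul V) (*) (\<lambda>v. \<phi> v w)) \<and>
     (\<forall>k. \<forall>u\<in>weight_space V k. \<forall>n v. \<phi> (mode V u n v) = (\<lambda>w. \<phi> v (adj_mode V k u n w))))"

definition invariant_form ::
  "('v::ab_group_add, 'm) vertex_data_scheme \<Rightarrow> ('v \<Rightarrow> 'v \<Rightarrow> complex) \<Rightarrow> bool" where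
  "invariant_form V \<beta> \<longleftrightarrow>
     (\<forall>v. Vector_Spaces.linear (smul V) (*) (\<beta> v)) \<and>
     (\<forall>w. Vector_Spaces.linear (smul V) (*) (\<lambda>v. \<beta> v w)) \<and>
     (\<forall>k. \<forall>u\<in>weight_space V k. \<forall>n v w. \<beta> (mode V u n v) w = \<beta> v (adj_mode V k u n w))"

definition nondegenerate_form :: "('v::zero \<Rightarrow> 'v \<Rightarrow> complex) \<Rightarrow> bool" where
  "nondegenerate_form \<beta> \<longleftrightarrow>
     (\<forall>v. (\<forall>w. \<beta> v w = 0) \<longrightarrow> v = 0) \<and> (\<forall>w. (\<forall>v. \<beta> v w = 0) \<longrightarrow> w = 0)"

definition quasiprimary :: "('v::ab_group_add, 'm) vertex_data_scheme \<Rightarrow> nat \<Rightarrow> 'v \<Rightarrow> bool" where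
  "quasiprimary V k v \<longleftrightarrow> v \<in> weight_space V (int k) \<and> vir V 1 v = 0"

definition homogeneous_basis :: "('v::ab_group_add, 'm) vertex_data_scheme \<Rightarrow> 'v set \<Rightarrow> bool" where
  "homogeneous_basis V B \<longleftrightarrow> \<not> module.dependent (smul V) B \<and> module.span (smul V) B = UNIV \<and>
     (\<forall>b\<in>B. \<exists>n. b \<in> weight_space V n)"

definition dual_basis :: "('v \<Rightarrow> 'v \<Rightarrow> complex) \<Rightarrow> 'v set \<Rightarrow> ('v \<Rightarrow> 'v) \<Rightarrow> bool" where
  "dual_basis \<beta> B d \<longleftrightarrow> (\<forall>b\<in>B. \<forall>c\<in>B. \<beta> (d b) c = (if b = c then 1 else 0))"

text \<open>The \<open>(k\<^sub>1,\<dots>,k\<^sub>n)\<close>-term of \<open>Y(u\<^sub>1,y\<^sub>1) \<cdots> Y(u\<^sub>n,y\<^sub>n) b\<close>, i.e.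
  \<open>u\<^sub>1(k\<^sub>1) \<cdots> u\<^sub>n(k\<^sub>n) b \<Prod>\<^sub>i y\<^sub>i powi (-k\<^sub>i-1)\<close>.\<close>

fun insertions ::
  "('v, 'm) vertex_data_scheme \<Rightarrow> 'v list \<Rightarrow> complex list \<Rightarrow> int list \<Rightarrow> 'v \<Rightarrow> 'v" where
  "insertions V (u # us) (y # ys) (k # ks) b =
     smul V (y powi (- k - 1)) (mode V u k (insertions V us ys ks b))"
| "insertions V _ _ _ b = b"

definition polynomial_fun :: "nat \<Rightarrow> (complex list \<Rightarrow> complex) \<Rightarrow> bool" where
  "polynomial_fun n p \<longleftrightarrow> (\<exists>(S :: (nat \<Rightarrow> nat) set) c. finite S \<and>
     (\<forall>ys. length ys = n \<longrightarrow> p ys = (\<Sum>\<alpha>\<in>S. c \<alpha> * (\<Prod>i<n. (ys ! i) ^ \<alpha> i))))"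

definition radially_ordered :: "nat \<Rightarrow> complex list set" where
  "radially_ordered n =
     {ys. length ys = n \<and> 0 \<notin> set ys \<and> sorted_wrt (\<lambda>x y. cmod x > cmod y) ys}"

text \<open>The value at \<open>xs\<close> of the rational function in \<open>n\<close> variables \<open>ys\<close> to which
  \<open>\<Sum>\<^sub>k t ys k\<close> (over all \<open>k \<in> \<int>\<^sup>n\<close>) converges for \<open>|y\<^sub>1| > \<dots> > |y\<^sub>n| > 0\<close>.
  It does not depend on the representation \<open>P/Q\<close>, because the domain is open and \<open>Q\<close> is not
  identically zero.\<close>

definition rational_extension ::
  "nat \<Rightarrow> (complex list \<Rightarrow> int list \<Rightarrow> complex) \<Rightarrow> complex list \<Rightarrow> complex" where
  "rational_extension n t xs = (THE r. \<exists>P Q. polynomial_fun n P \<and> polynomial_fun n Q \<and>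
     Q xs \<noteq> 0 \<and> r = P xs / Q xs \<and>
     (\<forall>ys\<in>radially_ordered n. Q ys \<noteq> 0 \<longrightarrow> (t ys has_sum P ys / Q ys) {ks. length ks = n}))"

definition genus0 ::
  "('v::ab_group_add, 'm) vertex_data_scheme \<Rightarrow> ('v \<Rightarrow> 'v \<Rightarrow> complex) \<Rightarrow> 'v list \<Rightarrow> complex list \<Rightarrow> complex" where
  "genus0 V \<beta> us =
     rational_extension (length us) (\<lambda>ys ks. \<beta> (vac V) (insertions V us ys ks (vac V)))"

definition w_pos :: "complex \<Rightarrow> complex \<Rightarrow> complex \<Rightarrow> complex" where
  "w_pos Wp Wm q = (Wp - q * Wm) / (1 - q)"

definition w_neg :: "complex \<Rightarrow> complex \<Rightarrow> complex \<Rightarrow> complex" where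
  "w_neg Wp Wm q = (Wm - q * Wp) / (1 - q)"

definition rho :: "complex \<Rightarrow> complex \<Rightarrow> complex \<Rightarrow> complex" where
  "rho Wp Wm q = - (q * (Wm - Wp)\<^sup>2 / (1 - q)\<^sup>2)"

text \<open>The coefficient of \<open>\<Prod>\<^sub>i dz\<^sub>i^wt(v\<^sub>i)\<close> in the genus one correlation form, as a formal power
  series in \<open>q\<close>.  Here \<open>Wp\<close>, \<open>Wm\<close> are \<open>W\<^sub>1\<close>, \<open>W\<^sub>-\<^sub>1\<close> and \<open>d\<close> maps \<open>b\<close> to its dual vector.  The
  \<open>m\<close>-th summand is a rational function of \<open>q\<close>, regular at \<open>q = 0\<close>; it is replaced by its
  Taylor series, which is \<open>O(q\<^sup>m)\<close>, so that the sum over \<open>m\<close> converges \<open>q\<close>-adically, i.e. in the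
  topology of the type of formal power series.\<close>

definition genus1_form ::
  "('v::ab_group_add, 'm) vertex_data_scheme \<Rightarrow> ('v \<Rightarrow> 'v \<Rightarrow> complex) \<Rightarrow> 'v set \<Rightarrow> ('v \<Rightarrow> 'v) \<Rightarrow>
   complex \<Rightarrow> complex \<Rightarrow> 'v list \<Rightarrow> complex list \<Rightarrow> complex fps" where
  "genus1_form V \<beta> B d Wp Wm vs zs =
     (\<Sum>m. fps_expansion
        (\<lambda>q. rho Wp Wm q ^ m *
           (\<Sum>b\<in>B \<inter> weight_space V (int m).
              genus0 V \<beta> (vs @ [b, d b]) (zs @ [w_pos Wp Wm q, w_neg Wp Wm q]))) 0)"

text \<open>The trace of the \<open>V\<^sub>m \<rightarrow> V\<^sub>m\<close> block of the operator \<open>T\<close>, i.e. the coefficient of \<open>q\<^sup>m\<close> in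
  \<open>tr\<^sub>V (T q\<^sup>L\<^sup>(\<^sup>0\<^sup>))\<close>.\<close>

definition weight_trace :: "('v::ab_group_add, 'm) vertex_data_scheme \<Rightarrow> nat \<Rightarrow> ('v \<Rightarrow> 'v) \<Rightarrow> complex" where
  "weight_trace V m T = (let B = (SOME B. homogeneous_basis V B) in
     \<Sum>b\<in>B \<inter> weight_space V (int m). module.representation (smul V) B (T b) b)"

text \<open>The trace function as a formal power series in \<open>q\<close>.  With \<open>y\<^sub>i = exp \<zeta>\<^sub>i\<close>, the vector
  inserted at \<open>y\<^sub>i\<close> is \<open>exp (wt(v\<^sub>i) \<zeta>\<^sub>i) v\<^sub>i = y\<^sub>i^wt(v\<^sub>i) v\<^sub>i\<close>.  Each coefficient converges for
  \<open>|y\<^sub>1| > \<dots> > |y\<^sub>n| > 0\<close> to a rational function of the \<open>y\<^sub>i\<close>, which is evaluated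
  at \<open>exp \<zeta>\<^sub>i\<close>.\<close>

definition zhu_trace ::
  "('v::ab_group_add, 'm) vertex_data_scheme \<Rightarrow> nat list \<Rightarrow> 'v list \<Rightarrow> complex list \<Rightarrow> complex fps" where
  "zhu_trace V wts vs \<zeta>s = Abs_fps (\<lambda>m. rational_extension (length vs)
     (\<lambda>ys ks. weight_trace V m
        (insertions V (map (\<lambda>i. smul V ((ys ! i) ^ (wts ! i)) (vs ! i)) [0..<length vs]) ys ks))
     (map exp \<zeta>s))"

end

theory Submission
  imports Defs
begin

text \<open>For a linear functional \<open>f\<close> on \<open>V\<close> that vanishes on all high weights and for vectors \<open>u\<^sub>i\<close> at
points \<open>y\<^sub>i\<close>, let \<open>correlator\<close> be the rational function obtained by commuting the modes of the first
vector out of the product: the creating modes move to the left into \<open>f\<close>, the annihilating modes move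
to the right, and each encounter with another vector \<open>u\<^sub>j\<close> leaves poles at \<open>y\<^sub>j\<close>.  This is a
finite recursion.  The same poles appear, expanded in different regions, whichever position the first
vector has in the product.  Hence (\<open>insertion_has_sum\<close>) the series of products of modes converges to
\<open>correlator\<close> for every position of that vector, and since two rational functions that
agree on the radially ordered points agree wherever both are regular, \<open>correlator\<close> does not depend
on the order of the insertions (\<open>correlator_move_to_front\<close>).  All genus zero functions and all
matrix elements of products of vertex operators are values of \<open>correlator\<close>; a vector \<open>c\<close> on which
the product acts is an insertion at the point \<open>0\<close>.

The recursion also shows how \<open>correlator\<close> behaves when the points move.  The derivative in a
position is the insertion of \<open>L(-1)u\<close>, a translation of all points acts on \<open>f\<close> through \<open>L(-1)\<close>, and
homogeneous vectors scale.  The invariant form reverses products and inverts the points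
(\<open>correlator_inversion\<close>): a quasiprimary vector of weight \<open>w\<close> at \<open>y\<close> contributes \<open>(-1)\<^sup>w y\<^sup>-\<^sup>2\<^sup>w\<close>, and
the vector \<open>c\<close> is replaced by \<open>e\<^sup>y\<^sup>L\<^sup>(\<^sup>1\<^sup>) (-y\<^sup>-\<^sup>2)\<^sup>L\<^sup>(\<^sup>0\<^sup>) c\<close>.  With \<open>D = W\<^sub>1 - W\<^sub>-\<^sub>1\<close>, a
translation by \<open>-1/D\<close>, the inversion and a translation by \<open>W\<^sub>1\<close> compose to the inverse of the map
\<open>z \<mapsto> Z/D\<close>, where \<open>Z = (z - W\<^sub>-\<^sub>1) / (z - W\<^sub>1)\<close>.  So the matrix element of \<open>Y(v\<^sub>1,Z\<^sub>1) \<cdots> Y(v\<^sub>n,Z\<^sub>n)\<close> between vectors \<open>a\<close>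
and \<open>c\<close> of the same weight is, up to the Jacobian factors of the \<open>v\<^sub>i\<close>, the genus zero function with
\<open>e\<^sup>L\<^sup>(\<^sup>1\<^sup>)\<^sup>/\<^sup>D a\<close> inserted at \<open>W\<^sub>1\<close> and \<open>e\<^sup>-\<^sup>L\<^sup>(\<^sup>1\<^sup>)\<^sup>/\<^sup>D (-D\<^sup>2)\<^sup>L\<^sup>(\<^sup>0\<^sup>) c\<close> at \<open>W\<^sub>-\<^sub>1\<close>
(\<open>correlator_mobius\<close>).  Taking \<open>a = b\<close> and \<open>c\<close> the dual vector of \<open>b\<close> and summing over \<open>b\<close> gives
each coefficient of the trace function.

On the other side \<open>w\<^sub>1 = W\<^sub>1 + D p\<close> and \<open>w\<^sub>-\<^sub>1 = W\<^sub>-\<^sub>1 - D p\<close> with \<open>p = q / (1 - q)\<close>, and Taylor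
expansion in \<open>p\<close> inserts \<open>e\<^sup>D\<^sup>p\<^sup>L\<^sup>(\<^sup>-\<^sup>1\<^sup>) b\<close> at \<open>W\<^sub>1\<close> and \<open>e\<^sup>-\<^sup>D\<^sup>p\<^sup>L\<^sup>(\<^sup>-\<^sup>1\<^sup>)\<close> of the
dual vector at \<open>W\<^sub>-\<^sub>1\<close> (\<open>genus1_coefficient\<close>).  Both sides are now the same bilinear functional
applied to two tensors built from the Casimir elements \<open>\<Sum>\<^sub>b b \<otimes> b'\<close> of the weight spaces, where \<open>b'\<close> is dual to \<open>b\<close>.  The
tensors agree (\<open>sewing_identity\<close>): an operator on the second factor of a Casimir element is its
adjoint on the first, so everything becomes a combination of \<open>L(-1)\<^sup>i L(1)\<^sup>j\<close> on the first factor.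
Normal ordering \<open>L(1)\<^sup>i L(-1)\<^sup>j\<close> (\<open>lower_raise\<close>) produces rising factorials, which are the
coefficients of the powers of \<open>1 / (1 - q)\<close> that come from \<open>\<rho>\<close> and \<open>p\<close>.\<close>

section \<open>Rational functions on the radially ordered region\<close>

text \<open>A family of monomials may repeat exponents; collecting equal exponents brings it to the defining
form.  Sums and products of polynomials give such families.\<close>

lemma polynomial_funI_family:
  assumes "finite T" and "\<And>ys. length ys = n \<Longrightarrow> p ys = (\<Sum>t\<in>T. c t * (\<Prod>i<n. (ys ! i) ^ (\<alpha> t i)))"
  shows "polynomial_fun n p"
proof -
  have "p ys = (\<Sum>\<gamma>\<in>\<alpha> ` T. (\<Sum>t\<in>{t\<in>T. \<alpha> t = \<gamma>}. c t) * (\<Prod>i<n. (ys ! i) ^ \<gamma> i))"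
    if "length ys = n" for ys
  proof -
    have "p ys = (\<Sum>\<gamma>\<in>\<alpha> ` T. \<Sum>t\<in>{t\<in>T. \<alpha> t = \<gamma>}. c t * (\<Prod>i<n. (ys ! i) ^ (\<alpha> t i)))"
      unfolding assms(2)[OF that] by (rule sum.image_gen[OF assms(1)])
    also have "\<dots> = (\<Sum>\<gamma>\<in>\<alpha> ` T. (\<Sum>t\<in>{t\<in>T. \<alpha> t = \<gamma>}. c t) * (\<Prod>i<n. (ys ! i) ^ \<gamma> i))"
      by (simp add: sum_distrib_right)
    finally show ?thesis .
  qed
  then show ?thesis
    unfolding polynomial_fun_def using assms(1) by (intro exI[of _ "\<alpha> ` T"] exI) auto
qed

lemma polynomial_fun_const: "polynomial_fun n (\<lambda>_. c)"
  by (rule polynomial_funI_family[where T = "{()}" and c = "\<lambda>_. c" and \<alpha> = "\<lambda>_ _. 0"]) auto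

lemma polynomial_fun_nth:
  assumes "i < n"
  shows "polynomial_fun n (\<lambda>ys. ys ! i)"
proof (rule polynomial_funI_family[where T = "{()}" and c = "\<lambda>_. 1" and \<alpha> = "\<lambda>_ j. if j = i then 1 else 0"])
  fix ys :: "complex list"
  have "(\<Prod>j<n. (ys ! j) ^ (if j = i then 1 else 0)) = (\<Prod>j<n. if j = i then ys ! j else 1)"
    by (rule prod.cong) auto
  then show "ys ! i = (\<Sum>t\<in>{()}. 1 * (\<Prod>j<n. (ys ! j) ^ (if j = i then 1 else 0)))"
    using assms by simp
qed auto

lemma polynomial_fun_add:
  assumes "polynomial_fun n p" and "polynomial_fun n q"
  shows "polynomial_fun n (\<lambda>ys. p ys + q ys)"
proof -
  obtain S c where S: "finite S" "\<And>ys. length ys = n \<Longrightarrow> p ys = (\<Sum>\<alpha>\<in>S. c \<alpha> * (\<Prod>i<n. (ys ! i) ^ \<alpha> i))"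
    using assms(1) unfolding polynomial_fun_def by blast
  obtain T e where T: "finite T" "\<And>ys. length ys = n \<Longrightarrow> q ys = (\<Sum>\<alpha>\<in>T. e \<alpha> * (\<Prod>i<n. (ys ! i) ^ \<alpha> i))"
    using assms(2) unfolding polynomial_fun_def by blast
  show ?thesis
    by (rule polynomial_funI_family[where T = "S <+> T" and c = "case_sum c e" and \<alpha> = "case_sum id id"])
      (simp_all add: S T sum.Plus)
qed

lemma polynomial_fun_mult:
  assumes "polynomial_fun n p" and "polynomial_fun n q"
  shows "polynomial_fun n (\<lambda>ys. p ys * q ys)"
proof -
  obtain S c where S: "finite S" "\<And>ys. length ys = n \<Longrightarrow> p ys = (\<Sum>\<alpha>\<in>S. c \<alpha> * (\<Prod>i<n. (ys ! i) ^ \<alpha> i))"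
    using assms(1) unfolding polynomial_fun_def by blast
  obtain T e where T: "finite T" "\<And>ys. length ys = n \<Longrightarrow> q ys = (\<Sum>\<alpha>\<in>T. e \<alpha> * (\<Prod>i<n. (ys ! i) ^ \<alpha> i))"
    using assms(2) unfolding polynomial_fun_def by blast
  show ?thesis
    by (rule polynomial_funI_family[where T = "S \<times> T" and c = "\<lambda>(a, b). c a * e b"
          and \<alpha> = "\<lambda>(a, b) i. a i + b i"])
      (simp_all add: S T sum_product sum.cartesian_product power_add prod.distrib mult_ac case_prod_beta)
qed

lemma polynomial_fun_on_line:
  assumes "polynomial_fun n p" and "length xs = n" and "length ys = n"
  obtains F where "\<And>t. poly F t = p (map2 (\<lambda>x y. x + t * (y - x)) xs ys)"
proof -
  obtain S c where S: "finite S" "\<And>ys. length ys = n \<Longrightarrow> p ys = (\<Sum>\<alpha>\<in>S. c \<alpha> * (\<Prod>i<n. (ys ! i) ^ \<alpha> i))"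
    using assms(1) unfolding polynomial_fun_def by blast
  show ?thesis
    by (rule that[of "\<Sum>\<alpha>\<in>S. smult (c \<alpha>) (\<Prod>i<n. [:xs ! i, ys ! i - xs ! i:] ^ \<alpha> i)"])
      (use assms(2,3) in \<open>simp add: S poly_sum poly_prod poly_power\<close>)
qed

text \<open>One quotient \<open>P/Q\<close> has to serve all of \<open>D\<close>, with \<open>Q\<close> nowhere zero there, so that a value of \<open>g\<close> at any
point of \<open>D\<close> can be recovered from the values near any other point.\<close>

definition rational_on :: "nat \<Rightarrow> complex list set \<Rightarrow> (complex list \<Rightarrow> complex) \<Rightarrow> bool" where
  "rational_on n D g \<longleftrightarrow> (\<exists>P Q. polynomial_fun n P \<and> polynomial_fun n Q \<and>
     (\<forall>ys\<in>D. Q ys \<noteq> 0 \<and> g ys = P ys / Q ys))"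

lemma rational_on_cong:
  "rational_on n D g \<Longrightarrow> (\<And>ys. ys \<in> D \<Longrightarrow> h ys = g ys) \<Longrightarrow> rational_on n D h"
  unfolding rational_on_def by metis

lemma rational_on_const [intro]: "rational_on n D (\<lambda>_. c)"
  unfolding rational_on_def
  by (rule exI[of _ "\<lambda>_. c"], rule exI[of _ "\<lambda>_. 1"]) (auto simp: polynomial_fun_const)

lemma rational_on_nth [intro]: "i < n \<Longrightarrow> rational_on n D (\<lambda>ys. ys ! i)"
  unfolding rational_on_def
  by (rule exI[of _ "\<lambda>ys. ys ! i"], rule exI[of _ "\<lambda>_. 1"])
    (auto simp: polynomial_fun_const polynomial_fun_nth)

lemma rational_on_add [intro]:
  assumes "rational_on n D g" and "rational_on n D h"
  shows "rational_on n D (\<lambda>ys. g ys + h ys)"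
proof -
  obtain P Q where g: "polynomial_fun n P" "polynomial_fun n Q" "\<And>ys. ys \<in> D \<Longrightarrow> Q ys \<noteq> 0 \<and> g ys = P ys / Q ys"
    using assms(1) unfolding rational_on_def by blast
  obtain P' Q' where h: "polynomial_fun n P'" "polynomial_fun n Q'" "\<And>ys. ys \<in> D \<Longrightarrow> Q' ys \<noteq> 0 \<and> h ys = P' ys / Q' ys"
    using assms(2) unfolding rational_on_def by blast
  show ?thesis
    unfolding rational_on_def
    by (rule exI[of _ "\<lambda>ys. P ys * Q' ys + P' ys * Q ys"], rule exI[of _ "\<lambda>ys. Q ys * Q' ys"])
      (use g h in \<open>auto intro!: polynomial_fun_add polynomial_fun_mult simp: add_frac_eq\<close>)
qed

lemma rational_on_mult [intro]:
  assumes "rational_on n D g" and "rational_on n D h"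
  shows "rational_on n D (\<lambda>ys. g ys * h ys)"
proof -
  obtain P Q where g: "polynomial_fun n P" "polynomial_fun n Q" "\<And>ys. ys \<in> D \<Longrightarrow> Q ys \<noteq> 0 \<and> g ys = P ys / Q ys"
    using assms(1) unfolding rational_on_def by blast
  obtain P' Q' where h: "polynomial_fun n P'" "polynomial_fun n Q'" "\<And>ys. ys \<in> D \<Longrightarrow> Q' ys \<noteq> 0 \<and> h ys = P' ys / Q' ys"
    using assms(2) unfolding rational_on_def by blast
  show ?thesis
    unfolding rational_on_def
    by (rule exI[of _ "\<lambda>ys. P ys * P' ys"], rule exI[of _ "\<lambda>ys. Q ys * Q' ys"])
      (use g h in \<open>auto intro!: polynomial_fun_mult\<close>)
qed

lemma rational_on_inverse [intro]:
  assumes "rational_on n D g" and "\<And>ys. ys \<in> D \<Longrightarrow> g ys \<noteq> 0"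
  shows "rational_on n D (\<lambda>ys. inverse (g ys))"
proof -
  obtain P Q where g: "polynomial_fun n P" "polynomial_fun n Q" "\<And>ys. ys \<in> D \<Longrightarrow> Q ys \<noteq> 0 \<and> g ys = P ys / Q ys"
    using assms(1) unfolding rational_on_def by blast
  have "P ys \<noteq> 0" if "ys \<in> D" for ys
    using g(3)[OF that] assms(2)[OF that] by auto
  then show ?thesis
    unfolding rational_on_def
    by (intro exI[of _ Q] exI[of _ P]) (use g in auto)
qed

lemma rational_on_diff [intro]:
  "rational_on n D g \<Longrightarrow> rational_on n D h \<Longrightarrow> rational_on n D (\<lambda>ys. g ys - h ys)"
  using rational_on_add[of n D g "\<lambda>ys. (-1) * h ys"] rational_on_mult[of n D "\<lambda>_. -1" h]
  by auto

lemma rational_on_power [intro]: "rational_on n D g \<Longrightarrow> rational_on n D (\<lambda>ys. g ys ^ k)"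
  by (induction k) auto

lemma rational_on_sum [intro]:
  "(\<And>a. a \<in> A \<Longrightarrow> rational_on n D (g a)) \<Longrightarrow> rational_on n D (\<lambda>ys. \<Sum>a\<in>A. g a ys)"
  by (induction A rule: infinite_finite_induct) auto

lemma rational_on_prod [intro]:
  "(\<And>a. a \<in> A \<Longrightarrow> rational_on n D (g a)) \<Longrightarrow> rational_on n D (\<lambda>ys. \<Prod>a\<in>A. g a ys)"
  by (induction A rule: infinite_finite_induct) auto

lemma radially_ordered_iff_nth:
  "ys \<in> radially_ordered n \<longleftrightarrow> length ys = n \<and> (\<forall>i<n. ys ! i \<noteq> 0) \<and>
     (\<forall>i j. i < j \<longrightarrow> j < n \<longrightarrow> cmod (ys ! j) < cmod (ys ! i))"
  unfolding radially_ordered_def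
  by (auto simp: sorted_wrt_iff_nth_less in_set_conv_nth)

lemma radially_ordered_nonempty: "map (\<lambda>i. of_nat (n - i)) [0..<n] \<in> radially_ordered n"
  by (auto simp: radially_ordered_iff_nth simp del: of_nat_diff)

text \<open>The radially ordered region is open; only the points of one complex line are needed.\<close>

lemma eventually_line_radially_ordered:
  assumes "ys \<in> radially_ordered n" and "length xs = n"
  shows "\<forall>\<^sub>F t in nhds 1. map2 (\<lambda>x y. x + t * (y - x)) xs ys \<in> radially_ordered n"
proof -
  have y: "length ys = n" "\<And>i. i < n \<Longrightarrow> ys ! i \<noteq> 0"
      "\<And>i j. i < j \<Longrightarrow> j < n \<Longrightarrow> cmod (ys ! j) < cmod (ys ! i)"
    using assms(1) by (auto simp: radially_ordered_iff_nth)
  have lim: "((\<lambda>t. xs ! i + t * (ys ! i - xs ! i)) \<longlongrightarrow> ys ! i) (nhds 1)" for i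
  proof -
    have "((\<lambda>t. xs ! i + t * (ys ! i - xs ! i)) \<longlongrightarrow> xs ! i + 1 * (ys ! i - xs ! i)) (nhds 1)"
      by (intro tendsto_intros filterlim_ident)
    then show ?thesis by simp
  qed
  have a: "\<forall>\<^sub>F t in nhds 1. \<forall>i\<in>{..<n}. xs ! i + t * (ys ! i - xs ! i) \<noteq> 0"
    by (intro eventually_ball_finite ballI tendsto_imp_eventually_ne[OF lim]) (auto simp: y)
  have b: "\<forall>\<^sub>F t in nhds 1. \<forall>(i, j)\<in>{(i, j). i < j \<and> j < n}.
      cmod (xs ! j + t * (ys ! j - xs ! j)) < cmod (xs ! i + t * (ys ! i - xs ! i))"
  proof (rule eventually_ball_finite)
    show "finite {(i, j). i < j \<and> j < n}"
      by (rule finite_subset[of _ "{..<n} \<times> {..<n}"]) auto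
    show "\<forall>p\<in>{(i, j). i < j \<and> j < n}. \<forall>\<^sub>F t in nhds 1. case p of (i, j) \<Rightarrow>
      cmod (xs ! j + t * (ys ! j - xs ! j)) < cmod (xs ! i + t * (ys ! i - xs ! i))"
    proof clarify
      fix i j assume "i < j" "j < n"
      let ?c = "(cmod (ys ! j) + cmod (ys ! i)) / 2"
      have "cmod (ys ! j) < ?c" "?c < cmod (ys ! i)" using y(3)[OF \<open>i < j\<close> \<open>j < n\<close>] by auto
      then have "\<forall>\<^sub>F t in nhds 1. cmod (xs ! j + t * (ys ! j - xs ! j)) < ?c"
        "\<forall>\<^sub>F t in nhds 1. ?c < cmod (xs ! i + t * (ys ! i - xs ! i))"
        by (blast intro: order_tendstoD[OF tendsto_norm[OF lim]])+
      then show "\<forall>\<^sub>F t in nhds 1. cmod (xs ! j + t * (ys ! j - xs ! j)) < cmod (xs ! i + t * (ys ! i - xs ! i))"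
        by eventually_elim simp
    qed
  qed
  show ?thesis
    using a b by eventually_elim (auto simp: radially_ordered_iff_nth assms(2) y)
qed

text \<open>On the complex line from \<open>xs\<close> to a radially ordered point, \<open>P Q' - P' Q\<close> is a polynomial in one
variable that vanishes near the far end of the line, except possibly at zeros of \<open>Q Q'\<close>; so it
vanishes identically.\<close>

lemma rational_values_unique:
  assumes poly: "polynomial_fun n P" "polynomial_fun n Q" "polynomial_fun n P'" "polynomial_fun n Q'"
    and xs: "length xs = n" "Q xs \<noteq> 0" "Q' xs \<noteq> 0"
    and agree: "\<And>ys. ys \<in> radially_ordered n \<Longrightarrow> Q ys \<noteq> 0 \<Longrightarrow> Q' ys \<noteq> 0 \<Longrightarrow> P ys / Q ys = P' ys / Q' ys"
  shows "P xs / Q xs = P' xs / Q' xs"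
proof -
  define y0 :: "complex list" where "y0 = map (\<lambda>i. of_nat (n - i)) [0..<n]"
  have y0: "y0 \<in> radially_ordered n" "length y0 = n"
    unfolding y0_def by (rule radially_ordered_nonempty) simp
  \<comment> \<open>The line with \<open>l 0 = xs\<close> and \<open>l 1 = y0\<close>.\<close>
  define l where "l t = map2 (\<lambda>x y. x + t * (y - x)) xs y0" for t
  obtain p where p: "\<And>t. poly p t = P (l t)"
    using polynomial_fun_on_line[OF poly(1) xs(1) y0(2)] unfolding l_def by blast
  obtain q where q: "\<And>t. poly q t = Q (l t)"
    using polynomial_fun_on_line[OF poly(2) xs(1) y0(2)] unfolding l_def by blast
  obtain p' where p': "\<And>t. poly p' t = P' (l t)"
    using polynomial_fun_on_line[OF poly(3) xs(1) y0(2)] unfolding l_def by blast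
  obtain q' where q': "\<And>t. poly q' t = Q' (l t)"
    using polynomial_fun_on_line[OF poly(4) xs(1) y0(2)] unfolding l_def by blast
  have l0: "l 0 = xs"
    unfolding l_def using xs y0 by (auto intro!: nth_equalityI)
  have nz: "q \<noteq> 0" "q' \<noteq> 0"
    using q[of 0] q'[of 0] l0 xs by auto
  let ?r = "(p * q' - p' * q) * (q * q')"
  have "\<forall>\<^sub>F t in nhds 1. l t \<in> radially_ordered n"
    unfolding l_def by (rule eventually_line_radially_ordered[OF y0(1) xs(1)])
  then obtain e where e: "e > 0" "\<And>t. dist t 1 < e \<Longrightarrow> l t \<in> radially_ordered n"
    unfolding eventually_nhds_metric by blast
  have "poly ?r t = 0" if "t \<in> ball 1 e" for t
  proof (cases "poly q t = 0 \<or> poly q' t = 0")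
    case False
    then have "P (l t) / Q (l t) = P' (l t) / Q' (l t)"
      using e(2)[of t] that agree[of "l t"] by (auto simp: q q' dist_commute)
    then show ?thesis using False by (simp add: p q p' q' field_simps)
  qed auto
  then have "infinite {t. poly ?r t = 0}"
    using infinite_super[of "ball 1 e" "{t. poly ?r t = 0}"] uncountable_ball[OF e(1), of "1::complex"] countable_finite by blast
  then have "?r = 0" using poly_roots_finite by blast
  then have "p * q' - p' * q = 0" using nz by simp
  then have "poly (p * q' - p' * q) 0 = 0" by simp
  then show ?thesis using xs by (simp add: p q p' q' l0 field_simps)
qed

text \<open>The definite description in \<open>rational_extension\<close> is eliminated here: any rational function to which
the series converges supplies its value.\<close>

lemma rational_extension_eq:
  assumes "rational_on n D g" and "xs \<in> D" and "length xs = n"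
    and "radially_ordered n \<subseteq> D"
    and sums: "\<And>ys. ys \<in> radially_ordered n \<Longrightarrow> (t ys has_sum g ys) {ks. length ks = n}"
  shows "rational_extension n t xs = g xs"
proof -
  obtain P Q where PQ: "polynomial_fun n P" "polynomial_fun n Q" "\<And>ys. ys \<in> D \<Longrightarrow> Q ys \<noteq> 0 \<and> g ys = P ys / Q ys"
    using assms(1) unfolding rational_on_def by blast
  show ?thesis
    unfolding rational_extension_def
  proof (rule the_equality)
    have "(t ys has_sum P ys / Q ys) {ks. length ks = n}" if "ys \<in> radially_ordered n" for ys
      using sums[OF that] PQ(3)[of ys] that assms(4) by auto
    then show "\<exists>P Q. polynomial_fun n P \<and> polynomial_fun n Q \<and> Q xs \<noteq> 0 \<and> g xs = P xs / Q xs \<and>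
       (\<forall>ys\<in>radially_ordered n. Q ys \<noteq> 0 \<longrightarrow> (t ys has_sum P ys / Q ys) {ks. length ks = n})"
      using PQ(1,2) PQ(3)[OF assms(2)] by blast
  next
    fix r
    assume "\<exists>P Q. polynomial_fun n P \<and> polynomial_fun n Q \<and> Q xs \<noteq> 0 \<and> r = P xs / Q xs \<and>
       (\<forall>ys\<in>radially_ordered n. Q ys \<noteq> 0 \<longrightarrow> (t ys has_sum P ys / Q ys) {ks. length ks = n})"
    then obtain P' Q' where PQ': "polynomial_fun n P'" "polynomial_fun n Q'" "Q' xs \<noteq> 0" "r = P' xs / Q' xs"
      "\<And>ys. ys \<in> radially_ordered n \<Longrightarrow> Q' ys \<noteq> 0 \<Longrightarrow> (t ys has_sum P' ys / Q' ys) {ks. length ks = n}"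
      by blast
    have "P' xs / Q' xs = P xs / Q xs"
    proof (rule rational_values_unique[OF PQ'(1,2) PQ(1,2) assms(3)])
      fix ys assume ys: "ys \<in> radially_ordered n" "Q' ys \<noteq> 0" "Q ys \<noteq> 0"
      show "P' ys / Q' ys = P ys / Q ys"
        using has_sum_unique[OF PQ'(5)[OF ys(1,2)] sums[OF ys(1)]] PQ(3)[of ys] ys assms(4) by auto
    qed (use PQ(3)[OF assms(2)] PQ'(3) in auto)
    then show "r = g xs" using PQ'(4) PQ(3)[OF assms(2)] by simp
  qed
qed

lemma rational_on_eqI:
  assumes "rational_on n D g" and "rational_on n D h" and "xs \<in> D" and "length xs = n"
    and "radially_ordered n \<subseteq> D"
    and "\<And>ys. ys \<in> radially_ordered n \<Longrightarrow> g ys = h ys"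
  shows "g xs = h xs"
proof -
  obtain P Q where PQ: "polynomial_fun n P" "polynomial_fun n Q" "\<And>ys. ys \<in> D \<Longrightarrow> Q ys \<noteq> 0 \<and> g ys = P ys / Q ys"
    using assms(1) unfolding rational_on_def by blast
  obtain P' Q' where PQ': "polynomial_fun n P'" "polynomial_fun n Q'" "\<And>ys. ys \<in> D \<Longrightarrow> Q' ys \<noteq> 0 \<and> h ys = P' ys / Q' ys"
    using assms(2) unfolding rational_on_def by blast
  have "P xs / Q xs = P' xs / Q' xs"
    by (rule rational_values_unique[OF PQ(1,2) PQ'(1,2) assms(4)])
      (use PQ(3) PQ'(3) assms in \<open>auto simp: subset_iff\<close>)
  then show ?thesis using PQ(3) PQ'(3) assms(3) by auto
qed

lemma radially_ordered_distinct: "ys \<in> radially_ordered n \<Longrightarrow> distinct ys"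
  unfolding distinct_conv_nth radially_ordered_iff_nth by (metis less_irrefl linorder_neqE_nat)

lemma radially_ordered_length: "ys \<in> radially_ordered n \<Longrightarrow> length ys = n"
  and radially_ordered_nonzero: "ys \<in> radially_ordered n \<Longrightarrow> 0 \<notin> set ys"
  by (simp_all add: radially_ordered_def)

section \<open>The two expansions of a pole\<close>

text \<open>Induction on the exponent: multiplying by one more geometric series sums the coefficients, and the
hockey-stick identity evaluates the sum.\<close>

lemma negative_binomial_sums:
  fixes t :: complex
  assumes "cmod t < 1"
  shows "(\<lambda>r. of_nat (r + i choose i) * t ^ r) sums ((1 / (1 - t)) ^ Suc i)"
    and "summable (\<lambda>r. cmod (of_nat (r + i choose i) * t ^ r))"
proof -
  have *: "(\<lambda>r. of_nat (r + i choose i) * t ^ r) sums ((1 / (1 - t)) ^ Suc i) \<and>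
      summable (\<lambda>r. cmod (of_nat (r + i choose i) * t ^ r))"
    if "cmod t < 1" for t :: complex
    using that
  proof (induction i arbitrary: t)
    case 0
    then show ?case
      using geometric_sums[of t] by (simp add: norm_power summable_geometric)
  next
    case (Suc i)
    have *: "(\<lambda>r. of_nat (r + Suc i choose Suc i) * t ^ r) sums ((1 / (1 - t)) ^ Suc (Suc i))"
      if t: "cmod t < 1" for t :: complex
    proof -
      have "(\<lambda>k. \<Sum>l\<le>k. (of_nat (l + i choose i) * t ^ l) * t ^ (k - l)) sums
        ((\<Sum>r. of_nat (r + i choose i) * t ^ r) * (\<Sum>k. t ^ k))"
        by (rule Cauchy_product_sums) (use Suc.IH[OF t] t in \<open>auto simp: norm_power summable_geometric\<close>)
      moreover have "(\<Sum>l\<le>k. (of_nat (l + i choose i) * t ^ l) * t ^ (k - l)) = of_nat (k + Suc i choose Suc i) * t ^ k" for k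
      proof -
        have "(\<Sum>l\<le>k. (of_nat (l + i choose i) * t ^ l) * t ^ (k - l)) = (\<Sum>l\<le>k. of_nat (i + l choose i) * t ^ k)"
          by (rule sum.cong) (auto simp: add.commute simp flip: power_add)
        also have "\<dots> = of_nat (\<Sum>l\<le>k. i + l choose i) * t ^ k"
          by (simp add: sum_distrib_right)
        also have "(\<Sum>l\<le>k. i + l choose i) = k + Suc i choose Suc i"
          unfolding choose_rising_sum(1) by (simp add: add_ac)
        finally show ?thesis .
      qed
      ultimately show ?thesis
        using Suc.IH[OF t] geometric_sums[OF t] by (simp add: sums_iff mult.commute)
    qed
    have "summable (\<lambda>r. of_nat (r + Suc i choose Suc i) * complex_of_real (cmod t) ^ r)"
      using *[of "complex_of_real (cmod t)"] Suc.prems by (simp add: sums_iff)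
    then have "summable (\<lambda>r. of_real (of_nat (r + Suc i choose Suc i) * cmod t ^ r) :: complex)"
      by simp
    then have "summable (\<lambda>r. of_nat (r + Suc i choose Suc i) * cmod t ^ r)"
      by (subst (asm) summable_complex_of_real)
    then have "summable (\<lambda>r. cmod (of_nat (r + Suc i choose Suc i) * t ^ r))"
      by (simp only: norm_mult norm_power norm_of_nat)
    with *[OF Suc.prems] show ?case by blast
  qed
  show "(\<lambda>r. of_nat (r + i choose i) * t ^ r) sums ((1 / (1 - t)) ^ Suc i)"
    "summable (\<lambda>r. cmod (of_nat (r + i choose i) * t ^ r))"
    using *[OF assms] by blast+
qed

lemma negative_binomial_has_sum:
  "cmod t < 1 \<Longrightarrow> ((\<lambda>r. of_nat (r + i choose i) * t ^ r) has_sum (1 / (1 - t)) ^ Suc i) UNIV"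
  by (rule norm_summable_imp_has_sum) (rule negative_binomial_sums; assumption)+

text \<open>The coefficients of the commutator formula for modes \<open>k \<ge> 0\<close> sum to a pole; the modes \<open>k < 0\<close> give the
same pole, with the opposite sign, in the complementary region.  This is why a vertex operator leaves the same
rational function behind, whichever way it is moved.\<close>

lemma pole_expansion_outside:
  fixes x y :: complex
  assumes "cmod y < cmod x" and "y \<noteq> 0"
  shows "((\<lambda>k. (of_int k gchoose i) * y powi (k - int i) * x powi (- k - 1)) has_sum 1 / (x - y) ^ Suc i) {0..}"
proof -
  have x: "x \<noteq> 0" using assms by auto
  have "((\<lambda>r. (1 / x ^ Suc i) * (of_nat (r + i choose i) * (y / x) ^ r)) has_sum
      (1 / x ^ Suc i) * (1 / (1 - y / x)) ^ Suc i) UNIV"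
    by (intro has_sum_cmult_right negative_binomial_has_sum) (use assms x in \<open>simp add: norm_divide divide_simps\<close>)
  also have "(1 / x ^ Suc i) * (1 / (1 - y / x)) ^ Suc i = 1 / (x * (1 - y / x)) ^ Suc i"
    by (simp only: power_mult_distrib power_one_over) (simp add: field_simps)
  also have "x * (1 - y / x) = x - y" using x by (simp add: field_simps)
  finally have "((\<lambda>r. (1 / x ^ Suc i) * (of_nat (r + i choose i) * (y / x) ^ r)) has_sum 1 / (x - y) ^ Suc i) UNIV" .
  also have "?this \<longleftrightarrow> ((\<lambda>k. (of_int k gchoose i) * y powi (k - int i) * x powi (- k - 1)) has_sum 1 / (x - y) ^ Suc i) {int i..}"
  proof (rule has_sum_reindex_bij_witness[where j = "\<lambda>r. int (r + i)" and i = "\<lambda>k. nat (k - int i)"])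
    fix r :: nat
    have g: "(of_int (int (r + i)) gchoose i :: complex) = of_nat (r + i choose i)"
      unfolding of_int_of_nat_eq by (rule binomial_gbinomial[symmetric])
    have e: "x powi (- int (r + i) - 1) = 1 / (x ^ r * x ^ Suc i)"
      using x by (simp add: power_int_minus power_int_diff power_int_add field_simps power_int_of_nat)
    show "(of_int (int (r + i)) gchoose i) * y powi (int (r + i) - int i) * x powi (- int (r + i) - 1) =
        (1 / x ^ Suc i) * (of_nat (r + i choose i) * (y / x) ^ r)"
      unfolding g e by (simp add: power_divide power_int_of_nat)
  qed auto
  also have "\<dots> \<longleftrightarrow> ((\<lambda>k. (of_int k gchoose i) * y powi (k - int i) * x powi (- k - 1)) has_sum 1 / (x - y) ^ Suc i) {0..}"
  proof (rule has_sum_cong_neutral)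
    fix k assume "k \<in> {0..} - {int i..}"
    then obtain m where m: "k = int m" "m < i" by (metis Diff_iff atLeast_iff nonneg_int_cases not_le of_nat_less_iff)
    have "(of_int k gchoose i :: complex) = of_nat (m choose i)"
      unfolding m of_int_of_nat_eq by (rule binomial_gbinomial[symmetric])
    then show "(of_int k gchoose i) * y powi (k - int i) * x powi (- k - 1) = 0" using m by simp
  qed auto
  finally show ?thesis .
qed

lemma pole_expansion_inside:
  fixes x y :: complex
  assumes "cmod x < cmod y" and "x \<noteq> 0"
  shows "((\<lambda>k. - ((of_int k gchoose i) * y powi (k - int i) * x powi (- k - 1))) has_sum 1 / (x - y) ^ Suc i) {..<0}"
proof -
  have y: "y \<noteq> 0" using assms by auto
  let ?c = "- ((-1) ^ i / y ^ Suc i)"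
  have "((\<lambda>r. ?c * (of_nat (r + i choose i) * (x / y) ^ r)) has_sum ?c * (1 / (1 - x / y)) ^ Suc i) UNIV"
    by (intro has_sum_cmult_right negative_binomial_has_sum) (use assms y in \<open>simp add: norm_divide divide_simps\<close>)
  also have "?c * (1 / (1 - x / y)) ^ Suc i = (-1) ^ Suc i / (y * (1 - x / y)) ^ Suc i"
    by (simp only: power_mult_distrib power_one_over) (simp add: field_simps)
  also have "y * (1 - x / y) = - (x - y)" using y by (simp add: field_simps)
  also have "(-1) ^ Suc i / (- (x - y)) ^ Suc i = 1 / (x - y) ^ Suc i"
    by (subst power_minus[of "x - y"]) (simp del: minus_diff_eq)
  finally have "((\<lambda>r. ?c * (of_nat (r + i choose i) * (x / y) ^ r)) has_sum 1 / (x - y) ^ Suc i) UNIV" .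
  also have "?this \<longleftrightarrow> ?thesis"
  proof (rule has_sum_reindex_bij_witness[where j = "\<lambda>r. - 1 - int r" and i = "\<lambda>k. nat (- 1 - k)"])
    fix r :: nat
    have g: "(of_int (- 1 - int r) gchoose i :: complex) = (-1) ^ i * of_nat (r + i choose i)"
    proof -
      have "(of_int (- 1 - int r) gchoose i :: complex) = (- of_nat (Suc r)) gchoose i" by simp
      also have "\<dots> = (-1) ^ i * ((of_nat (Suc r) + of_nat i - 1) gchoose i)"
        by (rule gbinomial_minus)
      also have "(of_nat (Suc r) + of_nat i - 1 :: complex) = of_nat (r + i)" by simp
      finally show ?thesis by (simp only: binomial_gbinomial)
    qed
    have e: "y powi (- 1 - int r - int i) = 1 / (y ^ r * y ^ Suc i)"
      using y by (simp add: power_int_minus power_int_diff power_int_add field_simps power_int_of_nat)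
    have e': "x powi (- (- 1 - int r) - 1) = x ^ r" by (simp add: power_int_of_nat)
    show "- ((of_int (- 1 - int r) gchoose i) * y powi (- 1 - int r - int i) * x powi (- (- 1 - int r) - 1)) =
        ?c * (of_nat (r + i choose i) * (x / y) ^ r)"
      unfolding g e e' by (simp add: power_divide mult_ac)
  qed auto
  finally show ?thesis .
qed

text \<open>For complex numbers, summability is absolute, so the product family is summable.\<close>

lemma has_sum_complex_times:
  fixes A :: "'a \<Rightarrow> complex" and h :: "'b \<Rightarrow> complex"
  assumes A: "(A has_sum a) X" and h: "(h has_sum s) Y"
  shows "((\<lambda>(x, y). A x * h y) has_sum a * s) (X \<times> Y)"
proof (rule has_sum_SigmaI)
  show "((\<lambda>y. case (x, y) of (x, y) \<Rightarrow> A x * h y) has_sum A x * s) Y" for x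
    using has_sum_cmult_right[OF h] by simp
  show "((\<lambda>x. A x * s) has_sum a * s) X"
    using has_sum_cmult_left[OF A] by simp
  have "A summable_on X" and h': "h summable_on Y" using A h by (auto intro: has_sum_imp_summable)
  then have nA: "(\<lambda>x. norm (A x)) summable_on X" and nh: "(\<lambda>y. norm (h y)) summable_on Y"
    by (simp_all add: summable_on_iff_abs_summable_on_complex)
  have "(\<lambda>(x, y). norm (A x) * norm (h y)) summable_on X \<times> Y"
  proof (rule summable_on_SigmaI)
    show "((\<lambda>y. case (x, y) of (x, y) \<Rightarrow> norm (A x) * norm (h y)) has_sum norm (A x) * (\<Sum>\<^sub>\<infinity>y\<in>Y. norm (h y))) Y" for x
      using has_sum_cmult_right[OF has_sum_infsum[OF nh]] by simp
    show "(\<lambda>x. norm (A x) * (\<Sum>\<^sub>\<infinity>y\<in>Y. norm (h y))) summable_on X"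
      by (rule summable_on_cmult_left[OF nA])
  qed auto
  then show "(\<lambda>(x, y). A x * h y) summable_on X \<times> Y"
    by (subst summable_on_iff_abs_summable_on_complex) (simp add: case_prod_unfold norm_mult)
qed

lemma has_sum_finite_sum:
  assumes "\<And>a. a \<in> A \<Longrightarrow> (f a has_sum s a) (X :: 'a set)"
  shows "((\<lambda>x. \<Sum>a\<in>A. f a x) has_sum (\<Sum>a\<in>A. s a :: complex)) X"
  using assms by (induction A rule: infinite_finite_induct) (auto intro: has_sum_add)

lemma has_sum_single: "((\<lambda>k. if k = k0 then c else 0) has_sum c) UNIV"
  by (rule has_sum_finite_neutralI[of "{k0}"]) auto

section \<open>Modes, weights and restricted functionals\<close>

locale vertex_operator_algebra =
  fixes V :: "'v::ab_group_add vertex_data"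
  assumes voa: "voa V"
begin

sublocale vector_space "smul V"
  using voa unfolding voa_def by (elim conjE)

lemma mode_linear_right: "Vector_Spaces.linear (smul V) (smul V) (mode V u n)"
  and mode_linear_left: "Vector_Spaces.linear (smul V) (smul V) (\<lambda>u. mode V u n v)"
proof -
  have "\<forall>u n. Vector_Spaces.linear (smul V) (smul V) (mode V u n)"
    using voa unfolding voa_def by (elim conjE)
  then show "Vector_Spaces.linear (smul V) (smul V) (mode V u n)" by simp
  have "\<forall>n v. Vector_Spaces.linear (smul V) (smul V) (\<lambda>u. mode V u n v)"
    using voa unfolding voa_def by (elim conjE)
  then show "Vector_Spaces.linear (smul V) (smul V) (\<lambda>u. mode V u n v)" by simp
qed

lemma mode_add_right: "mode V u n (v + w) = mode V u n v + mode V u n w"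
  and mode_scale_right: "mode V u n (smul V c v) = smul V c (mode V u n v)"
  using mode_linear_right[of u n] by (auto simp: Vector_Spaces.linear_iff)

lemma mode_add_left: "mode V (u + v) n w = mode V u n w + mode V v n w"
  and mode_scale_left: "mode V (smul V c u) n w = smul V c (mode V u n w)"
  using mode_linear_left[of n w] by (auto simp: Vector_Spaces.linear_iff)

lemma mode_zero_right [simp]: "mode V u n 0 = 0"
  using mode_scale_right[of u n 0 0] by simp

lemma mode_zero_left [simp]: "mode V 0 n w = 0"
  using mode_scale_left[of 0 0 n w] by simp

lemma vir_add: "vir V n (v + w) = vir V n v + vir V n w"
  and vir_scale: "vir V n (smul V c v) = smul V c (vir V n v)"
  by (simp_all add: vir_def mode_add_right mode_scale_right)

lemma vir_zero [simp]: "vir V n 0 = 0"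
  by (simp add: vir_def)

lemma vir_pow_add: "(vir V n ^^ j) (v + w) = (vir V n ^^ j) v + (vir V n ^^ j) w"
  and vir_pow_scale: "(vir V n ^^ j) (smul V c v) = smul V c ((vir V n ^^ j) v)"
  by (induction j) (simp_all add: vir_add vir_scale)

lemma vir_pow_zero [simp]: "(vir V n ^^ j) 0 = 0"
  by (induction j) simp_all

lemma lower_truncation: obtains N :: nat where "\<And>n. n \<ge> int N \<Longrightarrow> mode V u n v = 0"
proof -
  have "\<forall>u v. \<exists>N. \<forall>n\<ge>N. mode V u n v = 0"
    using voa unfolding voa_def by (elim conjE)
  then obtain N where N: "\<forall>n\<ge>N. mode V u n v = 0" by blast
  show ?thesis by (rule that[of "nat N"]) (use N in \<open>auto split: if_splits\<close>)
qed

lemma mode_on_vac: "mode V u (-1) (vac V) = u" "n \<ge> 0 \<Longrightarrow> mode V u n (vac V) = 0"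
proof -
  have "\<forall>u. mode V u (-1) (vac V) = u \<and> (\<forall>n\<ge>0. mode V u n (vac V) = 0)"
    using voa unfolding voa_def by (elim conjE)
  then show "mode V u (-1) (vac V) = u" "n \<ge> 0 \<Longrightarrow> mode V u n (vac V) = 0" by simp_all
qed

lemma vir_m1_vac [simp]: "vir V (-1) (vac V) = 0"
  by (simp add: vir_def mode_on_vac)

lemma mode_vir_m1: "mode V (vir V (-1) u) n v = smul V (- of_int n) (mode V u (n - 1) v)"
proof -
  have "\<forall>u n v. mode V (vir V (-1) u) n v = smul V (- of_int n) (mode V u (n - 1) v)"
    using voa unfolding voa_def by (elim conjE)
  then show ?thesis by simp
qed

lemma gchoose_zero_left: "(0::complex) gchoose i = (if i = 0 then 1 else 0)"
  by (cases i) simp_all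

text \<open>The Borcherds identity with \<open>n = 0\<close>: on its right-hand side only the term \<open>i = 0\<close> survives.\<close>

lemma commutator:
  assumes "\<And>i. i \<ge> I \<Longrightarrow> mode V u (int i) v = 0"
  shows "mode V u k (mode V v m w) - mode V v m (mode V u k w) =
    (\<Sum>i<I. smul V (of_int k gchoose i) (mode V (mode V u (int i) v) (k + m - int i) w))"
proof -
  have "borcherds_identity V" using voa unfolding voa_def by (elim conjE)
  then have "\<forall>\<^sub>F K in sequentially.
     (\<Sum>i<K. smul V (of_int k gchoose i) (mode V (mode V u (0 + int i) v) (k + m - int i) w)) =
     (\<Sum>i<K. smul V ((-1) ^ i * (of_int 0 gchoose i))
        (mode V u (k + 0 - int i) (mode V v (m + int i) w)
         - smul V ((-1) powi 0) (mode V v (m + 0 - int i) (mode V u (k + int i) w))))"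
    unfolding borcherds_identity_def by blast
  then obtain K0 where K0: "\<And>K. K \<ge> K0 \<Longrightarrow>
     (\<Sum>i<K. smul V (of_int k gchoose i) (mode V (mode V u (0 + int i) v) (k + m - int i) w)) =
     (\<Sum>i<K. smul V ((-1) ^ i * (of_int 0 gchoose i))
        (mode V u (k + 0 - int i) (mode V v (m + int i) w)
         - smul V ((-1) powi 0) (mode V v (m + 0 - int i) (mode V u (k + int i) w))))"
    unfolding eventually_sequentially by blast
  define K where "K = Suc (max K0 I)"
  have "(\<Sum>i<I. smul V (of_int k gchoose i) (mode V (mode V u (int i) v) (k + m - int i) w)) =
    (\<Sum>i<K. smul V (of_int k gchoose i) (mode V (mode V u (int i) v) (k + m - int i) w))"
    by (rule sum.mono_neutral_left) (auto simp: K_def assms)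
  also have "\<dots> = (\<Sum>i<K. smul V ((-1) ^ i * (of_int 0 gchoose i))
        (mode V u (k + 0 - int i) (mode V v (m + int i) w)
         - smul V ((-1) powi 0) (mode V v (m + 0 - int i) (mode V u (k + int i) w))))"
    using K0[of K] by (simp add: K_def)
  also have "\<dots> = (\<Sum>i<K. if i = 0 then mode V u k (mode V v m w) - mode V v m (mode V u k w) else 0)"
    by (rule sum.cong) (auto simp: gchoose_zero_left)
  also have "\<dots> = mode V u k (mode V v m w) - mode V v m (mode V u k w)"
    by (simp add: K_def)
  finally show ?thesis by simp
qed

lemma vir_m1_mode: "vir V (-1) (mode V u k w) = mode V (vir V (-1) u) k w + mode V u k (vir V (-1) w)"
proof -
  obtain I where I: "\<And>n. n \<ge> int I \<Longrightarrow> mode V (conf V) n u = 0"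
    using lower_truncation[of "conf V" u] by blast
  have "mode V (conf V) 0 (mode V u k w) - mode V u k (mode V (conf V) 0 w) =
    (\<Sum>i<Suc I. smul V (of_int 0 gchoose i) (mode V (mode V (conf V) (int i) u) (0 + k - int i) w))"
    by (rule commutator) (use I in auto)
  also have "\<dots> = (\<Sum>i<Suc I. if i = 0 then mode V (mode V (conf V) 0 u) k w else 0)"
    by (rule sum.cong) (auto simp: gchoose_zero_left)
  also have "\<dots> = mode V (mode V (conf V) 0 u) k w" by simp
  finally show ?thesis by (simp add: vir_def algebra_simps)
qed

text \<open>The commutator formula for \<open>\<omega>(1) = L(0)\<close> has two terms, \<open>(L(-1)u)(k+1) = -(k+1) u(k)\<close> and \<open>(L(0)u)(k)\<close>.\<close>

lemma vir_0_mode: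
  assumes "u \<in> weight_space V h"
  shows "vir V 0 (mode V u k w) = smul V (of_int (h - k - 1)) (mode V u k w) + mode V u k (vir V 0 w)"
proof -
  obtain I where I: "\<And>n. n \<ge> int I \<Longrightarrow> mode V (conf V) n u = 0"
    using lower_truncation[of "conf V" u] by blast
  have g: "(1::complex) gchoose i = of_nat (1 choose i)" for i
    using binomial_gbinomial[of 1 i, where 'a = complex] by simp
  have "mode V (conf V) 1 (mode V u k w) - mode V u k (mode V (conf V) 1 w) =
    (\<Sum>i<Suc (Suc I). smul V (of_int 1 gchoose i) (mode V (mode V (conf V) (int i) u) (1 + k - int i) w))"
    by (rule commutator) (use I in auto)
  also have "\<dots> = (\<Sum>i\<in>{0, 1}. smul V (of_int 1 gchoose i) (mode V (mode V (conf V) (int i) u) (1 + k - int i) w))"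
    by (rule sum.mono_neutral_right) (auto simp: g binomial_eq_0)
  also have "\<dots> = mode V (vir V (-1) u) (1 + k) w + mode V (vir V 0 u) k w"
    by (simp add: vir_def)
  also have "\<dots> = smul V (- of_int (1 + k)) (mode V u k w) + smul V (of_int h) (mode V u k w)"
    using assms by (simp add: mode_vir_m1 weight_space_def mode_scale_left)
  also have "\<dots> = smul V (of_int (h - k - 1)) (mode V u k w)"
    unfolding scale_left_distrib[symmetric] by simp
  finally show ?thesis by (simp add: vir_def algebra_simps)
qed

lemma weight_space_add: "v \<in> weight_space V n \<Longrightarrow> w \<in> weight_space V n \<Longrightarrow> v + w \<in> weight_space V n"
  and weight_space_scale: "v \<in> weight_space V n \<Longrightarrow> smul V c v \<in> weight_space V n"
  and weight_space_zero [simp]: "0 \<in> weight_space V n"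
  by (auto simp: weight_space_def vir_add vir_scale scale_right_distrib mult.commute)

lemma mode_weight_space:
  assumes "u \<in> weight_space V h" and "w \<in> weight_space V m"
  shows "mode V u k w \<in> weight_space V (m + h - k - 1)"
proof -
  have "vir V 0 (mode V u k w) = smul V (of_int (h - k - 1)) (mode V u k w) + smul V (of_int m) (mode V u k w)"
    using assms(2) by (simp add: vir_0_mode[OF assms(1)] weight_space_def mode_scale_right)
  then show ?thesis
    unfolding scale_left_distrib[symmetric] by (simp add: weight_space_def algebra_simps)
qed

lemma virasoro_sl2:
  "vir V 0 (vir V 1 v) = vir V 1 (vir V 0 v) - vir V 1 v"
  "vir V 0 (vir V (-1) v) = vir V (-1) (vir V 0 v) + vir V (-1) v"
  "vir V 1 (vir V (-1) v) = vir V (-1) (vir V 1 v) + smul V 2 (vir V 0 v)"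
  and vir_m2_sl2:
  "vir V 0 (vir V (-2) v) = vir V (-2) (vir V 0 v) + smul V 2 (vir V (-2) v)"
  "vir V 1 (vir V (-2) v) = vir V (-2) (vir V 1 v) + smul V 3 (vir V (-1) v)"
proof -
  have "\<exists>C. \<forall>m n v. vir V m (vir V n v) - vir V n (vir V m v) =
        smul V (of_int (m - n)) (vir V (m + n) v)
        + (if m + n = 0 then smul V (C * of_int (m ^ 3 - m) / 12) v else 0)"
    using voa unfolding voa_def by (elim conjE)
  then obtain C where C: "\<And>m n v. vir V m (vir V n v) - vir V n (vir V m v) =
        smul V (of_int (m - n)) (vir V (m + n) v)
        + (if m + n = 0 then smul V (C * of_int (m ^ 3 - m) / 12) v else 0)"
    by blast
  show "vir V 0 (vir V 1 v) = vir V 1 (vir V 0 v) - vir V 1 v"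
    using C[of 0 1 v] by (simp add: algebra_simps)
  show "vir V 0 (vir V (-1) v) = vir V (-1) (vir V 0 v) + vir V (-1) v"
    using C[of 0 "-1" v] by (simp add: algebra_simps)
  show "vir V 1 (vir V (-1) v) = vir V (-1) (vir V 1 v) + smul V 2 (vir V 0 v)"
    using C[of 1 "-1" v] by (simp add: algebra_simps)
  show "vir V 0 (vir V (-2) v) = vir V (-2) (vir V 0 v) + smul V 2 (vir V (-2) v)"
    using C[of 0 "-2" v] by (simp add: algebra_simps)
  show "vir V 1 (vir V (-2) v) = vir V (-2) (vir V 1 v) + smul V 3 (vir V (-1) v)"
    using C[of 1 "-2" v] by (simp add: algebra_simps)
qed

lemma vir_1_weight_space: "v \<in> weight_space V n \<Longrightarrow> vir V 1 v \<in> weight_space V (n - 1)"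
  by (simp add: weight_space_def virasoro_sl2 vir_scale scale_left_diff_distrib)

lemma vir_m1_weight_space: "v \<in> weight_space V n \<Longrightarrow> vir V (-1) v \<in> weight_space V (n + 1)"
  by (simp add: weight_space_def virasoro_sl2 vir_scale scale_left_distrib)

lemma vir_1_pow_weight_space: "v \<in> weight_space V n \<Longrightarrow> (vir V 1 ^^ j) v \<in> weight_space V (n - int j)"
proof (induction j)
  case (Suc j)
  then show ?case using vir_1_weight_space[of "(vir V 1 ^^ j) v" "n - int j"] by (simp add: algebra_simps)
qed simp

lemma vir_m1_pow_weight_space: "v \<in> weight_space V n \<Longrightarrow> (vir V (-1) ^^ j) v \<in> weight_space V (n + int j)"
proof (induction j)
  case (Suc j)
  then show ?case using vir_m1_weight_space[of "(vir V (-1) ^^ j) v" "n + int j"] by (simp add: algebra_simps)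
qed simp

lemma vac_weight_space: "vac V \<in> weight_space V 0"
  by (simp add: weight_space_def vir_def mode_on_vac)

lemma conf_weight_space: "conf V \<in> weight_space V 2"
  and vir_1_conf: "vir V 1 (conf V) = 0"
proof -
  have c: "conf V = vir V (-2) (vac V)" by (simp add: vir_def mode_on_vac)
  have z: "vir V 0 (vac V) = 0" "vir V 1 (vac V) = 0" "vir V (-1) (vac V) = 0"
    by (simp_all add: vir_def mode_on_vac)
  show "conf V \<in> weight_space V 2" "vir V 1 (conf V) = 0"
    by (simp_all add: weight_space_def c vir_m2_sl2 z)
qed

lemma weight_space_bounded_below: obtains N where "\<And>n v. n < N \<Longrightarrow> v \<in> weight_space V n \<Longrightarrow> v = 0"
proof -
  have "\<exists>N. \<forall>n<N. weight_space V n = {0}" using voa unfolding voa_def by (elim conjE)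
  then obtain N where "\<forall>n<N. weight_space V n = {0}" by blast
  then show ?thesis using that[of N] by auto
qed

lemma homogeneous_induct [case_names add scale homogeneous]:
  assumes "\<And>v w. P v \<Longrightarrow> P w \<Longrightarrow> P (v + w)" and "\<And>c v. P v \<Longrightarrow> P (smul V c v)"
    and "\<And>n v. v \<in> weight_space V n \<Longrightarrow> P v"
  shows "P v"
proof -
  have "span (\<Union>n. weight_space V n) = UNIV" using voa unfolding voa_def by (elim conjE)
  then have "v \<in> span (\<Union>n. weight_space V n)" by simp
  moreover have "subspace (Collect P)"
    unfolding subspace_def using assms(1,2) assms(3)[OF weight_space_zero] by auto
  ultimately show ?thesis by (rule span_induct) (use assms(3) in auto)
qed

text \<open>The functionals for which only finitely many creating modes of a given vector matter.  They are closed
under composition with modes, and the coordinates of a homogeneous basis are among them.\<close>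

definition restricted_functional :: "('v \<Rightarrow> complex) \<Rightarrow> bool" where
  "restricted_functional f \<longleftrightarrow> (\<forall>v w. f (v + w) = f v + f w) \<and> (\<forall>c v. f (smul V c v) = c * f v) \<and>
     (\<exists>N. \<forall>n\<ge>N. \<forall>v\<in>weight_space V n. f v = 0)"

lemma restricted_add: "restricted_functional f \<Longrightarrow> f (v + w) = f v + f w"
  and restricted_scale: "restricted_functional f \<Longrightarrow> f (smul V c v) = c * f v"
  unfolding restricted_functional_def by blast+

lemma restricted_zero [simp]: "restricted_functional f \<Longrightarrow> f 0 = 0"
  using restricted_scale[of f 0 0] by simp

lemma restricted_diff: "restricted_functional f \<Longrightarrow> f (v - w) = f v - f w"
  using restricted_add[of f "v - w" w] by simp

lemma restricted_sum: "restricted_functional f \<Longrightarrow> f (\<Sum>a\<in>A. g a) = (\<Sum>a\<in>A. f (g a))"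
  by (induction A rule: infinite_finite_induct) (simp_all add: restricted_add)

text \<open>A mode \<open>u(k)\<close> with \<open>k\<close> very negative raises every weight beyond the support of \<open>f\<close>, because the
weights of \<open>V\<close> are bounded below.\<close>

lemma restricted_mode_vanishes:
  assumes "restricted_functional f"
  obtains K where "\<And>k w. k \<le> K \<Longrightarrow> f (mode V u k w) = 0"
proof -
  obtain N0 where N0: "\<And>n v. n < N0 \<Longrightarrow> v \<in> weight_space V n \<Longrightarrow> v = 0"
    using weight_space_bounded_below by blast
  obtain N where N: "\<And>n v. n \<ge> N \<Longrightarrow> v \<in> weight_space V n \<Longrightarrow> f v = 0"
    using assms unfolding restricted_functional_def by blast
  have "\<exists>K. \<forall>k\<le>K. \<forall>w. f (mode V u k w) = 0"
  proof (induction u rule: homogeneous_induct)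
    case (add u v)
    then obtain K K' where "\<forall>k\<le>K. \<forall>w. f (mode V u k w) = 0" "\<forall>k\<le>K'. \<forall>w. f (mode V v k w) = 0" by blast
    then show ?case
      by (intro exI[of _ "min K K'"]) (simp add: mode_add_left restricted_add[OF assms])
  next
    case (scale c u)
    then show ?case by (auto simp: mode_scale_left restricted_scale[OF assms])
  next
    case (homogeneous h u)
    have "f (mode V u k w) = 0" if "k \<le> h + N0 - 1 - N" for k w
    proof (induction w rule: homogeneous_induct)
      case (homogeneous m w)
      show ?case
      proof (cases "m < N0")
        case True
        then show ?thesis using N0[OF True homogeneous] assms by simp
      next
        case False
        then show ?thesis using N[OF _ mode_weight_space[OF \<open>u \<in> weight_space V h\<close> homogeneous]] that by simp
      qed
    qed (use assms in \<open>simp_all add: mode_add_right mode_scale_right restricted_add restricted_scale\<close>)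
    then show ?case by blast
  qed
  then show ?thesis using that by blast
qed

lemma restricted_comp_mode:
  assumes "restricted_functional f"
  shows "restricted_functional (\<lambda>w. f (mode V u k w))"
proof -
  obtain N where N: "\<And>n v. n \<ge> N \<Longrightarrow> v \<in> weight_space V n \<Longrightarrow> f v = 0"
    using assms unfolding restricted_functional_def by blast
  have "\<exists>N. \<forall>n\<ge>N. \<forall>v\<in>weight_space V n. f (mode V u k v) = 0"
  proof (induction u rule: homogeneous_induct)
    case (add u v)
    then obtain K K' where "\<forall>n\<ge>K. \<forall>w\<in>weight_space V n. f (mode V u k w) = 0"
      "\<forall>n\<ge>K'. \<forall>w\<in>weight_space V n. f (mode V v k w) = 0" by blast
    then show ?case
      by (intro exI[of _ "max K K'"]) (auto simp: mode_add_left restricted_add[OF assms])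
  next
    case (scale c u)
    then show ?case by (auto simp: mode_scale_left restricted_scale[OF assms])
  next
    case (homogeneous h u)
    have "f (mode V u k w) = 0" if "n \<ge> N - h + k + 1" "w \<in> weight_space V n" for n w
      using N[OF _ mode_weight_space[OF homogeneous that(2)]] that(1) by simp
    then show ?case by blast
  qed
  then show ?thesis
    using assms unfolding restricted_functional_def by (simp add: mode_add_right mode_scale_right)
qed

lemma restricted_comp_vir: "restricted_functional f \<Longrightarrow> restricted_functional (\<lambda>w. f (vir V n w))"
  unfolding vir_def by (rule restricted_comp_mode)

lemma restricted_comp_vir_pow:
  "restricted_functional f \<Longrightarrow> restricted_functional (\<lambda>w. f ((vir V n ^^ j) w))"
proof (induction j arbitrary: f)
  case (Suc j)
  then show ?case using Suc.IH[OF restricted_comp_vir[OF Suc.prems, of n]] by simp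
qed simp

lemma restricted_lin: "restricted_functional f \<Longrightarrow> restricted_functional g \<Longrightarrow>
   restricted_functional (\<lambda>w. c * f w + g w)"
proof -
  assume fg: "restricted_functional f" "restricted_functional g"
  obtain N where N: "\<And>n v. n \<ge> N \<Longrightarrow> v \<in> weight_space V n \<Longrightarrow> f v = 0"
    using fg(1) unfolding restricted_functional_def by blast
  obtain N' where N': "\<And>n v. n \<ge> N' \<Longrightarrow> v \<in> weight_space V n \<Longrightarrow> g v = 0"
    using fg(2) unfolding restricted_functional_def by blast
  have "\<exists>N. \<forall>n\<ge>N. \<forall>v\<in>weight_space V n. c * f v + g v = 0"
    by (rule exI[of _ "max N N'"]) (use N N' in auto)
  then show ?thesis
    using fg unfolding restricted_functional_def by (simp add: algebra_simps)
qed

end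

section \<open>Correlation functions defined by a recursion\<close>

text \<open>An insertion is a pair of a vector and its position; this applies an operator to the vector of the
\<open>j\<close>-th insertion.\<close>

definition map_slot :: "nat \<Rightarrow> ('v \<Rightarrow> 'v) \<Rightarrow> ('v \<times> 'c) list \<Rightarrow> ('v \<times> 'c) list" where
  "map_slot j A ps = ps[j := (A (fst (ps ! j)), snd (ps ! j))]"

lemma length_map_slot [simp]: "length (map_slot j A ps) = length ps"
  by (simp add: map_slot_def)

lemma map_slot_0 [simp]: "map_slot 0 A (p # ps) = (A (fst p), snd p) # ps"
  by (simp add: map_slot_def)

lemma map_slot_Suc [simp]: "map_slot (Suc j) A (p # ps) = p # map_slot j A ps"
  by (simp add: map_slot_def)

lemma map_slot_fst_nth: "j < length ps \<Longrightarrow> fst (map_slot j A ps ! i) = (if i = j then A (fst (ps ! j)) else fst (ps ! i))"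
  by (simp add: map_slot_def nth_list_update)

lemma snd_map_slot [simp]: "snd (map_slot j A ps ! i) = snd (ps ! i)"
  by (cases "j < length ps") (auto simp: map_slot_def nth_list_update list_update_beyond)

lemma map_snd_map_slot [simp]: "map snd (map_slot j A ps) = map snd ps"
  by (rule nth_equalityI) simp_all

lemma map_slot_swap: "i \<noteq> j \<Longrightarrow> map_slot i A (map_slot j A' ps) = map_slot j A' (map_slot i A ps)"
  unfolding map_slot_def by (simp add: list_update_swap)

lemma map_slot_map_slot: "map_slot j A (map_slot j A' ps) = map_slot j (\<lambda>v. A (A' v)) ps"
  by (cases "j < length ps") (auto simp: map_slot_def list_update_beyond)

lemma map_slot_cong: "A (fst (ps ! j)) = A' (fst (ps ! j)) \<Longrightarrow> map_slot j A ps = map_slot j A' ps"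
  by (simp add: map_slot_def)

lemma map_slot_const: "map_slot j A ps = map_slot j (\<lambda>_. A (fst (ps ! j))) ps"
  by (simp add: map_slot_def)

lemma map_slot_append: "j < length ps \<Longrightarrow> map_slot j A (ps @ qs) = map_slot j A ps @ qs"
  by (simp add: map_slot_def list_update_append nth_append)

lemma map_slot_append_right: "map_slot (length ps + j) A (ps @ qs) = ps @ map_slot j A qs"
  by (simp add: map_slot_def list_update_append)

lemma map_slot_map: "map_slot j A (map (\<lambda>(u, h). (u, F h)) us) = map (\<lambda>(u, h). (u, F h)) (map_slot j A us)"
  by (cases "j < length us") (auto simp: map_slot_def map_update list_update_beyond case_prod_beta)

lemma fst_map_conv_nth: "j < length us \<Longrightarrow> fst (map (\<lambda>(u, h). (u, F h)) us ! j) = fst (us ! j)"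
  and snd_map_conv_nth: "j < length us \<Longrightarrow> snd (map (\<lambda>(u, h). (u, F h)) us ! j) = F (snd (us ! j))"
  by (simp_all add: case_prod_beta)

context vertex_operator_algebra
begin

text \<open>The rational function represented by \<open>f (Y(u\<^sub>1,y\<^sub>1) \<cdots> Y(u\<^sub>n,y\<^sub>n) vac)\<close>.  In the first sum the creating
modes \<open>u(-1-n)\<close> of the first vector act on \<open>f\<close>; in the second one the commutators with the other
vertex operators have been summed to poles.  The annihilating modes kill the vacuum.  Both index sets are finite when \<open>f\<close> is
restricted, by \<open>restricted_mode_vanishes\<close> and lower truncation.\<close>

function correlator :: "('v \<Rightarrow> complex) \<Rightarrow> ('v \<times> complex) list \<Rightarrow> complex" where
  "correlator f [] = f (vac V)"
| "correlator f (p # ps) =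
     (\<Sum>n | (\<lambda>w. f (mode V (fst p) (-1 - int n) w)) \<noteq> (\<lambda>_. 0).
        snd p ^ n * correlator (\<lambda>w. f (mode V (fst p) (-1 - int n) w)) ps) +
     (\<Sum>j<length ps. \<Sum>i | mode V (fst p) (int i) (fst (ps ! j)) \<noteq> 0.
        correlator f (map_slot j (mode V (fst p) (int i)) ps) / (snd p - snd (ps ! j)) ^ Suc i)"
  by pat_completeness auto
termination by (relation "Wellfounded.measure (\<lambda>(f, ps). length ps)") auto

lemma correlator_zero_functional: "correlator (\<lambda>_. 0) ps = 0"
proof (induction "length ps" arbitrary: ps)
  case (Suc n)
  then obtain p qs where ps: "ps = p # qs" "length qs = n" by (cases ps) auto
  show ?case unfolding ps(1) by (simp add: Suc.hyps(1) ps(2))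
qed simp

lemma correlator_zero_slot:
  assumes "restricted_functional f" and "j < length ps"
  shows "correlator f (map_slot j (\<lambda>_. 0) ps) = 0"
  using assms
proof (induction "length ps" arbitrary: f j ps)
  case (Suc n)
  then obtain p qs where ps: "ps = p # qs" and n: "length qs = n" by (cases ps) auto
  show ?case
  proof (cases j)
    case 0
    then show ?thesis using Suc.prems by (simp add: ps)
  next
    case (Suc l)
    with Suc.prems ps have l: "l < length qs" by simp
    have 1: "correlator (\<lambda>w. f (mode V (fst p) (-1 - int m) w)) (map_slot l (\<lambda>_. 0) qs) = 0" for m
      by (rule Suc.hyps(1)[OF n[symmetric] restricted_comp_mode[OF Suc.prems(1)] l])
    have 2: "(\<Sum>i | mode V (fst p) (int i) (fst (map_slot l (\<lambda>_. 0) qs ! k)) \<noteq> 0.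
        correlator f (map_slot k (mode V (fst p) (int i)) (map_slot l (\<lambda>_. 0) qs)) / (snd p - snd (qs ! k)) ^ Suc i) = 0" for k
    proof (cases "k = l")
      case True
      then show ?thesis using l by (simp add: map_slot_fst_nth)
    next
      case False
      then show ?thesis
        using Suc.hyps(1)[of "map_slot k A qs" f l for A] Suc.prems(1) n l
        by (simp add: map_slot_swap)
    qed
    show ?thesis unfolding ps Suc map_slot_Suc correlator.simps 1 by (simp add: 2[simplified])
  qed
qed simp

declare correlator.simps(2) [simp del]

text \<open>The index sets in the recursion depend on \<open>f\<close> and on the vectors, which is inconvenient when several
correlators are compared.  Truncated at \<open>K\<close>, the recursion has fixed index sets and holds for
all large \<open>K\<close>.\<close>

definition recursion_sum :: "('v \<Rightarrow> complex) \<Rightarrow> 'v \<times> complex \<Rightarrow> ('v \<times> complex) list \<Rightarrow> nat \<Rightarrow> complex" where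
  "recursion_sum f p ps K =
     (\<Sum>n<K. snd p ^ n * correlator (\<lambda>w. f (mode V (fst p) (-1 - int n) w)) ps) +
     (\<Sum>j<length ps. \<Sum>i<K.
        correlator f (map_slot j (mode V (fst p) (int i)) ps) / (snd p - snd (ps ! j)) ^ Suc i)"

lemma correlator_eq_recursion_sum:
  assumes f: "restricted_functional f"
    and fz: "\<And>n w. n \<ge> K \<Longrightarrow> f (mode V (fst p) (-1 - int n) w) = 0"
    and uz: "\<And>i j. i \<ge> K \<Longrightarrow> j < length ps \<Longrightarrow> mode V (fst p) (int i) (fst (ps ! j)) = 0"
  shows "correlator f (p # ps) = recursion_sum f p ps K"
proof -
  have "(\<Sum>n | (\<lambda>w. f (mode V (fst p) (-1 - int n) w)) \<noteq> (\<lambda>_. 0).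
      snd p ^ n * correlator (\<lambda>w. f (mode V (fst p) (-1 - int n) w)) ps) =
    (\<Sum>n<K. snd p ^ n * correlator (\<lambda>w. f (mode V (fst p) (-1 - int n) w)) ps)"
  proof (rule sum.mono_neutral_left)
    show "{n. (\<lambda>w. f (mode V (fst p) (-1 - int n) w)) \<noteq> (\<lambda>_. 0)} \<subseteq> {..<K}"
    proof
      fix n assume "n \<in> {n. (\<lambda>w. f (mode V (fst p) (-1 - int n) w)) \<noteq> (\<lambda>_. 0)}"
      then show "n \<in> {..<K}" using fz[of n] by (cases "n < K") auto
    qed
    show "\<forall>n\<in>{..<K} - {n. (\<lambda>w. f (mode V (fst p) (-1 - int n) w)) \<noteq> (\<lambda>_. 0)}.
      snd p ^ n * correlator (\<lambda>w. f (mode V (fst p) (-1 - int n) w)) ps = 0"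
      using correlator_zero_functional by fastforce
  qed simp
  moreover have "(\<Sum>i | mode V (fst p) (int i) (fst (ps ! j)) \<noteq> 0.
      correlator f (map_slot j (mode V (fst p) (int i)) ps) / (snd p - snd (ps ! j)) ^ Suc i) =
    (\<Sum>i<K. correlator f (map_slot j (mode V (fst p) (int i)) ps) / (snd p - snd (ps ! j)) ^ Suc i)"
    if j: "j < length ps" for j
  proof (rule sum.mono_neutral_left)
    show "{i. mode V (fst p) (int i) (fst (ps ! j)) \<noteq> 0} \<subseteq> {..<K}"
    proof
      fix i assume "i \<in> {i. mode V (fst p) (int i) (fst (ps ! j)) \<noteq> 0}"
      then show "i \<in> {..<K}" using uz[of i j] j by (cases "i < K") auto
    qed
    show "\<forall>i\<in>{..<K} - {i. mode V (fst p) (int i) (fst (ps ! j)) \<noteq> 0}.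
      correlator f (map_slot j (mode V (fst p) (int i)) ps) / (snd p - snd (ps ! j)) ^ Suc i = 0"
      using correlator_zero_slot[OF f j] by (subst map_slot_const) auto
  qed simp
  ultimately show ?thesis by (simp add: recursion_sum_def correlator.simps(2))
qed

lemma eventually_recursion_bound:
  assumes f: "restricted_functional f"
  shows "\<forall>\<^sub>F K in sequentially. (\<forall>n\<ge>K. \<forall>w. f (mode V u (-1 - int n) w) = 0) \<and>
    (\<forall>i\<ge>K. \<forall>v\<in>set vs. mode V u (int i) v = 0)"
proof -
  obtain K1 where K1: "\<And>k w. k \<le> K1 \<Longrightarrow> f (mode V u k w) = 0"
    using restricted_mode_vanishes[OF f] by blast
  have "\<exists>N. \<forall>n\<ge>N. mode V u (int n) v = 0" for v
    using lower_truncation[of u v] by (meson zle_int)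
  then obtain N where N: "\<And>v n. n \<ge> N v \<Longrightarrow> mode V u (int n) v = 0" by metis
  define K0 where "K0 = Max (insert (nat (- K1)) (N ` set vs))"
  have a: "nat (- K1) \<le> K0" and b: "\<And>v. v \<in> set vs \<Longrightarrow> N v \<le> K0"
    unfolding K0_def by (auto intro!: Max_ge)
  have "f (mode V u (-1 - int n) w) = 0" if "n \<ge> K0" for n w
    by (rule K1) (use that a in linarith)
  moreover have "mode V u (int i) v = 0" if "i \<ge> K0" "v \<in> set vs" for i v
    by (rule N) (use that b[of v] in linarith)
  ultimately show ?thesis
    unfolding eventually_sequentially by (intro exI[of _ K0]) (auto simp: le_trans)
qed

lemma eventually_correlator_Cons:
  assumes "restricted_functional f"
  shows "\<forall>\<^sub>F K in sequentially. correlator f (p # ps) = recursion_sum f p ps K"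
  using eventually_recursion_bound[OF assms, of "fst p" "map fst ps"]
  by eventually_elim (rule correlator_eq_recursion_sum[OF assms]; auto)

lemma correlator_lin_functional:
  assumes "restricted_functional f" and "restricted_functional g"
  shows "correlator (\<lambda>w. c * f w + g w) ps = c * correlator f ps + correlator g ps"
  using assms
proof (induction "length ps" arbitrary: f g ps)
  case (Suc n)
  then obtain p qs where ps: "ps = p # qs" and n: "length qs = n" by (cases ps) auto
  let ?h = "\<lambda>w. c * f w + g w"
  have h: "restricted_functional ?h" by (rule restricted_lin[OF Suc.prems])
  have ih: "length rs = length qs \<Longrightarrow> restricted_functional f' \<Longrightarrow> restricted_functional g' \<Longrightarrow>
      correlator (\<lambda>w. c * f' w + g' w) rs = c * correlator f' rs + correlator g' rs" for rs f' g'
    using Suc.hyps(1)[of rs f' g'] n by simp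
  have 1: "correlator (\<lambda>w. c * f (mode V u k w) + g (mode V u k w)) qs =
     c * correlator (\<lambda>w. f (mode V u k w)) qs + correlator (\<lambda>w. g (mode V u k w)) qs" for u k
    by (rule ih) (simp_all add: restricted_comp_mode Suc.prems)
  have 2: "correlator ?h (map_slot j A qs) = c * correlator f (map_slot j A qs) + correlator g (map_slot j A qs)" for j A
    by (rule ih) (simp_all add: Suc.prems)
  have sum: "recursion_sum ?h p qs K = c * recursion_sum f p qs K + recursion_sum g p qs K" for K
    unfolding recursion_sum_def 1 2
    by (simp add: sum.distrib sum_distrib_left algebra_simps add_divide_distrib)
  have "\<forall>\<^sub>F K in sequentially. correlator ?h ps = c * correlator f ps + correlator g ps"
    using eventually_correlator_Cons[OF h, of p qs] eventually_correlator_Cons[OF Suc.prems(1), of p qs]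
      eventually_correlator_Cons[OF Suc.prems(2), of p qs]
    by eventually_elim (simp only: ps sum)
  then show ?case by simp
qed simp

lemma restricted_zero_functional: "restricted_functional (\<lambda>_. 0)"
  by (simp add: restricted_functional_def)

lemma correlator_add_functional:
  "restricted_functional f \<Longrightarrow> restricted_functional g \<Longrightarrow>
   correlator (\<lambda>w. f w + g w) ps = correlator f ps + correlator g ps"
  using correlator_lin_functional[of f g 1] by simp

lemma correlator_scale_functional:
  "restricted_functional f \<Longrightarrow> correlator (\<lambda>w. c * f w) ps = c * correlator f ps"
  using correlator_lin_functional[of f "\<lambda>_. 0" c] by (simp add: correlator_zero_functional restricted_zero_functional)

lemma correlator_lin_slot:
  assumes "restricted_functional f" and "j < length ps"
  shows "correlator f (map_slot j (\<lambda>v. smul V c (A v) + A' v) ps) =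
     c * correlator f (map_slot j A ps) + correlator f (map_slot j A' ps)"
  using assms
proof (induction "length ps" arbitrary: f j ps A A')
  case (Suc n)
  then obtain p qs where ps: "ps = p # qs" and n: "length qs = n" by (cases ps) auto
  note f = Suc.prems(1)
  note ev = eventually_correlator_Cons[OF f]
  have ih: "restricted_functional g \<Longrightarrow> length rs = n \<Longrightarrow> i < n \<Longrightarrow>
      correlator g (map_slot i (\<lambda>v. smul V c (C v) + C' v) rs) =
      c * correlator g (map_slot i C rs) + correlator g (map_slot i C' rs)" for g i C C' rs
    using Suc.hyps(1)[of rs g i C C'] by simp
  show ?case
  proof (cases j)
    case 0
    let ?a = "A (fst p)" and ?b = "A' (fst p)" and ?y = "snd p"
    have 1: "correlator (\<lambda>w. f (mode V (smul V c ?a + ?b) k w)) qs =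
      c * correlator (\<lambda>w. f (mode V ?a k w)) qs + correlator (\<lambda>w. f (mode V ?b k w)) qs" for k
      using correlator_lin_functional[OF restricted_comp_mode[OF f, of ?a k] restricted_comp_mode[OF f, of ?b k]]
      by (simp add: mode_add_left mode_scale_left restricted_add[OF f] restricted_scale[OF f])
    have 2: "correlator f (map_slot j (mode V (smul V c ?a + ?b) k) qs) =
      c * correlator f (map_slot j (mode V ?a k) qs) + correlator f (map_slot j (mode V ?b k) qs)"
      if "j < length qs" for j k
    proof -
      have "mode V (smul V c ?a + ?b) k = (\<lambda>v. smul V c (mode V ?a k v) + mode V ?b k v)"
        by (simp add: fun_eq_iff mode_add_left mode_scale_left)
      then show ?thesis
        using ih[OF f, of qs j "mode V ?a k" "mode V ?b k"] n that by simp
    qed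
    have sum: "recursion_sum f (smul V c ?a + ?b, ?y) qs K =
        c * recursion_sum f (?a, ?y) qs K + recursion_sum f (?b, ?y) qs K" for K
    proof -
      have "(\<Sum>j<length qs. \<Sum>i<K. correlator f (map_slot j (mode V (smul V c ?a + ?b) (int i)) qs) / (?y - snd (qs ! j)) ^ Suc i) =
        c * (\<Sum>j<length qs. \<Sum>i<K. correlator f (map_slot j (mode V ?a (int i)) qs) / (?y - snd (qs ! j)) ^ Suc i) +
        (\<Sum>j<length qs. \<Sum>i<K. correlator f (map_slot j (mode V ?b (int i)) qs) / (?y - snd (qs ! j)) ^ Suc i)"
        by (simp add: 2 sum.distrib sum_distrib_left add_divide_distrib)
      moreover have "(\<Sum>n<K. ?y ^ n * correlator (\<lambda>w. f (mode V (smul V c ?a + ?b) (-1 - int n) w)) qs) =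
        c * (\<Sum>n<K. ?y ^ n * correlator (\<lambda>w. f (mode V ?a (-1 - int n) w)) qs) +
        (\<Sum>n<K. ?y ^ n * correlator (\<lambda>w. f (mode V ?b (-1 - int n) w)) qs)"
        unfolding 1 by (simp add: sum.distrib sum_distrib_left distrib_left mult.left_commute)
      ultimately show ?thesis
        unfolding recursion_sum_def fst_conv snd_conv by (simp only: distrib_left add_ac)
    qed
    have "\<forall>\<^sub>F K in sequentially. correlator f ((smul V c ?a + ?b, ?y) # qs) =
        c * correlator f ((?a, ?y) # qs) + correlator f ((?b, ?y) # qs)"
      using ev[of "(smul V c ?a + ?b, ?y)" qs] ev[of "(?a, ?y)" qs] ev[of "(?b, ?y)" qs]
      by eventually_elim (simp only: sum)
    then show ?thesis by (simp add: ps 0)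
  next
    case (Suc l)
    with Suc.prems ps n have l: "l < n" by simp
    let ?B = "\<lambda>v. smul V c (A v) + A' v"
    have 1: "correlator (\<lambda>w. f (mode V u k w)) (map_slot l ?B qs) =
      c * correlator (\<lambda>w. f (mode V u k w)) (map_slot l A qs) +
      correlator (\<lambda>w. f (mode V u k w)) (map_slot l A' qs)" for u k
      by (rule ih) (use n l f in \<open>auto simp: restricted_comp_mode\<close>)
    have 2: "correlator f (map_slot j (mode V u k) (map_slot l ?B qs)) =
      c * correlator f (map_slot j (mode V u k) (map_slot l A qs)) +
      correlator f (map_slot j (mode V u k) (map_slot l A' qs))" for u j k
    proof (cases "j = l")
      case True
      show ?thesis
        unfolding True map_slot_map_slot mode_add_right mode_scale_right
        by (rule ih) (use n l f in auto)
    next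
      case False
      show ?thesis
        unfolding map_slot_swap[OF False]
        by (rule ih) (use n l f in auto)
    qed
    have sum: "recursion_sum f p (map_slot l ?B qs) K =
        c * recursion_sum f p (map_slot l A qs) K + recursion_sum f p (map_slot l A' qs) K" for K
      unfolding recursion_sum_def 1 2 length_map_slot snd_map_slot
      by (simp add: sum.distrib sum_distrib_left algebra_simps add_divide_distrib)
    have "\<forall>\<^sub>F K in sequentially. correlator f (p # map_slot l ?B qs) =
        c * correlator f (p # map_slot l A qs) + correlator f (p # map_slot l A' qs)"
      using ev[of p "map_slot l ?B qs"] ev[of p "map_slot l A qs"] ev[of p "map_slot l A' qs"]
      by eventually_elim (simp only: sum)
    then show ?thesis by (simp only: ps Suc map_slot_Suc eventually_const trivial_limit_sequentially simp_thms)
  qed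
qed simp

lemma correlator_add_slot:
  "restricted_functional f \<Longrightarrow> j < length ps \<Longrightarrow> correlator f (map_slot j (\<lambda>v. A v + A' v) ps) =
     correlator f (map_slot j A ps) + correlator f (map_slot j A' ps)"
  using correlator_lin_slot[of f j ps 1 A A'] by simp

lemma correlator_scale_slot:
  "restricted_functional f \<Longrightarrow> j < length ps \<Longrightarrow> correlator f (map_slot j (\<lambda>v. smul V c (A v)) ps) =
     c * correlator f (map_slot j A ps)"
  using correlator_lin_slot[of f j ps c A "\<lambda>_. 0"] correlator_zero_slot[of f j ps] by simp

end

section \<open>Convergence of the mode series and symmetry of the correlation functions\<close>

context vertex_operator_algebra
begin

abbreviation product_term :: "('v \<times> complex) list \<Rightarrow> int list \<Rightarrow> 'v \<Rightarrow> 'v" where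
  "product_term ps ks c \<equiv> insertions V (map fst ps) (map snd ps) ks c"

lemma product_term_append:
  "length ks = length ps \<Longrightarrow> product_term (ps @ qs) (ks @ ls) c = product_term ps ks (product_term qs ls c)"
  by (induction ps ks rule: list_induct2') auto

lemma product_term_add: "product_term ps ks (c + c') = product_term ps ks c + product_term ps ks c'"
  and product_term_scale: "product_term ps ks (smul V a c) = smul V a (product_term ps ks c)"
  by (induction ps ks rule: list_induct2')
    (auto simp: mode_add_right mode_scale_right scale_right_distrib mult.commute)

lemma product_term_zero [simp]: "product_term ps ks 0 = 0"
  using product_term_scale[of ps ks 0 0] by simp

lemma mode_sum_right: "mode V u k (\<Sum>a\<in>A. g a) = (\<Sum>a\<in>A. mode V u k (g a))"
  by (induction A rule: infinite_finite_induct) (simp_all add: mode_add_right)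

lemma product_term_sum: "product_term ps ks (\<Sum>a\<in>A. g a) = (\<Sum>a\<in>A. product_term ps ks (g a))"
  by (induction A rule: infinite_finite_induct) (simp_all add: product_term_add)

text \<open>Commuting \<open>u(k)\<close> through a product of modes.  The mode \<open>(u(i)u\<^sub>j)(k + l - i)\<close> arising from \<open>u\<^sub>j(l)\<close> is again a
term of a product of vertex operators, with label \<open>k + l - i\<close>, once the power of \<open>y\<^sub>j\<close> is
adjusted.\<close>

lemma mode_product_term:
  assumes "length ks = length ps" and "\<And>j. j < length ps \<Longrightarrow> snd (ps ! j) \<noteq> 0"
    and "\<And>j i. j < length ps \<Longrightarrow> i \<ge> I \<Longrightarrow> mode V u (int i) (fst (ps ! j)) = 0"
  shows "mode V u k (product_term ps ks c) = product_term ps ks (mode V u k c) +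
    (\<Sum>j<length ps. \<Sum>i<I. smul V ((of_int k gchoose i) * snd (ps ! j) powi (k - int i))
      (product_term (map_slot j (mode V u (int i)) ps) (ks[j := ks ! j + k - int i]) c))"
  using assms
proof (induction ks ps rule: list_induct2)
  case (Cons l ks p ps)
  obtain v y where p: "p = (v, y)" by (cases p)
  let ?X = "product_term ps ks c"
  have y: "y \<noteq> 0" using Cons.prems(1)[of 0] by (simp add: p)
  have z: "mode V u (int i) v = 0" if "i \<ge> I" for i
    using Cons.prems(2)[of 0 i] that by (simp add: p)
  have ih: "mode V u k ?X = product_term ps ks (mode V u k c) +
    (\<Sum>j<length ps. \<Sum>i<I. smul V ((of_int k gchoose i) * snd (ps ! j) powi (k - int i))
      (product_term (map_slot j (mode V u (int i)) ps) (ks[j := ks ! j + k - int i]) c))"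
    by (rule Cons.IH) (use Cons.prems[of "Suc j" for j] in auto)
  have "mode V u k (mode V v l ?X) = mode V v l (mode V u k ?X) +
      (\<Sum>i<I. smul V (of_int k gchoose i) (mode V (mode V u (int i) v) (k + l - int i) ?X))"
    using commutator[of I u v k l ?X] z by (simp add: algebra_simps)
  then have "mode V u k (product_term (p # ps) (l # ks) c) =
    smul V (y powi (- l - 1)) (mode V v l (mode V u k ?X)) +
    (\<Sum>i<I. smul V ((of_int k gchoose i) * y powi (- l - 1)) (mode V (mode V u (int i) v) (k + l - int i) ?X))"
    by (simp add: p mode_scale_right scale_right_distrib scale_sum_right mult.commute)
  also have "(\<Sum>i<I. smul V ((of_int k gchoose i) * y powi (- l - 1)) (mode V (mode V u (int i) v) (k + l - int i) ?X)) =
    (\<Sum>i<I. smul V ((of_int k gchoose i) * y powi (k - int i))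
       (product_term (map_slot 0 (mode V u (int i)) (p # ps)) ((l # ks)[0 := (l # ks) ! 0 + k - int i]) c))"
  proof (rule sum.cong)
    fix i
    have "y powi (k - int i) * y powi (- (k + l - int i) - 1) = y powi (k - int i + (- (k + l - int i) - 1))"
      using y by (subst power_int_add) auto
    also have "k - int i + (- (k + l - int i) - 1) = - l - 1" by simp
    finally have e: "y powi (- l - 1) = y powi (k - int i) * y powi (- (k + l - int i) - 1)" by simp
    show "smul V ((of_int k gchoose i) * y powi (- l - 1)) (mode V (mode V u (int i) v) (k + l - int i) ?X) =
      smul V ((of_int k gchoose i) * y powi (k - int i))
       (product_term (map_slot 0 (mode V u (int i)) (p # ps)) ((l # ks)[0 := (l # ks) ! 0 + k - int i]) c)"
      unfolding e by (simp add: p add.commute[of k l] mult.assoc)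
  qed simp
  also have "smul V (y powi (- l - 1)) (mode V v l (mode V u k ?X)) =
    product_term (p # ps) (l # ks) (mode V u k c) +
    (\<Sum>j<length ps. \<Sum>i<I. smul V ((of_int k gchoose i) * snd ((p # ps) ! Suc j) powi (k - int i))
      (product_term (map_slot (Suc j) (mode V u (int i)) (p # ps)) ((l # ks)[Suc j := (l # ks) ! Suc j + k - int i]) c))"
    unfolding ih by (simp add: p mode_add_right scale_right_distrib mode_sum_right mode_scale_right scale_sum_right mult.commute)
  finally show ?case
    by (simp add: lessThan_Suc_eq_insert_0 sum.insert zero_notin_Suc_image sum.reindex add_ac p del: map_slot_Suc map_slot_0 insertions.simps)
qed simp

text \<open>The vertex operator of \<open>b\<close> stands at an arbitrary place of the product, while the limit has \<open>b\<close> in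
front.  Creating modes of \<open>b\<close> are moved to the left through \<open>ps1\<close>, annihilating ones to the right
through \<open>ps2\<close>.  For every other insertion the labels that remain after the shift
\<open>k + l - i\<close> run over all integers independently of \<open>k\<close>, so the double series factors into the
expansion of a pole in the region where it converges and a series with one insertion less.\<close>

lemma insertion_has_sum:
  fixes ps1 ps2 :: "('v \<times> complex) list" and b c :: 'v and x :: complex
  defines "ps \<equiv> ps1 @ ps2"
  assumes f: "restricted_functional f" and x: "x \<noteq> 0"
    and nz: "\<And>j. j < length ps \<Longrightarrow> snd (ps ! j) \<noteq> 0"
    and outer: "\<And>j. j < length ps1 \<Longrightarrow> cmod x < cmod (snd (ps ! j))"
    and inner: "\<And>j. length ps1 \<le> j \<Longrightarrow> j < length ps \<Longrightarrow> cmod (snd (ps ! j)) < cmod x"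
    and IH: "\<And>g rs d. restricted_functional g \<Longrightarrow> map snd rs = map snd ps \<Longrightarrow>
      ((\<lambda>ks. g (product_term rs ks d)) has_sum correlator g (rs @ [(d, 0)])) {ks. length ks = length ps}"
  shows "((\<lambda>ks. f (product_term (ps1 @ (b, x) # ps2) ks c)) has_sum
      correlator f ((b, x) # ps @ [(c, 0)])) {ks. length ks = Suc (length ps)}"
proof -
  let ?n = "length ps" and ?p = "length ps1" and ?qs = "ps @ [(c, 0)]"
  let ?L = "{ks :: int list. length ks = ?n}"
  let ?y = "\<lambda>j. snd (ps ! j)"
  let ?at = "\<lambda>j i. map_slot j (mode V b (int i)) ps"
  obtain K where K: "correlator f ((b, x) # ?qs) =
     (\<Sum>n<K. x ^ n * correlator (\<lambda>w. f (mode V b (-1 - int n) w)) ?qs) +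
     (\<Sum>j<length ?qs. \<Sum>i<K. correlator f (map_slot j (mode V b (int i)) ?qs) / (x - snd (?qs ! j)) ^ Suc i)"
    "\<And>M w. M \<ge> K \<Longrightarrow> f (mode V b (-1 - int M) w) = 0"
    "\<And>M j. M \<ge> K \<Longrightarrow> j < length ?qs \<Longrightarrow> mode V b (int M) (fst (?qs ! j)) = 0"
  proof -
    obtain K where K: "\<forall>n\<ge>K. \<forall>w. f (mode V b (-1 - int n) w) = 0"
        "\<forall>i\<ge>K. \<forall>v\<in>set (map fst ?qs). mode V b (int i) v = 0"
      using eventually_happens'[OF _ eventually_recursion_bound[OF f, of b "map fst ?qs"]] by auto
    have Kv: "mode V b (int i) (fst (?qs ! j)) = 0" if "i \<ge> K" "j < length ?qs" for i j
      using K(2) that nth_mem[of j ?qs] by (metis list.set_map imageI)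
    have "correlator f ((b, x) # ?qs) = recursion_sum f (b, x) ?qs K"
      by (rule correlator_eq_recursion_sum[OF f]) (use K(1) Kv in auto)
    then show ?thesis
      using that[of K] K(1) Kv by (simp add: recursion_sum_def)
  qed
  have Kc: "mode V b (int M) c = 0" if "M \<ge> K" for M
    using K(3)[OF that, of ?n] by simp
  have Kp: "mode V b (int M) (fst (ps ! j)) = 0" if "M \<ge> K" "j < ?n" for M j
    using K(3)[OF that(1), of j] that(2) by (simp add: nth_append)
  define ker where "ker j i k = (if j < ?p \<longleftrightarrow> k < 0
      then (if k < 0 then -1 else 1) * ((of_int k gchoose i) * ?y j powi (k - int i) * x powi (- k - 1)) else 0)" for j i k
  have ker: "(ker j i has_sum 1 / (x - ?y j) ^ Suc i) UNIV" if j: "j < ?n" for i j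
  proof (cases "j < ?p")
    case True
    have "((\<lambda>k. - ((of_int k gchoose i) * ?y j powi (k - int i) * x powi (- k - 1))) has_sum 1 / (x - ?y j) ^ Suc i) {..<0}"
      by (rule pole_expansion_inside[OF outer[OF True] x])
    also have "?this \<longleftrightarrow> ?thesis"
      by (rule has_sum_cong_neutral) (auto simp: ker_def True)
    finally show ?thesis .
  next
    case False
    have "((\<lambda>k. (of_int k gchoose i) * ?y j powi (k - int i) * x powi (- k - 1)) has_sum 1 / (x - ?y j) ^ Suc i) {0..}"
      by (rule pole_expansion_outside[OF inner nz]) (use False j in auto)
    also have "?this \<longleftrightarrow> ?thesis"
      by (rule has_sum_cong_neutral) (auto simp: ker_def False)
    finally show ?thesis .
  qed
  \<comment> \<open>\<open>S1\<close>: creating modes that reach \<open>f\<close>; \<open>S2\<close>: annihilating modes that reach \<open>c\<close>;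
    \<open>S3 j i\<close>: the \<open>i\<close>-th term of the commutator with the \<open>j\<close>-th insertion.\<close>
  define S1 where "S1 = (\<lambda>n (k, ks). (if k = - 1 - int n then x ^ n else 0) * f (mode V b (- 1 - int n) (product_term ps ks c)))"
  define S2 where "S2 = (\<lambda>i (k, ks). (if k = int i then x powi (- int i - 1) else 0) * f (product_term ps ks (mode V b (int i) c)))"
  define S3 where "S3 = (\<lambda>j i (k, ks). ker j i k * f (product_term (?at j i) (ks[j := ks ! j + k - int i]) c))"
  have S1: "(S1 n has_sum x ^ n * correlator (\<lambda>w. f (mode V b (-1 - int n) w)) ?qs) (UNIV \<times> ?L)" for n
    unfolding S1_def by (rule has_sum_complex_times[OF has_sum_single IH[OF restricted_comp_mode[OF f]]]) simp
  have S2: "(S2 i has_sum x powi (- int i - 1) * correlator f (ps @ [(mode V b (int i) c, 0)])) (UNIV \<times> ?L)" for i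
    unfolding S2_def by (rule has_sum_complex_times[OF has_sum_single IH[OF f]]) simp
  have S3: "(S3 j i has_sum 1 / (x - ?y j) ^ Suc i * correlator f (map_slot j (mode V b (int i)) ps @ [(c, 0)])) (UNIV \<times> ?L)"
    if j: "j < ?n" for j i
  proof -
    have "((\<lambda>(k, ks). ker j i k * f (product_term (?at j i) ks c)) has_sum
       1 / (x - ?y j) ^ Suc i * correlator f (map_slot j (mode V b (int i)) ps @ [(c, 0)])) (UNIV \<times> ?L)"
      by (rule has_sum_complex_times[OF ker[OF j] IH[OF f]]) simp
    also have "?this \<longleftrightarrow> ?thesis"
      by (rule sym, rule has_sum_reindex_bij_witness
          [where j = "\<lambda>(k, ks). (k, ks[j := ks ! j + k - int i])" and i = "\<lambda>(k, ks). (k, ks[j := ks ! j - k + int i])"])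
        (use j in \<open>auto simp: S3_def\<close>)
    finally show ?thesis .
  qed
  have total: "((\<lambda>z. (\<Sum>n<K. S1 n z) + ((\<Sum>j<?n. \<Sum>i<K. S3 j i z) + (\<Sum>i<K. S2 i z))) has_sum
      correlator f ((b, x) # ?qs)) (UNIV \<times> ?L)"
  proof -
    have "correlator f ((b, x) # ?qs) = (\<Sum>n<K. x ^ n * correlator (\<lambda>w. f (mode V b (-1 - int n) w)) ?qs) +
      ((\<Sum>j<?n. \<Sum>i<K. 1 / (x - ?y j) ^ Suc i * correlator f (map_slot j (mode V b (int i)) ps @ [(c, 0)])) +
       (\<Sum>i<K. x powi (- int i - 1) * correlator f (ps @ [(mode V b (int i) c, 0)])))"
    proof -
      have "(\<Sum>j<?n. \<Sum>i<K. correlator f (map_slot j (mode V b (int i)) ?qs) / (x - snd (?qs ! j)) ^ Suc i) =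
        (\<Sum>j<?n. \<Sum>i<K. 1 / (x - ?y j) ^ Suc i * correlator f (map_slot j (mode V b (int i)) ps @ [(c, 0)]))"
        by (intro sum.cong) (auto simp: map_slot_append nth_append)
      moreover have "(\<Sum>i<K. correlator f (map_slot ?n (mode V b (int i)) ?qs) / (x - snd (?qs ! ?n)) ^ Suc i) =
        (\<Sum>i<K. x powi (- int i - 1) * correlator f (ps @ [(mode V b (int i) c, 0)]))"
      proof (rule sum.cong)
        fix i
        have "x powi (- int i - 1) = 1 / x ^ Suc i"
          using x by (simp add: power_int_diff power_int_minus field_simps power_int_of_nat)
        then show "correlator f (map_slot ?n (mode V b (int i)) ?qs) / (x - snd (?qs ! ?n)) ^ Suc i =
          x powi (- int i - 1) * correlator f (ps @ [(mode V b (int i) c, 0)])"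
          using map_slot_append_right[of ps 0 "mode V b (int i)" "[(c, 0)]"] by simp
      qed simp
      ultimately show ?thesis unfolding K(1) by simp
    qed
    then show ?thesis
      by (simp only:) (intro has_sum_add has_sum_finite_sum S1 S2 S3; simp)
  qed
  have pointwise: "f (product_term (ps1 @ (b, x) # ps2) (take ?p ks @ k # drop ?p ks) c) =
      (\<Sum>n<K. S1 n (k, ks)) + ((\<Sum>j<?n. \<Sum>i<K. S3 j i (k, ks)) + (\<Sum>i<K. S2 i (k, ks)))"
    if ks: "length ks = ?n" for k ks
  proof -
    define ks1 where "ks1 = take ?p ks"
    define ks2 where "ks2 = drop ?p ks"
    have len: "length ks1 = ?p" "length ks2 = length ps2" "ks = ks1 @ ks2"
      using ks by (auto simp: ks1_def ks2_def ps_def)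
    let ?u = "\<lambda>j i. f (product_term (?at j i) (ks[j := ks ! j + k - int i]) c)"
    let ?g = "\<lambda>j i. (of_int k gchoose i) * ?y j powi (k - int i)"
    have lhs: "f (product_term (ps1 @ (b, x) # ps2) (ks1 @ k # ks2) c) =
      x powi (- k - 1) * f (product_term ps1 ks1 (mode V b k (product_term ps2 ks2 c)))"
      using product_term_append[of ks1 ps1 "(b, x) # ps2" "k # ks2" c] len
      by (simp add: product_term_scale restricted_scale[OF f])
    show ?thesis
    proof (cases "k < 0")
      case True
      have 1: "(\<Sum>n<K. S1 n (k, ks)) = x powi (- k - 1) * f (mode V b k (product_term ps ks c))"
      proof -
        define N where "N = nat (- 1 - k)"
        have N: "k = - 1 - int N" using True by (simp add: N_def)
        have "(\<Sum>n<K. S1 n (k, ks)) = (\<Sum>n<K. if n = N then x ^ N * f (mode V b k (product_term ps ks c)) else 0)"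
          by (rule sum.cong) (auto simp: S1_def N)
        also have "\<dots> = x ^ N * f (mode V b k (product_term ps ks c))"
          using K(2)[of N] by (cases "N < K") (auto simp: N not_less)
        also have "x ^ N = x powi (- k - 1)" by (simp add: N power_int_of_nat)
        finally show ?thesis .
      qed
      have 2: "(\<Sum>i<K. S2 i (k, ks)) = 0"
        using True by (auto simp: S2_def intro!: sum.neutral)
      have "mode V b k (product_term ps1 ks1 (product_term ps2 ks2 c)) = product_term ps1 ks1 (mode V b k (product_term ps2 ks2 c)) +
        (\<Sum>j<?p. \<Sum>i<K. smul V ((of_int k gchoose i) * snd (ps1 ! j) powi (k - int i))
          (product_term (map_slot j (mode V b (int i)) ps1) (ks1[j := ks1 ! j + k - int i]) (product_term ps2 ks2 c)))"
      proof (rule mode_product_term)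
        fix j assume j: "j < length ps1"
        have e: "ps1 ! j = ps ! j" "j < ?n" using j by (simp_all add: ps_def nth_append)
        show "snd (ps1 ! j) \<noteq> 0" unfolding e(1) by (rule nz[OF e(2)])
        show "mode V b (int i) (fst (ps1 ! j)) = 0" if "i \<ge> K" for i
          unfolding e(1) by (rule Kp[OF that e(2)])
      qed (use len in simp)
      also have "(\<Sum>j<?p. \<Sum>i<K. smul V ((of_int k gchoose i) * snd (ps1 ! j) powi (k - int i))
          (product_term (map_slot j (mode V b (int i)) ps1) (ks1[j := ks1 ! j + k - int i]) (product_term ps2 ks2 c))) =
        (\<Sum>j<?p. \<Sum>i<K. smul V (?g j i) (product_term (?at j i) (ks[j := ks ! j + k - int i]) c))"
      proof (intro sum.cong)
        fix j i assume "j \<in> {..<?p}"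
        then have j: "j < ?p" by simp
        have "product_term (?at j i) (ks[j := ks ! j + k - int i]) c =
          product_term (map_slot j (mode V b (int i)) ps1 @ ps2) (ks1[j := ks1 ! j + k - int i] @ ks2) c"
          using j len by (simp add: ps_def map_slot_append list_update_append nth_append)
        also have "\<dots> = product_term (map_slot j (mode V b (int i)) ps1) (ks1[j := ks1 ! j + k - int i]) (product_term ps2 ks2 c)"
          using len by (intro product_term_append) simp
        finally show "smul V ((of_int k gchoose i) * snd (ps1 ! j) powi (k - int i))
          (product_term (map_slot j (mode V b (int i)) ps1) (ks1[j := ks1 ! j + k - int i]) (product_term ps2 ks2 c)) =
          smul V (?g j i) (product_term (?at j i) (ks[j := ks ! j + k - int i]) c)"
          using j by (simp add: ps_def nth_append)
      qed simp_all
      also have "product_term ps1 ks1 (product_term ps2 ks2 c) = product_term ps ks c"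
        unfolding ps_def len(3) using len by (intro product_term_append[symmetric])
      finally have r: "f (product_term ps1 ks1 (mode V b k (product_term ps2 ks2 c))) =
        f (mode V b k (product_term ps ks c)) - (\<Sum>j<?p. \<Sum>i<K. ?g j i * ?u j i)"
        by (simp add: restricted_add[OF f] restricted_sum[OF f] restricted_scale[OF f])
      have t: "(\<Sum>j<?n. \<Sum>i<K. S3 j i (k, ks)) = - (x powi (- k - 1) * (\<Sum>j<?p. \<Sum>i<K. ?g j i * ?u j i))"
      proof -
        have "(\<Sum>j<?n. \<Sum>i<K. S3 j i (k, ks)) = (\<Sum>j<?p. \<Sum>i<K. S3 j i (k, ks))"
          by (rule sum.mono_neutral_right) (use True in \<open>auto simp: S3_def ker_def ps_def\<close>)
        also have "\<dots> = (\<Sum>j<?p. \<Sum>i<K. - (x powi (- k - 1) * (?g j i * ?u j i)))"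
          by (intro sum.cong) (use True in \<open>auto simp: S3_def ker_def\<close>)
        finally show ?thesis by (simp add: sum_distrib_left sum_negf)
      qed
      show ?thesis
        unfolding ks1_def[symmetric] ks2_def[symmetric] lhs 1 2 r t by (simp add: right_diff_distrib)
    next
      case False
      have 1: "(\<Sum>n<K. S1 n (k, ks)) = 0"
        using False by (auto simp: S1_def intro!: sum.neutral)
      have 2: "(\<Sum>i<K. S2 i (k, ks)) = x powi (- k - 1) * f (product_term ps ks (mode V b k c))"
      proof -
        define N where "N = nat k"
        have N: "k = int N" using False by (simp add: N_def)
        have "(\<Sum>i<K. S2 i (k, ks)) = (\<Sum>i<K. if i = N then x powi (- k - 1) * f (product_term ps ks (mode V b k c)) else 0)"
          by (rule sum.cong) (auto simp: S2_def N)
        also have "\<dots> = x powi (- k - 1) * f (product_term ps ks (mode V b k c))"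
          using Kc[of N] f by (cases "N < K") (auto simp: N not_less)
        finally show ?thesis .
      qed
      have "mode V b k (product_term ps2 ks2 c) = product_term ps2 ks2 (mode V b k c) +
        (\<Sum>j<length ps2. \<Sum>i<K. smul V ((of_int k gchoose i) * snd (ps2 ! j) powi (k - int i))
          (product_term (map_slot j (mode V b (int i)) ps2) (ks2[j := ks2 ! j + k - int i]) c))"
      proof (rule mode_product_term)
        fix j assume j: "j < length ps2"
        have e: "ps2 ! j = ps ! (?p + j)" "?p + j < ?n" using j by (simp_all add: ps_def)
        show "snd (ps2 ! j) \<noteq> 0" unfolding e(1) by (rule nz[OF e(2)])
        show "mode V b (int i) (fst (ps2 ! j)) = 0" if "i \<ge> K" for i
          unfolding e(1) by (rule Kp[OF that e(2)])
      qed (use len in simp)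
      then have "f (product_term ps1 ks1 (mode V b k (product_term ps2 ks2 c))) =
         f (product_term ps1 ks1 (product_term ps2 ks2 (mode V b k c))) +
         (\<Sum>j<length ps2. \<Sum>i<K. (of_int k gchoose i) * snd (ps2 ! j) powi (k - int i) *
          f (product_term ps1 ks1 (product_term (map_slot j (mode V b (int i)) ps2) (ks2[j := ks2 ! j + k - int i]) c)))"
        by (simp add: product_term_add product_term_sum product_term_scale
            restricted_add[OF f] restricted_sum[OF f] restricted_scale[OF f])
      also have "product_term ps1 ks1 (product_term ps2 ks2 (mode V b k c)) = product_term ps ks (mode V b k c)"
        unfolding ps_def len(3) using len by (intro product_term_append[symmetric])
      also have "(\<Sum>j<length ps2. \<Sum>i<K. (of_int k gchoose i) * snd (ps2 ! j) powi (k - int i) *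
          f (product_term ps1 ks1 (product_term (map_slot j (mode V b (int i)) ps2) (ks2[j := ks2 ! j + k - int i]) c))) =
        (\<Sum>j<length ps2. \<Sum>i<K. ?g (?p + j) i * ?u (?p + j) i)"
      proof (intro sum.cong)
        fix j i assume "j \<in> {..<length ps2}"
        have "product_term (map_slot (?p + j) (mode V b (int i)) ps) (ks[?p + j := ks ! (?p + j) + k - int i]) c =
          product_term (ps1 @ map_slot j (mode V b (int i)) ps2) (ks1 @ ks2[j := ks2 ! j + k - int i]) c"
          using len by (simp add: ps_def map_slot_append_right list_update_append nth_append)
        also have "\<dots> = product_term ps1 ks1 (product_term (map_slot j (mode V b (int i)) ps2) (ks2[j := ks2 ! j + k - int i]) c)"
          using len by (intro product_term_append) simp
        finally show "(of_int k gchoose i) * snd (ps2 ! j) powi (k - int i) *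
          f (product_term ps1 ks1 (product_term (map_slot j (mode V b (int i)) ps2) (ks2[j := ks2 ! j + k - int i]) c)) =
          ?g (?p + j) i * ?u (?p + j) i"
          by (simp add: ps_def)
      qed simp_all
      also have "\<dots> = (\<Sum>j\<in>{?p..<?n}. \<Sum>i<K. ?g j i * ?u j i)"
        by (rule sum.reindex_bij_witness[where i = "\<lambda>j. j - ?p" and j = "\<lambda>j. ?p + j"]) (auto simp: ps_def)
      finally have r: "f (product_term ps1 ks1 (mode V b k (product_term ps2 ks2 c))) =
        f (product_term ps ks (mode V b k c)) + (\<Sum>j\<in>{?p..<?n}. \<Sum>i<K. ?g j i * ?u j i)" .
      have "(\<Sum>j<?n. \<Sum>i<K. S3 j i (k, ks)) = x powi (- k - 1) * (\<Sum>j\<in>{?p..<?n}. \<Sum>i<K. ?g j i * ?u j i)"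
      proof -
        have "(\<Sum>j<?n. \<Sum>i<K. S3 j i (k, ks)) = (\<Sum>j\<in>{?p..<?n}. \<Sum>i<K. S3 j i (k, ks))"
          by (rule sum.mono_neutral_right) (use False in \<open>auto simp: S3_def ker_def\<close>)
        also have "\<dots> = (\<Sum>j\<in>{?p..<?n}. \<Sum>i<K. x powi (- k - 1) * (?g j i * ?u j i))"
          by (intro sum.cong) (use False in \<open>auto simp: S3_def ker_def\<close>)
        finally show ?thesis by (simp add: sum_distrib_left)
      qed
      then show ?thesis
        unfolding ks1_def[symmetric] ks2_def[symmetric] lhs 1 2 r by (simp add: algebra_simps)
    qed
  qed
  have "((\<lambda>ks. f (product_term (ps1 @ (b, x) # ps2) ks c)) has_sum correlator f ((b, x) # ?qs)) {ks. length ks = Suc ?n} \<longleftrightarrow>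
    ((\<lambda>z. (\<Sum>n<K. S1 n z) + ((\<Sum>j<?n. \<Sum>i<K. S3 j i z) + (\<Sum>i<K. S2 i z))) has_sum
      correlator f ((b, x) # ?qs)) (UNIV \<times> ?L)"
  proof (rule sym, rule has_sum_reindex_bij_witness
      [where j = "\<lambda>(k, ks). take ?p ks @ k # drop ?p ks" and i = "\<lambda>ls. (ls ! ?p, take ?p ls @ drop (Suc ?p) ls)"])
    have pn: "?p \<le> ?n" by (simp add: ps_def)
    show "(case z of (k, ks) \<Rightarrow> take ?p ks @ k # drop ?p ks) \<in> {ks. length ks = Suc ?n}" if "z \<in> UNIV \<times> ?L" for z
      using that pn by auto
    show "(\<lambda>ls. (ls ! ?p, take ?p ls @ drop (Suc ?p) ls)) (case z of (k, ks) \<Rightarrow> take ?p ks @ k # drop ?p ks) = z"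
      if "z \<in> UNIV \<times> ?L" for z
      using that pn by (auto simp: nth_append min_def)
    show "(case (ls ! ?p, take ?p ls @ drop (Suc ?p) ls) of (k, ks) \<Rightarrow> take ?p ks @ k # drop ?p ks) = ls"
      "(ls ! ?p, take ?p ls @ drop (Suc ?p) ls) \<in> UNIV \<times> ?L"
      if "ls \<in> {ks. length ks = Suc ?n}" for ls
      using that pn by (auto simp: id_take_nth_drop[symmetric] min_def)
    show "f (product_term (ps1 @ (b, x) # ps2) (case z of (k, ks) \<Rightarrow> take ?p ks @ k # drop ?p ks) c) =
      (\<Sum>n<K. S1 n z) + ((\<Sum>j<?n. \<Sum>i<K. S3 j i z) + (\<Sum>i<K. S2 i z))" if "z \<in> UNIV \<times> ?L" for z
      using that pointwise by auto
  qed simp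
  with total show ?thesis by blast
qed

lemma correlator_has_sum:
  assumes "restricted_functional f" and "map snd ps \<in> radially_ordered (length ps)"
  shows "((\<lambda>ks. f (product_term ps ks c)) has_sum correlator f (ps @ [(c, 0)])) {ks. length ks = length ps}"
  using assms
proof (induction "length ps" arbitrary: f ps c)
  case 0
  \<comment> \<open>The point \<open>0\<close> leaves only the term with \<open>0 ^ 0 = 1\<close>, which is \<open>f (c(-1)vac) = f c\<close>.\<close>
  have "(\<Sum>n | (\<lambda>w. f (mode V c (-1 - int n) w)) \<noteq> (\<lambda>_. 0). 0 ^ n * f (mode V c (-1 - int n) (vac V))) =
    (\<Sum>n | (\<lambda>w. f (mode V c (-1 - int n) w)) \<noteq> (\<lambda>_. 0). if n = 0 then f c else 0)"
    by (rule sum.cong) (auto simp: mode_on_vac)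
  also have "\<dots> = f c"
  proof (cases "(\<lambda>w. f (mode V c (-1) w)) = (\<lambda>_. 0)")
    case True
    then have "f c = 0" using mode_on_vac(1)[of c] by metis
    then show ?thesis by (intro trans[OF sum.neutral]) auto
  next
    case False
    obtain K where K: "\<And>k w. k \<le> K \<Longrightarrow> f (mode V c k w) = 0"
      using restricted_mode_vanishes[OF 0(2)] by blast
    have "finite {n. (\<lambda>w. f (mode V c (-1 - int n) w)) \<noteq> (\<lambda>_. 0)}"
    proof (rule finite_subset[of _ "{..nat (- K)}"])
      show "{n. (\<lambda>w. f (mode V c (-1 - int n) w)) \<noteq> (\<lambda>_. 0)} \<subseteq> {..nat (- K)}"
      proof
        fix n assume "n \<in> {n. (\<lambda>w. f (mode V c (-1 - int n) w)) \<noteq> (\<lambda>_. 0)}"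
        then have "\<not> (-1 - int n \<le> K)" using K by auto
        then show "n \<in> {..nat (- K)}" by simp
      qed
    qed simp
    then show ?thesis using False by (simp add: sum.delta)
  qed
  finally show ?case using 0 has_sum_finite[of "{[]}" "\<lambda>_. f c"] by (simp add: correlator.simps(2))
next
  case (Suc n)
  then obtain b x qs where ps: "ps = (b, x) # qs" and n: "length qs = n" by (cases ps) auto
  have ro: "x \<noteq> 0" "\<forall>q\<in>set qs. snd q \<noteq> 0 \<and> cmod (snd q) < cmod x" "map snd qs \<in> radially_ordered n"
    using Suc.prems(2) n by (auto simp: ps radially_ordered_def)
  have ro_nth: "snd (qs ! j) \<noteq> 0" "cmod (snd (qs ! j)) < cmod x" if "j < n" for j
    using ro(2) nth_mem[of j qs] that n by auto
  have "((\<lambda>ks. f (product_term ([] @ (b, x) # qs) ks c)) has_sum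
      correlator f ((b, x) # ([] @ qs) @ [(c, 0)])) {ks. length ks = Suc (length ([] @ qs))}"
  proof (rule insertion_has_sum[OF Suc.prems(1)])
    fix g and rs :: "('v \<times> complex) list" and d
    assume g: "restricted_functional g" and rs: "map snd rs = map snd ([] @ qs)"
    have len: "length rs = length qs" using arg_cong[OF rs, of length] by simp
    show "((\<lambda>ks. g (product_term rs ks d)) has_sum correlator g (rs @ [(d, 0)])) {ks. length ks = length ([] @ qs)}"
      using Suc.hyps(1)[of rs g d] g rs ro(3) n len by simp
  qed (use ro(1) ro_nth n in auto)
  then show ?case by (simp add: ps n)
qed

lemma correlator_state_only: "restricted_functional f \<Longrightarrow> correlator f [(c, 0)] = f c"
proof -
  assume f: "restricted_functional f"
  have "((\<lambda>ks. f (product_term [] ks c)) has_sum correlator f ([] @ [(c, 0)])) {ks. length ks = length ([] :: ('v \<times> complex) list)}"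
    by (rule correlator_has_sum[OF f]) (simp add: radially_ordered_def)
  then have "((\<lambda>ks. f c) has_sum correlator f [(c, 0)]) {[] :: int list}" by simp
  with has_sum_finite[of "{[] :: int list}" "\<lambda>_. f c"] show ?thesis
    by (simp add: has_sum_unique)
qed

text \<open>The vacuum has no modes \<open>u(i)vac\<close> with \<open>i \<ge> 0\<close>, so it produces no poles.\<close>

lemma correlator_vac_last:
  "restricted_functional f \<Longrightarrow> correlator f (ps @ [(vac V, 0)]) = correlator f ps"
proof (induction "length ps" arbitrary: f ps)
  case 0
  then show ?case by (simp add: correlator_state_only)
next
  case (Suc n)
  then obtain p qs where ps: "ps = p # qs" and n: "length qs = n" by (cases ps) auto
  note f = Suc.prems
  let ?qv = "qs @ [(vac V, 0)]"
  have ih: "correlator g (rs @ [(vac V, 0)]) = correlator g rs" if "restricted_functional g" "length rs = n" for g rs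
    using Suc.hyps(1)[of rs g] that by simp
  have "correlator f (map_slot (length qs) (mode V u (int i)) ?qv) = 0" for u i
  proof -
    have "map_slot (length qs) (mode V u (int i)) ?qv = map_slot (length qs) (\<lambda>_. 0) ?qv"
      by (rule map_slot_cong) (simp add: mode_on_vac)
    then show ?thesis using correlator_zero_slot[OF f, of "length qs" ?qv] by simp
  qed
  then have sum: "recursion_sum f p ?qv K = recursion_sum f p qs K" for K
    using n by (simp add: recursion_sum_def ih restricted_comp_mode f map_slot_append nth_append)
  have "\<forall>\<^sub>F K in sequentially. correlator f (p # ?qv) = correlator f (p # qs)"
    using eventually_correlator_Cons[OF f, of p ?qv] eventually_correlator_Cons[OF f, of p qs]
    by eventually_elim (simp only: sum)
  then show ?case by (simp add: ps)
qed

text \<open>The insertion points may be rational functions of the variables.  This one statement covers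
permuted, inverted and fixed points.\<close>

lemma correlator_rational:
  assumes "restricted_functional f"
    and "\<And>j. j < length us \<Longrightarrow> rational_on n D (snd (us ! j))"
    and "\<And>i j ys. i < j \<Longrightarrow> j < length us \<Longrightarrow> ys \<in> D \<Longrightarrow> snd (us ! i) ys \<noteq> snd (us ! j) ys"
  shows "rational_on n D (\<lambda>ys. correlator f (map (\<lambda>(u, h). (u, h ys)) us))"
  using assms
proof (induction "length us" arbitrary: f us)
  case (Suc m)
  then obtain u h rs where us: "us = (u, h) # rs" and m: "length rs = m" by (cases us) auto
  note f = Suc.prems(1)
  have h: "rational_on n D h" using Suc.prems(2)[of 0] by (simp add: us)
  have hj: "rational_on n D (snd (rs ! j))" if "j < m" for j
    using Suc.prems(2)[of "Suc j"] that m by (simp add: us)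
  have ne: "h ys \<noteq> snd (rs ! j) ys" if "j < m" "ys \<in> D" for j ys
    using Suc.prems(3)[of 0 "Suc j" ys] that m by (simp add: us)
  have ih: "rational_on n D (\<lambda>ys. correlator g (map (\<lambda>(u, h). (u, h ys)) ts))"
    if "restricted_functional g" "length ts = m" "\<And>j. j < m \<Longrightarrow> snd (ts ! j) = snd (rs ! j)" for g ts
    by (rule Suc.hyps(1)) (use that hj Suc.prems(3)[of "Suc i" "Suc j" for i j] m in \<open>auto simp: us\<close>)
  have 1: "rational_on n D (\<lambda>ys. h ys ^ k * correlator (\<lambda>w. f (mode V u (-1 - int k) w)) (map (\<lambda>(u, h). (u, h ys)) rs))" for k
    by (intro rational_on_mult rational_on_power h ih restricted_comp_mode f m) simp
  have 2: "rational_on n D (\<lambda>ys. correlator f (map_slot j A (map (\<lambda>(u, h). (u, h ys)) rs)) /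
      (h ys - snd (map (\<lambda>(u, h). (u, h ys)) rs ! j)) ^ Suc i)" if j: "j < length rs" for j A i
  proof -
    have "rational_on n D (\<lambda>ys. correlator f (map (\<lambda>(u, h). (u, h ys)) (map_slot j A rs)) *
      inverse ((h ys - snd (rs ! j) ys) ^ Suc i))"
      by (intro rational_on_mult rational_on_inverse rational_on_power rational_on_diff h hj ih f)
        (use m j ne in auto)
    then show ?thesis
      by (rule rational_on_cong) (use j in \<open>simp add: map_slot_map[of j A "\<lambda>h. h ys" for ys] snd_map_conv_nth[of j rs "\<lambda>h. h ys" for ys] divide_inverse case_prod_beta\<close>)
  qed
  have 3: "rational_on n D (\<lambda>ys. \<Sum>i | mode V u (int i) (fst (map (\<lambda>(u, h). (u, h ys)) rs ! j)) \<noteq> 0.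
      correlator f (map_slot j (mode V u (int i)) (map (\<lambda>(u, h). (u, h ys)) rs)) /
      (h ys - snd (map (\<lambda>(u, h). (u, h ys)) rs ! j)) ^ Suc i)" if j: "j < length rs" for j
    unfolding fst_map_conv_nth[OF j] by (intro rational_on_sum 2 j)
  have "rational_on n D (\<lambda>ys. correlator f ((u, h ys) # map (\<lambda>(u, h). (u, h ys)) rs))"
    unfolding correlator.simps fst_conv snd_conv length_map
    by (intro rational_on_add rational_on_sum[of "{..<length rs}"] rational_on_sum[of "{n. P n}" for P] 1 3) simp
  then show ?case by (simp add: us)
qed auto

text \<open>The mode series with \<open>b\<close> in its place converges to both sides: to the left one by taking the modes of
the first vector out, to the right one by taking those of \<open>b\<close> out.\<close>

lemma correlator_move_to_front:
  assumes f: "restricted_functional f" and dist: "distinct (map snd (ps1 @ (b, x) # ps2))"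
  shows "correlator f (ps1 @ (b, x) # ps2) = correlator f ((b, x) # ps1 @ ps2)"
proof -
  let ?p = "length ps1" and ?n = "Suc (length (ps1 @ ps2))"
  define D where "D = {ys :: complex list. length ys = ?n \<and> distinct ys}"
  define g where "g ys = correlator f (zip (map fst (ps1 @ (b, x) # ps2)) ys)" for ys
  define us where "us = (b, \<lambda>ys :: complex list. ys ! ?p) # map (\<lambda>i. (fst ((ps1 @ ps2) ! i), \<lambda>ys. ys ! (if i < ?p then i else Suc i))) [0..<length (ps1 @ ps2)]"
  define g' where "g' ys = correlator f (map (\<lambda>(u, h). (u, h ys)) us)" for ys
  have "rational_on ?n D (\<lambda>ys. correlator f (map (\<lambda>(u, h). (u, h ys)) (map (\<lambda>i. (fst ((ps1 @ (b, x) # ps2) ! i), \<lambda>ys. ys ! i)) [0..<?n])))"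
    by (rule correlator_rational[OF f]) (auto simp: D_def nth_eq_iff_index_eq simp del: upt_Suc)
  then have rg: "rational_on ?n D g"
  proof (rule rational_on_cong)
    fix ys assume "ys \<in> D"
    then show "g ys = correlator f (map (\<lambda>(u, h). (u, h ys)) (map (\<lambda>i. (fst ((ps1 @ (b, x) # ps2) ! i), \<lambda>ys. ys ! i)) [0..<?n]))"
      unfolding g_def by (intro arg_cong[of _ _ "correlator f"] nth_equalityI) (auto simp: D_def simp del: upt_Suc map_append list.map)
  qed
  have lu: "length us = ?n" by (simp add: us_def)
  have pn: "?p < ?n" by simp
  have rg': "rational_on ?n D g'"
    unfolding g'_def
  proof (rule correlator_rational[OF f])
    fix j assume "j < length us"
    then show "rational_on ?n D (snd (us ! j))"
      by (cases j) (auto simp: us_def intro!: rational_on_nth)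
  next
    fix i j ys assume "i < j" "j < length us" "ys \<in> D"
    then show "snd (us ! i) ys \<noteq> snd (us ! j) ys"
      by (cases j; cases i) (auto simp: us_def D_def nth_eq_iff_index_eq)
  qed
  have sums: "g ys = g' ys" if ys: "ys \<in> radially_ordered ?n" for ys
  proof -
    let ?ps = "zip (map fst (ps1 @ (b, x) # ps2)) ys"
    have len: "length ys = ?n" using ys by (simp add: radially_ordered_def)
    have ro: "\<And>i. i < ?n \<Longrightarrow> ys ! i \<noteq> 0" "\<And>i j. i < j \<Longrightarrow> j < ?n \<Longrightarrow> cmod (ys ! j) < cmod (ys ! i)"
      using ys by (auto simp: radially_ordered_iff_nth)
    define qs1 where "qs1 = zip (map fst ps1) (take ?p ys)"
    define qs2 where "qs2 = zip (map fst ps2) (drop (Suc ?p) ys)"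
    have lq: "length qs1 = ?p" "length qs2 = length ps2" using len by (auto simp: qs1_def qs2_def)
    have e: "take ?p ys @ ys ! ?p # drop (Suc ?p) ys = ys"
      using len by (intro id_take_nth_drop[symmetric]) simp
    have "zip (map fst (ps1 @ (b, x) # ps2)) (take ?p ys @ ys ! ?p # drop (Suc ?p) ys) = qs1 @ (b, ys ! ?p) # qs2"
      unfolding qs1_def qs2_def using len by simp
    then have split: "?ps = qs1 @ (b, ys ! ?p) # qs2" unfolding e .
    have snd_qs: "snd ((qs1 @ qs2) ! j) = ys ! (if j < ?p then j else Suc j)" if "j < ?p + length ps2" for j
      using that len by (auto simp: qs1_def qs2_def nth_append)
    have "((\<lambda>ks. f (product_term (qs1 @ (b, ys ! ?p) # qs2) ks (vac V))) has_sum
      correlator f ((b, ys ! ?p) # (qs1 @ qs2) @ [(vac V, 0)])) {ks. length ks = Suc (length (qs1 @ qs2))}"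
    proof (rule insertion_has_sum[OF f])
      show "ys ! ?p \<noteq> 0" using ro by simp
      show "snd ((qs1 @ qs2) ! j) \<noteq> 0" if "j < length (qs1 @ qs2)" for j
        using that snd_qs[of j] ro(1)[of j] ro(1)[of "Suc j"] lq by auto
      show "cmod (ys ! ?p) < cmod (snd ((qs1 @ qs2) ! j))" if "j < length qs1" for j
        using that snd_qs[of j] ro(2)[of j ?p] lq by auto
      show "cmod (snd ((qs1 @ qs2) ! j)) < cmod (ys ! ?p)" if "length qs1 \<le> j" "j < length (qs1 @ qs2)" for j
        using that snd_qs[of j] ro(2)[of ?p "Suc j"] lq by auto
      fix g and rs :: "('v \<times> complex) list" and d
      assume g: "restricted_functional g" and rs: "map snd rs = map snd (qs1 @ qs2)"
      have lr: "length rs = length (qs1 @ qs2)" using arg_cong[OF rs, of length] by simp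
      have "map snd (qs1 @ qs2) \<in> radially_ordered (length (qs1 @ qs2))"
      proof -
        have "map snd (qs1 @ qs2) ! j = ys ! (if j < ?p then j else Suc j)" if "j < ?p + length ps2" for j
          using snd_qs[OF that] that lq by (simp del: map_append)
        then show ?thesis
          unfolding radially_ordered_iff_nth using lq ro by (auto simp del: map_append)
      qed
      then show "((\<lambda>ks. g (product_term rs ks d)) has_sum correlator g (rs @ [(d, 0)])) {ks. length ks = length (qs1 @ qs2)}"
        using correlator_has_sum[OF g, of rs d] lr rs by simp
    qed
    moreover have "((\<lambda>ks. f (product_term ?ps ks (vac V))) has_sum correlator f (?ps @ [(vac V, 0)])) {ks. length ks = length ?ps}"
      by (rule correlator_has_sum[OF f]) (use ys len in simp)
    ultimately have "correlator f (?ps @ [(vac V, 0)]) = correlator f (((b, ys ! ?p) # qs1 @ qs2) @ [(vac V, 0)])"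
      unfolding split using has_sum_unique lq by auto
    then have "g ys = correlator f ((b, ys ! ?p) # qs1 @ qs2)"
      unfolding correlator_vac_last[OF f] g_def by simp
    also have "(b, ys ! ?p) # qs1 @ qs2 = map (\<lambda>(u, h). (u, h ys)) us"
    proof -
      have "qs1 @ qs2 = map (\<lambda>(u, h). (u, h ys)) (tl us)"
        by (rule nth_equalityI)
          (use lq len in \<open>auto simp: us_def qs1_def qs2_def nth_append\<close>)
      then show ?thesis by (simp add: us_def)
    qed
    finally show ?thesis by (simp add: g'_def)
  qed
  define xs where "xs = map snd (ps1 @ (b, x) # ps2)"
  have xs: "xs \<in> D" using dist by (simp add: D_def xs_def)
  have "g xs = g' xs"
    by (rule rational_on_eqI[OF rg rg' xs _ _ sums])
      (auto simp: xs_def D_def radially_ordered_distinct radially_ordered_length)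
  moreover have "g xs = correlator f (ps1 @ (b, x) # ps2)"
    unfolding g_def xs_def by (simp only: zip_map_fst_snd)
  moreover have "map (\<lambda>(u, h). (u, h xs)) us = (b, x) # ps1 @ ps2"
    by (rule nth_equalityI) (auto simp: us_def xs_def nth_Cons nth_append Suc_diff_le not_less split: nat.splits)
  ultimately show ?thesis unfolding g'_def by simp
qed

text \<open>Adjoints reverse the order of a product, so this order is needed in inversions.\<close>

lemma correlator_rev_append:
  assumes "restricted_functional f" and "distinct (map snd (ps @ qs))"
  shows "correlator f (rev ps @ qs) = correlator f (ps @ qs)"
  using assms(2)
proof (induction ps arbitrary: qs)
  case (Cons p ps)
  have "correlator f (rev ps @ p # qs) = correlator f (ps @ p # qs)"
    by (rule Cons.IH) (use Cons.prems in auto)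
  also have "\<dots> = correlator f (p # ps @ qs)"
    using correlator_move_to_front[OF assms(1), of ps "fst p" "snd p" qs] Cons.prems by auto
  finally show ?case by simp
qed simp

lemma correlator_zip_rational:
  assumes "restricted_functional f" and "length us = n"
  shows "rational_on n {ys. length ys = n \<and> distinct ys} (\<lambda>ys. correlator f (zip us ys))"
proof -
  have "rational_on n {ys. length ys = n \<and> distinct ys} (\<lambda>ys. correlator f (map (\<lambda>(u, h). (u, h ys)) (map (\<lambda>i. (us ! i, \<lambda>ys. ys ! i)) [0..<n])))"
    by (rule correlator_rational[OF assms(1)]) (auto simp: nth_eq_iff_index_eq)
  then show ?thesis
  proof (rule rational_on_cong)
    fix ys :: "complex list" assume "ys \<in> {ys. length ys = n \<and> distinct ys}"
    then have "zip us ys = map (\<lambda>(u, h). (u, h ys)) (map (\<lambda>i. (us ! i, \<lambda>ys. ys ! i)) [0..<n])"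
      using assms(2) by (intro nth_equalityI) auto
    then show "correlator f (zip us ys) = correlator f (map (\<lambda>(u, h). (u, h ys)) (map (\<lambda>i. (us ! i, \<lambda>ys. ys ! i)) [0..<n]))"
      by simp
  qed
qed

lemma insertions_scaled:
  "length us = length ys \<Longrightarrow> length ys = length cs \<Longrightarrow> length cs = length ks \<Longrightarrow>
   insertions V (map2 (\<lambda>c u. smul V c u) cs us) ys ks x = smul V (prod_list cs) (insertions V us ys ks x)"
  by (induction us ys cs ks rule: list_induct4)
    (simp_all add: mode_scale_left mode_scale_right mult_ac)

end

section \<open>Moving the insertion points: derivatives, translations and scalings\<close>

lemma sum_list_update_group:
  fixes xs :: "int list"
  shows "k < length xs \<Longrightarrow> sum_list (xs[k := x]) = sum_list xs + x - xs ! k"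
  by (induction xs arbitrary: k) (auto split: nat.splits)

context vertex_operator_algebra
begin

text \<open>The Ward identity for \<open>L(-1)\<close>, which acts as a derivation on all products \<open>u(k)v\<close>; it annihilates the vacuum.\<close>

lemma correlator_vir_m1_functional:
  assumes "restricted_functional f"
  shows "correlator (\<lambda>w. f (vir V (-1) w)) ps = (\<Sum>l<length ps. correlator f (map_slot l (vir V (-1)) ps))"
  using assms
proof (induction "length ps" arbitrary: f ps)
  case (Suc n)
  then obtain p qs where ps: "ps = p # qs" and n: "length qs = n" by (cases ps) auto
  note f = Suc.prems
  let ?L = "vir V (-1)"
  have ih: "correlator (\<lambda>w. g (?L w)) rs = (\<Sum>l<n. correlator g (map_slot l ?L rs))"
    if "restricted_functional g" "length rs = n" for g rs
    using Suc.hyps(1)[of rs g] that by simp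
  have slot: "correlator f (map_slot l ?L (map_slot j (mode V u k) qs)) =
      correlator f (map_slot j (mode V u k) (map_slot l ?L qs)) +
      (if l = j then correlator f (map_slot j (mode V (?L u) k) qs) else 0)" if "j < n" for l j u k
    using that n
    by (auto simp: map_slot_swap map_slot_map_slot vir_m1_mode correlator_add_slot[OF f])
  have 1: "correlator (\<lambda>w. f (?L (mode V u k w))) qs =
     correlator (\<lambda>w. f (mode V (?L u) k w)) qs + (\<Sum>l<n. correlator (\<lambda>w. f (mode V u k w)) (map_slot l ?L qs))" for u k
  proof -
    have "correlator (\<lambda>w. f (?L (mode V u k w))) qs = correlator (\<lambda>w. f (mode V (?L u) k w) + f (mode V u k (?L w))) qs"
      by (simp add: vir_m1_mode restricted_add[OF f])
    also have "\<dots> = correlator (\<lambda>w. f (mode V (?L u) k w)) qs + correlator (\<lambda>w. f (mode V u k (?L w))) qs"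
      by (rule correlator_add_functional) (intro restricted_comp_mode f restricted_comp_vir)+
    also have "correlator (\<lambda>w. f (mode V u k (?L w))) qs = (\<Sum>l<n. correlator (\<lambda>w. f (mode V u k w)) (map_slot l ?L qs))"
      by (rule ih[OF restricted_comp_mode[OF f] n])
    finally show ?thesis .
  qed
  have 2: "correlator (\<lambda>w. f (?L w)) (map_slot j (mode V u k) qs) =
      correlator f (map_slot j (mode V (?L u) k) qs) + (\<Sum>l<n. correlator f (map_slot j (mode V u k) (map_slot l ?L qs)))"
    if "j < n" for j u k
    using that n by (subst ih[OF f]) (simp_all add: slot sum.distrib)
  have sum: "recursion_sum (\<lambda>w. f (?L w)) p qs K = recursion_sum f (?L (fst p), snd p) qs K +
      (\<Sum>l<n. recursion_sum f p (map_slot l ?L qs) K)" for K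
  proof -
    have "(\<Sum>j<n. \<Sum>i<K. correlator (\<lambda>w. f (?L w)) (map_slot j (mode V (fst p) (int i)) qs) / (snd p - snd (qs ! j)) ^ Suc i) =
      (\<Sum>j<n. \<Sum>i<K. correlator f (map_slot j (mode V (?L (fst p)) (int i)) qs) / (snd p - snd (qs ! j)) ^ Suc i) +
      (\<Sum>l<n. \<Sum>j<n. \<Sum>i<K. correlator f (map_slot j (mode V (fst p) (int i)) (map_slot l ?L qs)) / (snd p - snd (qs ! j)) ^ Suc i)"
    proof -
      have "(\<Sum>l<n. \<Sum>j<n. \<Sum>i<K. correlator f (map_slot j (mode V (fst p) (int i)) (map_slot l ?L qs)) / (snd p - snd (qs ! j)) ^ Suc i) =
        (\<Sum>j<n. \<Sum>i<K. \<Sum>l<n. correlator f (map_slot j (mode V (fst p) (int i)) (map_slot l ?L qs)) / (snd p - snd (qs ! j)) ^ Suc i)"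
        by (subst sum.swap) (intro sum.cong refl sum.swap)
      then show ?thesis by (simp add: 2 sum.distrib add_divide_distrib sum_divide_distrib)
    qed
    moreover have "(\<Sum>m<K. snd p ^ m * correlator (\<lambda>w. f (?L (mode V (fst p) (- 1 - int m) w))) qs) =
      (\<Sum>m<K. snd p ^ m * correlator (\<lambda>w. f (mode V (?L (fst p)) (- 1 - int m) w)) qs) +
      (\<Sum>l<n. \<Sum>m<K. snd p ^ m * correlator (\<lambda>w. f (mode V (fst p) (- 1 - int m) w)) (map_slot l ?L qs))"
      unfolding 1 by (subst sum.swap) (simp add: sum.distrib distrib_left sum_distrib_left)
    ultimately show ?thesis
      unfolding recursion_sum_def n length_map_slot snd_map_slot fst_conv snd_conv sum.distrib by (simp only: add_ac)
  qed
  have "\<forall>\<^sub>F K in sequentially. \<forall>l\<in>{..<n}. correlator f (p # map_slot l ?L qs) = recursion_sum f p (map_slot l ?L qs) K"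
    by (intro eventually_ball_finite ballI eventually_correlator_Cons f) simp
  then have "\<forall>\<^sub>F K in sequentially. correlator (\<lambda>w. f (?L w)) ps =
      correlator f ((?L (fst p), snd p) # qs) + (\<Sum>l<n. correlator f (p # map_slot l ?L qs))"
    using eventually_correlator_Cons[OF restricted_comp_vir[OF f], of "-1" p qs]
      eventually_correlator_Cons[OF f, of "(?L (fst p), snd p)" qs]
    by eventually_elim (simp add: ps sum)
  then show ?case
    by (simp add: ps n sum.lessThan_Suc_shift del: sum.lessThan_Suc)
qed simp

text \<open>By the recursion, differentiating the explicit powers and poles of the first position amounts to
replacing the modes \<open>u(k)\<close> by \<open>-k u(k-1) = (L(-1)u)(k)\<close>.  The derivative of a pole in
the position \<open>h\<^sub>j\<close> of another insertion cancels against the term \<open>(L(-1)u)(i) u\<^sub>j\<close> of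
\<open>L(-1)(u(i)u\<^sub>j) = (L(-1)u)(i) u\<^sub>j + u(i)(L(-1)u\<^sub>j)\<close>.\<close>

lemma correlator_has_derivative:
  fixes us :: "('v \<times> (complex \<Rightarrow> complex)) list" and h' :: "nat \<Rightarrow> complex"
  assumes "restricted_functional f"
    and "\<And>l. l < length us \<Longrightarrow> (snd (us ! l) has_field_derivative h' l) (at t)"
    and "\<And>i j. i < j \<Longrightarrow> j < length us \<Longrightarrow> snd (us ! i) t \<noteq> snd (us ! j) t"
  shows "((\<lambda>s. correlator f (map (\<lambda>(u, h). (u, h s)) us)) has_field_derivative
    (\<Sum>l<length us. h' l * correlator f (map_slot l (vir V (-1)) (map (\<lambda>(u, h). (u, h t)) us)))) (at t)"
  using assms
proof (induction "length us" arbitrary: f us h')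
  case (Suc n)
  then obtain u h rs where us: "us = (u, h) # rs" and n: "length rs = n" by (cases us) auto
  let ?L = "vir V (-1)" and ?ev = "\<lambda>s. map (\<lambda>(u, h). (u, h s)) :: ('v \<times> (complex \<Rightarrow> complex)) list \<Rightarrow> ('v \<times> complex) list"
  note f = Suc.prems(1)
  define h0 where "h0 = h' 0"
  define hr where "hr l = h' (Suc l)" for l
  have dh: "(h has_field_derivative h0) (at t)"
    using Suc.prems(2)[of 0] by (simp add: us h0_def)
  have dr: "(snd (rs ! l) has_field_derivative hr l) (at t)" if "l < n" for l
    using Suc.prems(2)[of "Suc l"] that n by (simp add: us hr_def)
  have ne: "h t - snd (rs ! j) t \<noteq> 0" if "j < n" for j
    using Suc.prems(3)[of 0 "Suc j"] that n by (simp add: us)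
  have ih: "((\<lambda>s. correlator g (?ev s ts)) has_field_derivative
      (\<Sum>l<n. hr l * correlator g (map_slot l ?L (?ev t ts)))) (at t)"
    if "restricted_functional g" "length ts = n" "\<And>j. j < n \<Longrightarrow> snd (ts ! j) = snd (rs ! j)" for g ts
    using Suc.hyps(1)[of ts g hr] that dr Suc.prems(3)[of "Suc i" "Suc j" for i j] n by (simp add: us)
  define C where "C m = correlator (\<lambda>w. f (mode V u (- 1 - int m) w)) (?ev t rs)" for m
  define C' where "C' m = (\<Sum>l<n. hr l * correlator (\<lambda>w. f (mode V u (- 1 - int m) w)) (map_slot l ?L (?ev t rs)))" for m
  define E where "E j i = correlator f (map_slot j (mode V u (int i)) (?ev t rs))" for j i
  define E' where "E' j i = (\<Sum>l<n. hr l * correlator f (map_slot j (mode V u (int i)) (map_slot l ?L (?ev t rs))))" for j i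
  define EL where "EL j i = correlator f (map_slot j (mode V (?L u) (int i)) (?ev t rs))" for j i
  define z where "z j = h t - snd (rs ! j) t" for j
  have dC: "((\<lambda>s. correlator (\<lambda>w. f (mode V u (- 1 - int m) w)) (?ev s rs)) has_field_derivative C' m) (at t)" for m
    unfolding C'_def by (rule ih[OF restricted_comp_mode[OF f] n]) simp
  have slot: "correlator f (map_slot l ?L (map_slot j (mode V u k) (?ev t rs))) =
      correlator f (map_slot j (mode V u k) (map_slot l ?L (?ev t rs))) +
      (if l = j then correlator f (map_slot j (mode V (?L u) k) (?ev t rs)) else 0)" if "j < n" for l j k
    using that n
    by (auto simp: map_slot_swap map_slot_map_slot vir_m1_mode correlator_add_slot[OF f])
  have dE: "((\<lambda>s. correlator f (map_slot j (mode V u (int i)) (?ev s rs))) has_field_derivative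
      (hr j * EL j i + E' j i)) (at t)" if j: "j < n" for j i
  proof -
    have "((\<lambda>s. correlator f (?ev s (map_slot j (mode V u (int i)) rs))) has_field_derivative
      (\<Sum>l<n. hr l * correlator f (map_slot l ?L (?ev t (map_slot j (mode V u (int i)) rs))))) (at t)"
      by (rule ih[OF f]) (use n in auto)
    also have "(\<Sum>l<n. hr l * correlator f (map_slot l ?L (?ev t (map_slot j (mode V u (int i)) rs)))) = hr j * EL j i + E' j i"
      unfolding map_slot_map[symmetric] slot[OF j] E'_def EL_def
      using j by (simp add: distrib_left sum.distrib if_distrib[of "\<lambda>x. _ * x"] cong: if_cong)
    finally show ?thesis unfolding map_slot_map .
  qed
  have rec_deriv: "((\<lambda>s. recursion_sum f (u, h s) (?ev s rs) K) has_field_derivative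
      ((\<Sum>m<K. h t ^ m * C' m + of_nat m * h t ^ (m - 1) * h0 * C m) +
       (\<Sum>j<n. \<Sum>i<K. (hr j * EL j i + E' j i) / z j ^ Suc i -
         of_nat (Suc i) * (h0 - hr j) * E j i / z j ^ Suc (Suc i)))) (at t)" for K
  proof -
    have a: "((\<lambda>s. h s ^ m * correlator (\<lambda>w. f (mode V u (- 1 - int m) w)) (?ev s rs)) has_field_derivative
        h t ^ m * C' m + of_nat m * h t ^ (m - 1) * h0 * C m) (at t)" for m
      by (rule derivative_eq_intros dh dC refl)+ (simp add: C_def mult_ac)
    have b: "((\<lambda>s. correlator f (map_slot j (mode V u (int i)) (?ev s rs)) / (h s - snd (?ev s rs ! j)) ^ Suc i) has_field_derivative
        (hr j * EL j i + E' j i) / z j ^ Suc i - of_nat (Suc i) * (h0 - hr j) * E j i / z j ^ Suc (Suc i)) (at t)"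
      if j: "j < n" for j i
    proof -
      have zj: "z j \<noteq> 0" using ne[OF j] by (simp add: z_def)
      have e: "snd (?ev s rs ! j) = snd (rs ! j) s" for s
        by (rule snd_map_conv_nth) (use j n in simp)
      have d: "((\<lambda>s. (h s - snd (rs ! j) s) ^ Suc i) has_field_derivative of_nat (Suc i) * z j ^ i * (h0 - hr j)) (at t)"
        by (rule derivative_eq_intros dh dr[OF j] refl)+ (simp add: z_def)
      have nz: "(h t - snd (rs ! j) t) ^ Suc i \<noteq> 0" using zj by (simp add: z_def)
      have "((\<lambda>s. correlator f (map_slot j (mode V u (int i)) (?ev s rs)) / (h s - snd (rs ! j) s) ^ Suc i) has_field_derivative
        ((hr j * EL j i + E' j i) * z j ^ Suc i - E j i * (of_nat (Suc i) * z j ^ i * (h0 - hr j))) / (z j ^ Suc i * z j ^ Suc i)) (at t)"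
        using DERIV_divide[OF dE[OF j, of i] d nz] by (simp add: z_def E_def)
      also have "((hr j * EL j i + E' j i) * z j ^ Suc i - E j i * (of_nat (Suc i) * z j ^ i * (h0 - hr j))) / (z j ^ Suc i * z j ^ Suc i) =
        (hr j * EL j i + E' j i) / z j ^ Suc i - of_nat (Suc i) * (h0 - hr j) * E j i / z j ^ Suc (Suc i)"
      proof -
        have "E j i * (of_nat (Suc i) * z j ^ i * (h0 - hr j)) / (z j ^ Suc i * z j ^ Suc i) =
          of_nat (Suc i) * (h0 - hr j) * E j i / z j ^ Suc (Suc i)"
          using zj by (simp add: divide_simps del: of_nat_Suc)
        then show ?thesis using zj by (simp add: diff_divide_distrib del: of_nat_Suc)
      qed
      finally show ?thesis unfolding e .
    qed
    show ?thesis
      unfolding recursion_sum_def length_map n fst_conv snd_conv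
      by (intro DERIV_add DERIV_sum a b) simp_all
  qed
  \<comment> \<open>The bound is taken one larger than needed for \<open>u\<close>, so that the sums for \<open>L(-1)u\<close> can be shifted by one.\<close>
  have ev1: "\<forall>\<^sub>F K in sequentially. (\<forall>n\<ge>K. \<forall>w. f (mode V u (-1 - int n) w) = 0) \<and>
    (\<forall>i\<ge>K. \<forall>v\<in>set (map fst rs). mode V u (int i) v = 0)"
    by (rule eventually_recursion_bound[OF f])
  have ev2: "\<forall>\<^sub>F K in sequentially. correlator f ((?L u, h t) # ?ev t rs) = recursion_sum f (?L u, h t) (?ev t rs) K"
    by (rule eventually_correlator_Cons[OF f])
  have ev3: "\<forall>\<^sub>F K in sequentially. \<forall>l\<in>{..<n}. correlator f ((u, h t) # map_slot l ?L (?ev t rs)) =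
      recursion_sum f (u, h t) (map_slot l ?L (?ev t rs)) K"
    by (intro eventually_ball_finite ballI eventually_correlator_Cons f) simp
  have "\<forall>\<^sub>F K in sequentially. (\<forall>n\<ge>K. \<forall>w. f (mode V u (-1 - int n) w) = 0) \<and>
      (\<forall>i\<ge>K. \<forall>v\<in>set (map fst rs). mode V u (int i) v = 0) \<and>
      correlator f ((?L u, h t) # ?ev t rs) = recursion_sum f (?L u, h t) (?ev t rs) (Suc K) \<and>
      (\<forall>l\<in>{..<n}. correlator f ((u, h t) # map_slot l ?L (?ev t rs)) =
        recursion_sum f (u, h t) (map_slot l ?L (?ev t rs)) (Suc K))"
    using ev1 eventually_sequentially_Suc[THEN iffD2, OF ev2] eventually_sequentially_Suc[THEN iffD2, OF ev3]
    by eventually_elim blast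
  from eventually_happens'[OF sequentially_bot this] obtain K
    where K: "(\<forall>n\<ge>K. \<forall>w. f (mode V u (-1 - int n) w) = 0) \<and>
      (\<forall>i\<ge>K. \<forall>v\<in>set (map fst rs). mode V u (int i) v = 0) \<and>
      correlator f ((?L u, h t) # ?ev t rs) = recursion_sum f (?L u, h t) (?ev t rs) (Suc K) \<and>
      (\<forall>l\<in>{..<n}. correlator f ((u, h t) # map_slot l ?L (?ev t rs)) =
        recursion_sum f (u, h t) (map_slot l ?L (?ev t rs)) (Suc K))" ..
  have fz: "f (mode V u (-1 - int m) w) = 0" if "m \<ge> K" for m w
    using conjunct1[OF K] that by simp
  have uz: "mode V u (int i) v = 0" if "i \<ge> K" "v \<in> set (map fst rs)" for i v
    using conjunct1[OF conjunct2[OF K]] that by blast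
  have KL: "correlator f ((?L u, h t) # ?ev t rs) = recursion_sum f (?L u, h t) (?ev t rs) (Suc K)"
    by (rule conjunct1[OF conjunct2[OF conjunct2[OF K]]])
  have Kl: "correlator f ((u, h t) # map_slot l ?L (?ev t rs)) =
      recursion_sum f (u, h t) (map_slot l ?L (?ev t rs)) (Suc K)" if "l < n" for l
    by (rule bspec[OF conjunct2[OF conjunct2[OF conjunct2[OF K]]]]) (use that in simp)
  have uz': "mode V u (int i) (fst (?ev s rs ! j)) = 0" if "i \<ge> K" "j < n" for i j s
    using uz[OF that(1), of "fst (rs ! j)"] that(2) n by (simp add: case_prod_beta)
  have cor: "correlator f (?ev s us) = recursion_sum f (u, h s) (?ev s rs) (Suc K)" for s
    unfolding us list.map prod.case
    by (rule correlator_eq_recursion_sum[OF f]) (use fz uz' n in auto)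
  have EL: "EL j i = - of_nat i * E j (i - 1)" if "j < n" for i j
  proof (cases i)
    case 0
    have "EL j 0 = correlator f (map_slot j (\<lambda>_. 0) (?ev t rs))"
      unfolding EL_def by (intro arg_cong[of _ _ "correlator f"] map_slot_cong) (simp add: mode_vir_m1)
    then show ?thesis using correlator_zero_slot[OF f, of j "?ev t rs"] that n 0 by simp
  next
    case (Suc k)
    have "EL j i = correlator f (map_slot j (\<lambda>v. smul V (- of_nat i) (mode V u (int k) v)) (?ev t rs))"
      unfolding EL_def by (intro arg_cong[of _ _ "correlator f"] map_slot_cong) (simp add: mode_vir_m1 Suc)
    also have "\<dots> = - of_nat i * E j k"
      unfolding E_def by (rule correlator_scale_slot[OF f]) (use that n in simp)
    finally show ?thesis by (simp add: Suc)
  qed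
  have EK: "E j K = 0" if "j < n" for j
  proof -
    have "map_slot j (mode V u (int K)) (?ev t rs) = map_slot j (\<lambda>_. 0) (?ev t rs)"
      by (rule map_slot_cong) (use uz' that in simp)
    then show ?thesis unfolding E_def using correlator_zero_slot[OF f, of j "?ev t rs"] that n by simp
  qed
  have CK: "C K = 0" unfolding C_def by (simp add: fz correlator_zero_functional)
  have CL: "correlator (\<lambda>w. f (mode V (?L u) (- 1 - int m) w)) (?ev t rs) = of_nat (Suc m) * C (Suc m)" for m
  proof -
    have "(\<lambda>w. f (mode V (?L u) (- 1 - int m) w)) = (\<lambda>w. of_nat (Suc m) * f (mode V u (- 1 - int (Suc m)) w))"
      by (simp add: fun_eq_iff mode_vir_m1 restricted_scale[OF f] restricted_add[OF f] algebra_simps)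
    then show ?thesis
      unfolding C_def by (simp only: correlator_scale_functional[OF restricted_comp_mode[OF f]])
  qed
  have head: "h0 * recursion_sum f (?L u, h t) (?ev t rs) (Suc K) =
      (\<Sum>m<Suc K. of_nat m * h t ^ (m - 1) * h0 * C m) + (\<Sum>j<n. \<Sum>i<Suc K. h0 * EL j i / z j ^ Suc i)"
  proof -
    have "(\<Sum>m<Suc K. h t ^ m * (of_nat (Suc m) * C (Suc m))) = (\<Sum>m<Suc K. of_nat m * h t ^ (m - 1) * C m)"
    proof -
      have "C (Suc K) = 0" unfolding C_def using fz[of "Suc K"] by (simp add: correlator_zero_functional)
      then have "(\<Sum>m<Suc K. h t ^ m * (of_nat (Suc m) * C (Suc m))) = (\<Sum>m<K. h t ^ m * (of_nat (Suc m) * C (Suc m)))"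
        by simp
      also have "\<dots> = (\<Sum>m<Suc K. of_nat m * h t ^ (m - 1) * C m)"
        by (subst sum.lessThan_Suc_shift) (simp add: mult_ac)
      finally show ?thesis .
    qed
    moreover have "snd (?ev t rs ! j) = snd (rs ! j) t" if "j < n" for j
      by (rule snd_map_conv_nth) (use that n in simp)
    ultimately show ?thesis
      unfolding recursion_sum_def fst_conv snd_conv length_map n CL EL_def[symmetric]
      by (simp add: distrib_left sum_distrib_left z_def mult_ac del: sum.lessThan_Suc of_nat_Suc)
  qed
  have tail: "(\<Sum>l<n. hr l * recursion_sum f (u, h t) (map_slot l ?L (?ev t rs)) (Suc K)) =
      (\<Sum>m<Suc K. h t ^ m * C' m) + (\<Sum>j<n. \<Sum>i<Suc K. E' j i / z j ^ Suc i)"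
  proof -
    have e: "snd (?ev t rs ! j) = snd (rs ! j) t" if "j < n" for j
      by (rule snd_map_conv_nth) (use that n in simp)
    have "(\<Sum>l<n. \<Sum>j<n. \<Sum>i<Suc K. hr l * correlator f (map_slot j (mode V u (int i)) (map_slot l ?L (?ev t rs))) / z j ^ Suc i) =
        (\<Sum>j<n. \<Sum>i<Suc K. E' j i / z j ^ Suc i)"
      unfolding E'_def sum_divide_distrib by (subst sum.swap) (intro sum.cong refl sum.swap)
    moreover have "(\<Sum>l<n. \<Sum>m<Suc K. h t ^ m * (hr l * correlator (\<lambda>w. f (mode V u (- 1 - int m) w)) (map_slot l ?L (?ev t rs)))) =
        (\<Sum>m<Suc K. h t ^ m * C' m)"
      unfolding C'_def sum_distrib_left by (rule sum.swap)
    ultimately show ?thesis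
      unfolding recursion_sum_def fst_conv snd_conv length_map_slot length_map n snd_map_slot
      by (simp add: distrib_left sum_distrib_left sum.distrib e z_def[symmetric] mult.left_commute del: sum.lessThan_Suc)
  qed
  have pole: "(\<Sum>i<Suc K. (hr j * EL j i + E' j i) / z j ^ Suc i - of_nat (Suc i) * (h0 - hr j) * E j i / z j ^ Suc (Suc i)) =
      (\<Sum>i<Suc K. h0 * EL j i / z j ^ Suc i) + (\<Sum>i<Suc K. E' j i / z j ^ Suc i)" if j: "j < n" for j
  proof -
    have s: "(\<Sum>i<Suc K. of_nat (Suc i) * E j i / z j ^ Suc (Suc i)) = - (\<Sum>i<Suc K. EL j i / z j ^ Suc i)"
    proof -
      have "(\<Sum>i<Suc K. EL j i / z j ^ Suc i) = (\<Sum>i<K. EL j (Suc i) / z j ^ Suc (Suc i))"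
        by (subst sum.lessThan_Suc_shift) (simp add: EL[OF j])
      also have "\<dots> = - (\<Sum>i<K. of_nat (Suc i) * E j i / z j ^ Suc (Suc i))"
        by (simp add: EL[OF j] sum_negf del: of_nat_Suc)
      finally show ?thesis by (simp add: EK[OF j])
    qed
    have "(\<Sum>i<Suc K. (hr j * EL j i + E' j i) / z j ^ Suc i - of_nat (Suc i) * (h0 - hr j) * E j i / z j ^ Suc (Suc i)) =
      hr j * (\<Sum>i<Suc K. EL j i / z j ^ Suc i) + (\<Sum>i<Suc K. E' j i / z j ^ Suc i) -
      (h0 - hr j) * (\<Sum>i<Suc K. of_nat (Suc i) * E j i / z j ^ Suc (Suc i))"
      unfolding sum_subtractf sum_distrib_left sum.distrib[symmetric]
      by (intro arg_cong2[of _ _ _ _ "(-)"] sum.cong refl) (simp_all add: add_divide_distrib mult.left_commute mult.assoc del: of_nat_Suc)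
    moreover have "(\<Sum>i<Suc K. h0 * EL j i / z j ^ Suc i) = h0 * (\<Sum>i<Suc K. EL j i / z j ^ Suc i)"
      by (simp only: sum_distrib_left times_divide_eq_right)
    moreover have "a * S + T - (b - a) * - S = b * S + T" for a b S T :: complex
      by (simp add: algebra_simps)
    ultimately show ?thesis unfolding s by (simp only:)
  qed
  have "(\<Sum>l<length us. h' l * correlator f (map_slot l ?L (?ev t us))) =
      h0 * correlator f ((?L u, h t) # ?ev t rs) + (\<Sum>l<n. hr l * correlator f ((u, h t) # map_slot l ?L (?ev t rs)))"
    by (simp add: us n sum.lessThan_Suc_shift h0_def hr_def del: sum.lessThan_Suc)
  also have "\<dots> = h0 * recursion_sum f (?L u, h t) (?ev t rs) (Suc K) +
      (\<Sum>l<n. hr l * recursion_sum f (u, h t) (map_slot l ?L (?ev t rs)) (Suc K))"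
    by (simp add: KL Kl)
  also have "\<dots> = (\<Sum>m<Suc K. h t ^ m * C' m + of_nat m * h t ^ (m - 1) * h0 * C m) +
       (\<Sum>j<n. \<Sum>i<Suc K. (hr j * EL j i + E' j i) / z j ^ Suc i -
         of_nat (Suc i) * (h0 - hr j) * E j i / z j ^ Suc (Suc i))"
  proof -
    have "(\<Sum>j<n. \<Sum>i<Suc K. (hr j * EL j i + E' j i) / z j ^ Suc i -
         of_nat (Suc i) * (h0 - hr j) * E j i / z j ^ Suc (Suc i)) =
      (\<Sum>j<n. (\<Sum>i<Suc K. h0 * EL j i / z j ^ Suc i) + (\<Sum>i<Suc K. E' j i / z j ^ Suc i))"
      by (intro sum.cong refl, simp only: lessThan_iff, rule pole)
    also have "\<dots> = (\<Sum>j<n. \<Sum>i<Suc K. h0 * EL j i / z j ^ Suc i) + (\<Sum>j<n. \<Sum>i<Suc K. E' j i / z j ^ Suc i)"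
      by (rule sum.distrib)
    finally have "(\<Sum>j<n. \<Sum>i<Suc K. (hr j * EL j i + E' j i) / z j ^ Suc i -
         of_nat (Suc i) * (h0 - hr j) * E j i / z j ^ Suc (Suc i)) =
      (\<Sum>j<n. \<Sum>i<Suc K. h0 * EL j i / z j ^ Suc i) + (\<Sum>j<n. \<Sum>i<Suc K. E' j i / z j ^ Suc i)" .
    then show ?thesis unfolding head tail by (simp only: sum.distrib add_ac)
  qed
  finally show ?case unfolding cor using rec_deriv[of "Suc K"] by simp
qed simp

text \<open>Along a translation every derivative is given by the Ward identity, so the \<open>j\<close>-th one is the
correlator of \<open>f \<circ> L(-1)\<^sup>j\<close>.  It vanishes for large \<open>j\<close>, and Taylor's formula is a finite sum
without remainder.\<close>

lemma correlator_translate: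
  assumes f: "restricted_functional f" and dist: "distinct (map snd ps)"
    and J: "\<And>j w. j > J \<Longrightarrow> f ((vir V (-1) ^^ j) w) = 0"
  shows "correlator f (map (\<lambda>(u, y). (u, y + s)) ps) =
    (\<Sum>j\<le>J. s ^ j / fact j * correlator (\<lambda>w. f ((vir V (-1) ^^ j) w)) ps)"
proof -
  define F where "F i t = correlator (\<lambda>w. f ((vir V (-1) ^^ i) w)) (map (\<lambda>(u, y). (u, y + t)) ps)" for i t
  have "(F i has_field_derivative F (Suc i) t) (at t within UNIV)" for i t
  proof -
    define us :: "('v \<times> (complex \<Rightarrow> complex)) list" where "us = map (\<lambda>(u, y). (u, \<lambda>t. y + t)) ps"
    let ?g = "\<lambda>w. f ((vir V (-1) ^^ i) w)"
    have g: "restricted_functional ?g" by (rule restricted_comp_vir_pow[OF f])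
    have us: "map (\<lambda>(u, h). (u, h t)) us = map (\<lambda>(u, y). (u, y + t)) ps" for t
      by (simp add: us_def case_prod_beta)
    have "((\<lambda>s. correlator ?g (map (\<lambda>(u, h). (u, h s)) us)) has_field_derivative
      (\<Sum>l<length us. (\<lambda>_. 1) l * correlator ?g (map_slot l (vir V (-1)) (map (\<lambda>(u, h). (u, h t)) us)))) (at t)"
    proof (rule correlator_has_derivative[OF g])
      fix l assume "l < length us"
      then have "snd (us ! l) = (\<lambda>t. snd (ps ! l) + t)" by (simp add: us_def case_prod_beta)
      then show "(snd (us ! l) has_field_derivative 1) (at t)"
        by (auto intro!: derivative_eq_intros)
    next
      fix i j assume ij: "i < j" "j < length us"
      then have "snd (ps ! i) \<noteq> snd (ps ! j)"
        using dist nth_eq_iff_index_eq[OF dist, of i j] by (simp add: us_def)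
      then show "snd (us ! i) t \<noteq> snd (us ! j) t" using ij by (simp add: us_def case_prod_beta)
    qed
    also have "(\<Sum>l<length us. (\<lambda>_. 1) l * correlator ?g (map_slot l (vir V (-1)) (map (\<lambda>(u, h). (u, h t)) us))) =
      correlator (\<lambda>w. ?g (vir V (-1) w)) (map (\<lambda>(u, y). (u, y + t)) ps)"
      unfolding correlator_vir_m1_functional[OF g] us by (simp add: us_def)
    also have "(\<lambda>w. ?g (vir V (-1) w)) = (\<lambda>w. f ((vir V (-1) ^^ Suc i) w))"
      by (simp add: funpow_swap1)
    finally show ?thesis unfolding us F_def by simp
  qed
  moreover have "cmod (F (Suc J) t) \<le> 0" for t
    unfolding F_def using J[of "Suc J"] by (simp add: correlator_zero_functional)
  ultimately have "cmod (F 0 s - (\<Sum>i\<le>J. F i 0 * (s - 0) ^ i / fact i)) \<le> 0 * cmod (s - 0) ^ Suc J / fact J"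
    by (intro complex_Taylor[of UNIV]) auto
  then have "F 0 s = (\<Sum>i\<le>J. F i 0 * s ^ i / fact i)" by simp
  then show ?thesis by (simp add: F_def case_prod_beta mult.commute)
qed

text \<open>In the recursion each factor \<open>y\<^sup>n\<close> and each pole of order \<open>i + 1\<close> is matched by the change of
weight of the functional or of the product vector.\<close>

lemma correlator_scale:
  assumes "restricted_functional f" and "\<And>n v. n \<noteq> m \<Longrightarrow> v \<in> weight_space V n \<Longrightarrow> f v = 0"
    and "length ws = length ps" and "\<And>j. j < length ps \<Longrightarrow> fst (ps ! j) \<in> weight_space V (ws ! j)"
    and "\<mu> \<noteq> 0"
  shows "correlator f (map (\<lambda>(u, y). (u, \<mu> * y)) ps) = \<mu> powi (m - sum_list ws) * correlator f ps"
  using assms(1-4)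
proof (induction "length ps" arbitrary: f m ps ws)
  case 0
  show ?case
  proof (cases "m = 0")
    case False
    then show ?thesis using 0 "0.prems"(2)[OF _ vac_weight_space] by auto
  qed (use 0 in auto)
next
  case (Suc n)
  then obtain u y qs where ps: "ps = (u, y) # qs" and n: "length qs = n" by (cases ps) auto
  obtain h wr where ws: "ws = h # wr" and wr: "length wr = n" using Suc.prems(3) ps n by (cases ws) auto
  note f = Suc.prems(1)
  let ?sc = "map (\<lambda>(u, y). (u, \<mu> * y)) :: ('v \<times> complex) list \<Rightarrow> ('v \<times> complex) list"
  have u: "u \<in> weight_space V h" using Suc.prems(4)[of 0] by (simp add: ps ws)
  have wq: "fst (qs ! j) \<in> weight_space V (wr ! j)" if "j < n" for j
    using Suc.prems(4)[of "Suc j"] that n by (simp add: ps ws)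
  have 1: "(\<mu> * y) ^ k * correlator (\<lambda>w. f (mode V u (-1 - int k) w)) (?sc qs) =
      \<mu> powi (m - sum_list ws) * (y ^ k * correlator (\<lambda>w. f (mode V u (-1 - int k) w)) qs)" for k
  proof -
    have "correlator (\<lambda>w. f (mode V u (-1 - int k) w)) (?sc qs) =
      \<mu> powi (m - h - int k - sum_list wr) * correlator (\<lambda>w. f (mode V u (-1 - int k) w)) qs"
    proof (rule Suc.hyps(1))
      fix n' v assume "n' \<noteq> m - h - int k" and v: "v \<in> weight_space V n'"
      then show "f (mode V u (-1 - int k) v) = 0"
        by (intro Suc.prems(2)[OF _ mode_weight_space[OF u v]]) auto
    qed (use n wr wq f in \<open>auto simp: restricted_comp_mode\<close>)
    moreover have "\<mu> powi (m - sum_list ws) = \<mu> ^ k * \<mu> powi (m - h - int k - sum_list wr)"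
      using assms(5) by (simp add: ws power_int_add[symmetric] power_int_of_nat[symmetric] algebra_simps del: power_int_of_nat)
    ultimately show ?thesis by (simp add: power_mult_distrib)
  qed
  have 2: "correlator f (map_slot j (mode V u (int i)) (?sc qs)) / (\<mu> * y - snd (?sc qs ! j)) ^ Suc i =
      \<mu> powi (m - sum_list ws) * (correlator f (map_slot j (mode V u (int i)) qs) / (y - snd (qs ! j)) ^ Suc i)"
    if j: "j < n" for j i
  proof -
    have "correlator f (?sc (map_slot j (mode V u (int i)) qs)) =
      \<mu> powi (m - sum_list (wr[j := wr ! j + h - int i - 1])) * correlator f (map_slot j (mode V u (int i)) qs)"
    proof (rule Suc.hyps(1)[OF _ f Suc.prems(2)])
      fix l assume "l < length (map_slot j (mode V u (int i)) qs)"
      then show "fst (map_slot j (mode V u (int i)) qs ! l) \<in> weight_space V (wr[j := wr ! j + h - int i - 1] ! l)"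
        using n wr j wq mode_weight_space[OF u wq[OF j], of "int i"]
        by (auto simp: map_slot_fst_nth nth_list_update)
    qed (use n wr in auto)
    moreover have "sum_list (wr[j := wr ! j + h - int i - 1]) = sum_list wr + h - int i - 1"
      using j wr by (simp add: sum_list_update_group)
    moreover have "\<mu> powi (m - (sum_list wr + h - int i - 1)) = \<mu> powi (m - sum_list ws) * \<mu> ^ Suc i"
    proof -
      have "\<mu> powi (m - (sum_list wr + h - int i - 1)) = \<mu> powi (m - sum_list ws + int (Suc i))"
        by (simp add: ws algebra_simps)
      also have "\<dots> = \<mu> powi (m - sum_list ws) * \<mu> powi (int (Suc i))"
        using assms(5) by (intro power_int_add) auto
      finally show ?thesis by (simp only: power_int_of_nat)
    qed
    moreover have "snd (?sc qs ! j) = \<mu> * snd (qs ! j)" by (rule snd_map_conv_nth) (use j n in simp)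
    moreover have "(\<mu> * y - \<mu> * snd (qs ! j)) ^ Suc i = \<mu> ^ Suc i * (y - snd (qs ! j)) ^ Suc i"
      by (simp only: power_mult_distrib[symmetric] right_diff_distrib)
    ultimately show ?thesis using assms(5) by (simp add: map_slot_map)
  qed
  have sum: "recursion_sum f (u, \<mu> * y) (?sc qs) K = \<mu> powi (m - sum_list ws) * recursion_sum f (u, y) qs K" for K
    unfolding recursion_sum_def fst_conv snd_conv length_map n 1 distrib_left sum_distrib_left
    by (intro arg_cong2[of _ _ _ _ "(+)"] refl sum.cong) (rule 2, simp)
  have "\<forall>\<^sub>F K in sequentially. correlator f ((u, \<mu> * y) # ?sc qs) = \<mu> powi (m - sum_list ws) * correlator f ((u, y) # qs)"
    using eventually_correlator_Cons[OF f, of "(u, \<mu> * y)" "?sc qs"] eventually_correlator_Cons[OF f, of "(u, y)" qs]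
    by eventually_elim (simp only: sum)
  then show ?case by (simp add: ps)
qed

end

section \<open>The invariant form and inversion of the insertion points\<close>

text \<open>Since the weights are nonnegative, a power of \<open>L(1)\<close> beyond the weight of a vector annihilates it, and
the exponentials of \<open>L(1)\<close> below are finite sums.\<close>

locale voa_with_form = vertex_operator_algebra V for V :: "'v::ab_group_add vertex_data" +
  fixes \<beta> :: "'v \<Rightarrow> 'v \<Rightarrow> complex"
  assumes invariant: "invariant_form V \<beta>" and nondegenerate: "nondegenerate_form \<beta>"
    and negative_weight: "n < 0 \<Longrightarrow> v \<in> weight_space V n \<Longrightarrow> v = 0"
begin

lemma form_add_right: "\<beta> v (w + w') = \<beta> v w + \<beta> v w'"
  and form_scale_right: "\<beta> v (smul V c w) = c * \<beta> v w"
  and form_add_left: "\<beta> (v + v') w = \<beta> v w + \<beta> v' w"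
  and form_scale_left: "\<beta> (smul V c v) w = c * \<beta> v w"
  using invariant unfolding invariant_form_def by (auto simp: Vector_Spaces.linear_iff)

lemma form_zero [simp]: "\<beta> 0 w = 0" "\<beta> v 0 = 0"
  using form_scale_left[of 0 0 w] form_scale_right[of v 0 0] by simp_all

lemma form_sum_right: "\<beta> v (\<Sum>a\<in>A. g a) = (\<Sum>a\<in>A. \<beta> v (g a))"
  and form_sum_left: "\<beta> (\<Sum>a\<in>A. g a) w = (\<Sum>a\<in>A. \<beta> (g a) w)"
  by (induction A rule: infinite_finite_induct) (simp_all add: form_add_right form_add_left)

lemma form_mode: "u \<in> weight_space V k \<Longrightarrow> \<beta> (mode V u n v) w = \<beta> v (adj_mode V k u n w)"
  using invariant unfolding invariant_form_def by blast

lemma adj_mode_bounded: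
  assumes "\<And>j. j \<ge> J \<Longrightarrow> (vir V 1 ^^ j) u = 0"
  shows "adj_mode V k u n w = (\<Sum>j<J. smul V ((-1) powi k / fact j) (mode V ((vir V 1 ^^ j) u) (2 * k - n - int j - 2) w))"
  unfolding adj_mode_def
proof (rule sum.mono_neutral_left)
  show "{j. (vir V 1 ^^ j) u \<noteq> 0} \<subseteq> {..<J}" using assms by (auto simp: not_le[symmetric])
qed auto

text \<open>For quasiprimary vectors the adjoint of a mode is a single mode, and the relation is its own inverse.\<close>

lemma form_mode_quasiprimary:
  assumes "u \<in> weight_space V k" and "vir V 1 u = 0"
  shows "\<beta> (mode V u n v) w = (-1) powi k * \<beta> v (mode V u (2 * k - n - 2) w)"
proof -
  have "(vir V 1 ^^ j) u = 0" if "j \<ge> 1" for j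
    using that assms(2) by (cases j) (auto simp: funpow_swap1)
  then show ?thesis
    by (simp add: form_mode[OF assms(1)] adj_mode_bounded[of 1] form_scale_right)
qed

lemma form_vir: "\<beta> (vir V n v) w = \<beta> v (vir V (- n) w)"
  using form_mode_quasiprimary[OF conf_weight_space vir_1_conf, of "n + 1" v w] by (simp add: vir_def)

lemma form_vir_pow: "\<beta> ((vir V n ^^ j) v) w = \<beta> v ((vir V (- n) ^^ j) w)"
  by (induction j arbitrary: v w) (simp_all add: form_vir funpow_swap1)

lemma form_orthogonal:
  assumes "v \<in> weight_space V m" and "w \<in> weight_space V n" and "m \<noteq> n"
  shows "\<beta> v w = 0"
proof -
  have "of_int m * \<beta> v w = of_int n * \<beta> v w"
    using form_vir[of 0 v w] assms(1,2) by (simp add: weight_space_def form_scale_left form_scale_right)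
  then show ?thesis using assms(3) by simp
qed

lemma restricted_form_left: "restricted_functional (\<lambda>x. \<beta> x a)"
proof -
  have "\<exists>N. \<forall>n\<ge>N. \<forall>v\<in>weight_space V n. \<beta> v a = 0"
  proof (induction a rule: homogeneous_induct)
    case (add a b)
    then obtain K K' where "\<forall>n\<ge>K. \<forall>v\<in>weight_space V n. \<beta> v a = 0" "\<forall>n\<ge>K'. \<forall>v\<in>weight_space V n. \<beta> v b = 0" by blast
    then show ?case by (intro exI[of _ "max K K'"]) (auto simp: form_add_right)
  next
    case (homogeneous m a)
    then show ?case by (intro exI[of _ "m + 1"]) (auto intro: form_orthogonal)
  qed (auto simp: form_scale_right)
  then show ?thesis by (simp add: restricted_functional_def form_add_left form_scale_left)
qed

lemma restricted_form_right: "restricted_functional (\<beta> a)"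
proof -
  have "\<exists>N. \<forall>n\<ge>N. \<forall>v\<in>weight_space V n. \<beta> a v = 0"
  proof (induction a rule: homogeneous_induct)
    case (add a b)
    then obtain K K' where "\<forall>n\<ge>K. \<forall>v\<in>weight_space V n. \<beta> a v = 0" "\<forall>n\<ge>K'. \<forall>v\<in>weight_space V n. \<beta> b v = 0" by blast
    then show ?case by (intro exI[of _ "max K K'"]) (auto simp: form_add_left)
  next
    case (homogeneous m a)
    then show ?case by (intro exI[of _ "m + 1"]) (auto intro: form_orthogonal)
  qed (auto simp: form_scale_left)
  then show ?thesis by (simp add: restricted_functional_def form_add_right form_scale_right)
qed

text \<open>The product of the Jacobian factors \<open>(-y\<^sup>-\<^sup>2)\<^sup>w\<close> of the map \<open>y \<mapsto> 1/y\<close>.\<close>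

definition inversion_factor :: "nat list \<Rightarrow> complex list \<Rightarrow> complex" where
  "inversion_factor ws ys = (\<Prod>i<length ys. (-1) ^ (ws ! i) * ys ! i powi (- 2 * int (ws ! i)))"

lemma inversion_factor_Cons:
  "inversion_factor (w # ws) (y # ys) = (-1) ^ w * y powi (- 2 * int w) * inversion_factor ws ys"
  by (simp add: inversion_factor_def prod.lessThan_Suc_shift del: prod.lessThan_Suc)

text \<open>The adjoint of a quasiprimary mode \<open>u(k)\<close> is \<open>u(2w-k-2)\<close>, and its power of \<open>y\<close> becomes the one that
belongs to the new label at the point \<open>1/y\<close>, up to \<open>y\<^sup>-\<^sup>2\<^sup>w\<close>.\<close>

lemma form_product_term:
  assumes "length ws = length qs" and "length ks = length qs"
    and "\<And>i. i < length qs \<Longrightarrow> quasiprimary V (ws ! i) (fst (qs ! i))"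
    and "\<And>i. i < length qs \<Longrightarrow> snd (qs ! i) \<noteq> 0"
  shows "\<beta> (product_term qs ks x) a = inversion_factor ws (map snd qs) *
    \<beta> x (product_term (rev (map (\<lambda>(u, y). (u, inverse y)) qs)) (rev (map2 (\<lambda>w k. 2 * int w - k - 2) ws ks)) a)"
  using assms(1) assms(2)[symmetric] assms(3,4)
proof (induction ws qs ks arbitrary: a rule: list_induct3)
  case (Cons w ws q qs k ks)
  obtain u y where q: "q = (u, y)" by (cases q)
  have u: "u \<in> weight_space V (int w)" "vir V 1 u = 0"
    using Cons.prems(1)[of 0] by (simp_all add: q quasiprimary_def)
  have y: "y \<noteq> 0" using Cons.prems(2)[of 0] by (simp add: q)
  let ?l = "2 * int w - k - 2"
  let ?inv = "map (\<lambda>(u, y). (u, inverse y)) qs" and ?ls = "map2 (\<lambda>w k. 2 * int w - k - 2) ws ks"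
  have e: "y powi (- k - 1) = y powi (- 2 * int w) * inverse y powi (- ?l - 1)"
  proof -
    have "inverse y powi (- ?l - 1) = y powi (- (- ?l - 1))"
      by (simp only: power_int_inverse power_int_minus)
    also have "y powi (- 2 * int w) * \<dots> = y powi (- 2 * int w + - (- ?l - 1))"
      using y by (intro power_int_add[symmetric]) auto
    finally show ?thesis by simp
  qed
  have "\<beta> (product_term (q # qs) (k # ks) x) a =
      y powi (- k - 1) * (-1) ^ w * \<beta> (product_term qs ks x) (mode V u ?l a)"
    by (simp add: q form_scale_left form_mode_quasiprimary[OF u] power_int_of_nat)
  also have "\<beta> (product_term qs ks x) (mode V u ?l a) = inversion_factor ws (map snd qs) *
    \<beta> x (product_term (rev ?inv) (rev ?ls) (mode V u ?l a))"
    by (rule Cons.IH) (use Cons.prems[of "Suc i" for i] in auto)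
  also have "y powi (- k - 1) * (-1) ^ w * (inversion_factor ws (map snd qs) *
      \<beta> x (product_term (rev ?inv) (rev ?ls) (mode V u ?l a))) =
    inversion_factor (w # ws) (map snd (q # qs)) *
     \<beta> x (product_term (rev ?inv) (rev ?ls) (smul V (inverse y powi (- ?l - 1)) (mode V u ?l a)))"
    unfolding e by (simp add: q inversion_factor_Cons product_term_scale form_scale_right)
  also have "product_term (rev ?inv) (rev ?ls) (smul V (inverse y powi (- ?l - 1)) (mode V u ?l a)) =
    product_term (rev ?inv @ [(u, inverse y)]) (rev ?ls @ [?l]) a"
    using Cons.hyps by (subst product_term_append) auto
  finally show ?case by (simp add: q)
qed (simp add: inversion_factor_def)

text \<open>All modes are moved from the left to the right argument of the form.  This reverses the product and
replaces each label \<open>k\<close> of a quasiprimary vector by \<open>2w - k - 2\<close>, so a point \<open>y\<close> becomes \<open>1/y\<close> and a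
radially ordered point stays one.  The vector \<open>c\<close> is arbitrary and its adjoint contains all
\<open>L(1)\<^sup>j c\<close>; the vector \<open>a\<close>, which was at infinity, ends up at \<open>0\<close>.\<close>

lemma correlator_inversion:
  fixes qs :: "('v \<times> complex) list" and m :: int
  assumes len: "length ws = length qs"
    and qp: "\<And>i. i < length qs \<Longrightarrow> quasiprimary V (ws ! i) (fst (qs ! i))"
    and c: "c \<in> weight_space V m" and J: "\<And>j. j \<ge> J \<Longrightarrow> (vir V 1 ^^ j) c = 0"
    and dist: "distinct (x0 # map snd qs)" and nz: "0 \<notin> set (x0 # map snd qs)"
  shows "correlator (\<lambda>x. \<beta> x a) ((c, x0) # qs) = inversion_factor ws (map snd qs) *
    (\<Sum>j<J. (-1) powi m * x0 powi (int j - 2 * m) / fact j *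
      correlator (\<beta> (vac V)) (map (\<lambda>(u, y). (u, inverse y)) qs @ [((vir V 1 ^^ j) c, inverse x0), (a, 0)]))"
proof -
  let ?n = "length qs"
  let ?refl = "map2 (\<lambda>w k. 2 * int w - k - 2) ws"
    and ?end = "\<lambda>j ys. [((vir V 1 ^^ j) c, inverse (ys ! 0)), (a, 0)]"
  define D where "D = {ys :: complex list. length ys = Suc ?n \<and> distinct ys \<and> 0 \<notin> set ys}"
  define qat where "qat ys = zip (map fst qs) (tl ys)" for ys :: "complex list"
  \<comment> \<open>Both sides as functions of the positions \<open>ys\<close> of \<open>c\<close> and \<open>qs\<close>.\<close>
  let ?iq = "\<lambda>ys. map (\<lambda>(u, y). (u, inverse y)) (qat ys)"
  define g where "g ys = correlator (\<lambda>x. \<beta> x a) ((c, ys ! 0) # qat ys)" for ys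
  define g' where "g' ys = inversion_factor ws (tl ys) *
    (\<Sum>j<J. (-1) powi m * ys ! 0 powi (int j - 2 * m) / fact j *
      correlator (\<beta> (vac V)) (?iq ys @ ?end j ys))" for ys
  have Dne: "ys ! i \<noteq> 0" if "ys \<in> D" "i \<le> ?n" for ys i
  proof
    assume "ys ! i = 0"
    moreover have "i < length ys" "0 \<notin> set ys" using that by (auto simp: D_def)
    ultimately show False using nth_mem[of i ys] by simp
  qed
  have Dinj: "ys ! i = ys ! j \<longleftrightarrow> i = j" if "ys \<in> D" "i \<le> ?n" "j \<le> ?n" for ys i j
    using that by (auto simp: D_def nth_eq_iff_index_eq)
  have pw: "rational_on (Suc ?n) D (\<lambda>ys. ys ! i powi k)" if "i \<le> ?n" for i k
  proof (cases "k \<ge> 0")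
    case True
    then have "(\<lambda>ys. ys ! i powi k) = (\<lambda>ys :: complex list. (ys ! i) ^ nat k)"
      by (simp add: power_int_def)
    then show ?thesis using that by (auto intro!: rational_on_power rational_on_nth)
  next
    case False
    then have "(\<lambda>ys. ys ! i powi k) = (\<lambda>ys :: complex list. inverse (ys ! i) ^ nat (- k))"
      by (simp add: power_int_def)
    then show ?thesis using that Dne by (auto intro!: rational_on_power rational_on_inverse rational_on_nth)
  qed
  have "rational_on (Suc ?n) D (\<lambda>ys. correlator (\<lambda>x. \<beta> x a) (map (\<lambda>(u, h). (u, h ys))
      (map (\<lambda>i. ((c # map fst qs) ! i, \<lambda>ys. ys ! i)) [0..<Suc ?n])))"
    by (rule correlator_rational[OF restricted_form_left]) (auto simp: Dinj simp del: upt_Suc)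
  then have rg: "rational_on (Suc ?n) D g"
  proof (rule rational_on_cong)
    fix ys assume ys: "ys \<in> D"
    have "(c, ys ! 0) # qat ys = map (\<lambda>(u, h). (u, h ys)) (map (\<lambda>i. ((c # map fst qs) ! i, \<lambda>ys. ys ! i)) [0..<Suc ?n])"
      by (rule nth_equalityI) (use ys in \<open>auto simp: qat_def D_def nth_Cons nth_tl simp del: upt_Suc split: nat.splits\<close>)
    then show "g ys = correlator (\<lambda>x. \<beta> x a) (map (\<lambda>(u, h). (u, h ys)) (map (\<lambda>i. ((c # map fst qs) ! i, \<lambda>ys. ys ! i)) [0..<Suc ?n]))"
      by (simp only: g_def)
  qed
  have rj: "rational_on (Suc ?n) D (\<lambda>ys. correlator (\<beta> (vac V))
     (?iq ys @ ?end j ys))" for j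
  proof -
    define us where "us = map (\<lambda>i. (fst (qs ! i), \<lambda>ys :: complex list. inverse (ys ! Suc i))) [0..<?n] @
      [((vir V 1 ^^ j) c, \<lambda>ys. inverse (ys ! 0)), (a, \<lambda>_. 0)]"
    have us_nth: "snd (us ! i) = (if i < ?n then \<lambda>ys. inverse (ys ! Suc i) else if i = ?n then \<lambda>ys. inverse (ys ! 0) else (\<lambda>_. 0))"
      if "i < Suc (Suc ?n)" for i
      using that by (auto simp: us_def nth_append nth_Cons split: nat.splits)
    have lus: "length us = Suc (Suc ?n)" by (simp add: us_def)
    have "rational_on (Suc ?n) D (\<lambda>ys. correlator (\<beta> (vac V)) (map (\<lambda>(u, h). (u, h ys)) us))"
    proof (rule correlator_rational[OF restricted_form_right])
      fix i assume "i < length us"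
      then show "rational_on (Suc ?n) D (snd (us ! i))"
        using lus us_nth[of i] Dne by (auto intro!: rational_on_inverse rational_on_nth)
    next
      fix i l ys assume "i < l" "l < length us" "ys \<in> D"
      then show "snd (us ! i) ys \<noteq> snd (us ! l) ys"
        using lus us_nth[of i] us_nth[of l] Dinj[of ys "Suc i" "Suc l"] Dinj[of ys "Suc i" 0] Dne[of ys "Suc i"] Dne[of ys 0]
        by auto
    qed
    then show ?thesis
    proof (rule rational_on_cong)
      fix ys assume ys: "ys \<in> D"
      have "?iq ys = map (\<lambda>i. (fst (qs ! i), inverse (ys ! Suc i))) [0..<?n]"
        by (rule nth_equalityI) (use ys in \<open>auto simp: qat_def D_def nth_tl\<close>)
      then show "correlator (\<beta> (vac V)) (?iq ys @ ?end j ys) =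
        correlator (\<beta> (vac V)) (map (\<lambda>(u, h). (u, h ys)) us)"
        by (simp add: us_def o_def)
    qed
  qed
  have "rational_on (Suc ?n) D (\<lambda>ys. (\<Prod>i<?n. (-1) ^ (ws ! i) * ys ! Suc i powi (- 2 * int (ws ! i))))"
    by (intro rational_on_prod rational_on_mult rational_on_const pw) auto
  then have "rational_on (Suc ?n) D (\<lambda>ys. inversion_factor ws (tl ys))"
    by (rule rational_on_cong) (auto simp: inversion_factor_def D_def nth_tl intro!: prod.cong)
  then have rg': "rational_on (Suc ?n) D g'"
    unfolding g'_def divide_inverse
    by (intro rational_on_mult rational_on_sum rational_on_const pw rj) auto
  have eq: "g ys = g' ys" if ys: "ys \<in> radially_ordered (Suc ?n)" for ys
  proof -
    let ?qs = "qat ys" and ?x = "ys ! 0"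
    have lys: "length ys = Suc ?n" using ys by (rule radially_ordered_length)
    then have lq: "length ?qs = ?n" by (simp add: qat_def)
    have ycons: "ys = ?x # tl ys" using lys by (cases ys) auto
    have snd_qat: "map snd ?qs = tl ys" and fst_qat: "map fst ?qs = map fst qs" using lys by (simp_all add: qat_def)
    have ysD: "ys \<in> D" using ys by (simp add: D_def radially_ordered_length radially_ordered_distinct radially_ordered_nonzero)
    have x: "?x \<noteq> 0" using Dne[OF ysD] by simp
    have lhs: "((\<lambda>ks. \<beta> (product_term ((c, ?x) # ?qs) ks (vac V)) a) has_sum g ys) {ks. length ks = Suc ?n}"
    proof -
      have "map snd ((c, ?x) # ?qs) \<in> radially_ordered (length ((c, ?x) # ?qs))"
        using ys ycons snd_qat lq by simp
      from correlator_has_sum[OF restricted_form_left this, of "vac V" a] show ?thesis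
        unfolding g_def correlator_vac_last[OF restricted_form_left] by (simp add: lq)
    qed
    let ?inv = "map (\<lambda>(u, y). (u, inverse y)) ?qs"
    have inv_snd: "map snd ?inv = map inverse (tl ys)" unfolding snd_qat[symmetric] by (simp add: case_prod_beta)
    let ?co = "\<lambda>j. (-1) powi m * ?x powi (int j - 2 * m) / fact j"
    have rhs: "((\<lambda>ls. \<beta> (vac V) (product_term (rev ?inv @ [((vir V 1 ^^ j) c, inverse ?x)]) ls a)) has_sum
      correlator (\<beta> (vac V)) (?inv @ [((vir V 1 ^^ j) c, inverse ?x), (a, 0)])) {ls. length ls = Suc ?n}" for j
    proof -
      let ?l = "rev ?inv @ [((vir V 1 ^^ j) c, inverse ?x)]"
      have pos: "map snd ?l = rev (map inverse ys)"
      proof -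
        have "map snd ?l = rev (map snd ?inv) @ [inverse ?x]" by (simp add: rev_map)
        also have "\<dots> = rev (map inverse (?x # tl ys))" unfolding inv_snd by simp
        finally show ?thesis using ycons by simp
      qed
      have "map snd ?l \<in> radially_ordered (length ?l)"
        unfolding pos using ys lys lq
        by (auto simp: radially_ordered_iff_nth rev_nth norm_inverse)
      from correlator_has_sum[OF restricted_form_right this, of "vac V" a]
      have "((\<lambda>ls. \<beta> (vac V) (product_term ?l ls a)) has_sum correlator (\<beta> (vac V)) (?l @ [(a, 0)])) {ls. length ls = Suc ?n}"
        by (simp add: lq)
      moreover have "correlator (\<beta> (vac V)) (rev ?inv @ [((vir V 1 ^^ j) c, inverse ?x), (a, 0)]) =
        correlator (\<beta> (vac V)) (?inv @ [((vir V 1 ^^ j) c, inverse ?x), (a, 0)])"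
      proof (rule correlator_rev_append[OF restricted_form_right])
        have "distinct (map inverse ys)" "0 \<notin> set (map inverse ys)"
          using radially_ordered_distinct[OF ys] radially_ordered_nonzero[OF ys]
          by (auto simp: distinct_map inj_on_def)
        moreover have "map inverse ys = inverse ?x # map inverse (tl ys)" by (subst ycons) simp
        ultimately show "distinct (map snd (?inv @ [((vir V 1 ^^ j) c, inverse ?x), (a, 0)]))"
          unfolding map_append inv_snd by auto
      qed
      ultimately show ?thesis by simp
    qed
    have termwise: "\<beta> (product_term ((c, ?x) # ?qs) (k # ks) (vac V)) a =
      (\<Sum>j<J. (inversion_factor ws (tl ys) * ?co j) * \<beta> (vac V) (product_term (rev ?inv @ [((vir V 1 ^^ j) c, inverse ?x)])
        (rev (?refl ks) @ [2 * m - k - int j - 2]) a))"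
      if ks: "length ks = ?n" for k ks
    proof -
      let ?ls = "rev (?refl ks)"
      have "\<beta> (product_term ((c, ?x) # ?qs) (k # ks) (vac V)) a = ?x powi (- k - 1) * \<beta> (product_term ?qs ks (vac V)) (adj_mode V m c k a)"
        by (simp add: form_scale_left form_mode[OF c])
      also have "\<dots> = (\<Sum>j<J. ?x powi (- k - 1) * ((-1) powi m / fact j) *
        \<beta> (product_term ?qs ks (vac V)) (mode V ((vir V 1 ^^ j) c) (2 * m - k - int j - 2) a))"
        by (simp add: adj_mode_bounded[OF J] form_sum_right form_scale_right sum_distrib_left mult.assoc)
      also have "\<dots> = (\<Sum>j<J. (inversion_factor ws (tl ys) * ?co j) * \<beta> (vac V) (product_term (rev ?inv @ [((vir V 1 ^^ j) c, inverse ?x)])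
        (?ls @ [2 * m - k - int j - 2]) a))"
      proof (rule sum.cong)
        fix j
        let ?k = "2 * m - k - int j - 2"
        have e: "?x powi (- k - 1) = ?x powi (int j - 2 * m) * inverse ?x powi (- ?k - 1)"
        proof -
          have "inverse ?x powi (- ?k - 1) = ?x powi (- (- ?k - 1))"
            by (simp only: power_int_inverse power_int_minus)
          also have "?x powi (int j - 2 * m) * \<dots> = ?x powi (int j - 2 * m + - (- ?k - 1))"
            using x by (intro power_int_add[symmetric]) auto
          also have "int j - 2 * m + - (- ?k - 1) = - k - 1" by simp
          finally show ?thesis by (rule sym)
        qed
        have "\<beta> (product_term ?qs ks (vac V)) (mode V ((vir V 1 ^^ j) c) ?k a) = inversion_factor ws (map snd ?qs) *
          \<beta> (vac V) (product_term (rev ?inv) ?ls (mode V ((vir V 1 ^^ j) c) ?k a))"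
        proof (rule form_product_term)
          fix i assume i: "i < length ?qs"
          have "fst (?qs ! i) = fst (qs ! i)" using i fst_qat lq by (metis nth_map)
          then show "quasiprimary V (ws ! i) (fst (?qs ! i))" using qp i lq by simp
          have "snd (?qs ! i) = ys ! Suc i" using i snd_qat lq lys by (metis nth_map nth_tl length_map)
          then show "snd (?qs ! i) \<noteq> 0" using Dne[OF ysD, of "Suc i"] i lq by simp
        qed (use lq len ks in auto)
        moreover have "product_term (rev ?inv @ [((vir V 1 ^^ j) c, inverse ?x)]) (?ls @ [?k]) a =
          smul V (inverse ?x powi (- ?k - 1)) (product_term (rev ?inv) ?ls (mode V ((vir V 1 ^^ j) c) ?k a))"
          using ks len lq by (subst product_term_append) (auto simp: product_term_scale)
        ultimately show "?x powi (- k - 1) * ((-1) powi m / fact j) *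
          \<beta> (product_term ?qs ks (vac V)) (mode V ((vir V 1 ^^ j) c) ?k a) =
          (inversion_factor ws (tl ys) * ?co j) * \<beta> (vac V) (product_term (rev ?inv @ [((vir V 1 ^^ j) c, inverse ?x)]) (?ls @ [?k]) a)"
          unfolding e snd_qat by (simp add: form_scale_right)
      qed simp
      finally show ?thesis .
    qed
    have "((\<lambda>ks. \<Sum>j<J. (inversion_factor ws (tl ys) * ?co j) * \<beta> (vac V) (product_term (rev ?inv @ [((vir V 1 ^^ j) c, inverse ?x)])
        (rev (?refl (tl ks)) @ [2 * m - hd ks - int j - 2]) a)) has_sum
      (\<Sum>j<J. (inversion_factor ws (tl ys) * ?co j) * correlator (\<beta> (vac V)) (?inv @ [((vir V 1 ^^ j) c, inverse ?x), (a, 0)])))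
      {ks. length ks = Suc ?n}"
    proof (intro has_sum_finite_sum has_sum_cmult_right)
      fix j
      show "((\<lambda>ks. \<beta> (vac V) (product_term (rev ?inv @ [((vir V 1 ^^ j) c, inverse ?x)])
        (rev (?refl (tl ks)) @ [2 * m - hd ks - int j - 2]) a)) has_sum
        correlator (\<beta> (vac V)) (?inv @ [((vir V 1 ^^ j) c, inverse ?x), (a, 0)])) {ks. length ks = Suc ?n}"
      proof (rule has_sum_reindex_bij_witness
          [where h = "\<lambda>ls. \<beta> (vac V) (product_term (rev ?inv @ [((vir V 1 ^^ j) c, inverse ?x)]) ls a)"
            and j = "\<lambda>ks. rev (?refl (tl ks)) @ [2 * m - hd ks - int j - 2]"
            and i = "\<lambda>ls. (2 * m - last ls - int j - 2) # ?refl (rev (butlast ls))"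
            and T = "{ls. length ls = Suc ?n}", THEN iffD2, OF _ _ _ _ _ _ rhs])
        have mm: "?refl (?refl ls) = ls" if "length ls = ?n" for ls
          by (rule nth_equalityI) (use that len in auto)
        show "(2 * m - last (rev (?refl (tl ks)) @ [2 * m - hd ks - int j - 2]) - int j - 2) #
          ?refl (rev (butlast (rev (?refl (tl ks)) @ [2 * m - hd ks - int j - 2]))) = ks"
          if "ks \<in> {ks. length ks = Suc ?n}" for ks
          using that mm by (cases ks) auto
        show "rev (?refl (tl ((2 * m - last ls - int j - 2) # ?refl (rev (butlast ls))))) @
          [2 * m - hd ((2 * m - last ls - int j - 2) # ?refl (rev (butlast ls))) - int j - 2] = ls"
          if "ls \<in> {ls. length ls = Suc ?n}" for ls
          using that mm by (cases ls rule: rev_cases) auto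
      qed (use len in auto)
    qed
    also have "?this \<longleftrightarrow> ((\<lambda>ks. \<beta> (product_term ((c, ?x) # ?qs) ks (vac V)) a) has_sum
      (\<Sum>j<J. (inversion_factor ws (tl ys) * ?co j) * correlator (\<beta> (vac V)) (?inv @ [((vir V 1 ^^ j) c, inverse ?x), (a, 0)])))
      {ks. length ks = Suc ?n}"
    proof (rule has_sum_cong)
      fix ks :: "int list" assume "ks \<in> {ks. length ks = Suc ?n}"
      then obtain k ks' where "ks = k # ks'" "length ks' = ?n" by (cases ks) auto
      then show "(\<Sum>j<J. (inversion_factor ws (tl ys) * ?co j) * \<beta> (vac V) (product_term (rev ?inv @ [((vir V 1 ^^ j) c, inverse ?x)])
        (rev (?refl (tl ks)) @ [2 * m - hd ks - int j - 2]) a)) =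
        \<beta> (product_term ((c, ?x) # ?qs) ks (vac V)) a"
        using termwise by simp
    qed
    finally have "g ys = (\<Sum>j<J. (inversion_factor ws (tl ys) * ?co j) * correlator (\<beta> (vac V)) (?inv @ [((vir V 1 ^^ j) c, inverse ?x), (a, 0)]))"
      using lhs has_sum_unique by blast
    then show ?thesis
      unfolding g'_def sum_distrib_left by (simp only: mult.assoc)
  qed
  define xs where "xs = x0 # map snd qs"
  have "g xs = g' xs"
    by (rule rational_on_eqI[OF rg rg' _ _ _ eq])
      (use dist nz in \<open>auto simp: xs_def D_def radially_ordered_distinct radially_ordered_length radially_ordered_nonzero\<close>)
  moreover have "qat xs = qs" by (simp add: qat_def xs_def zip_map_fst_snd)
  ultimately show ?thesis unfolding g_def g'_def by (simp add: xs_def)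
qed

section \<open>The coordinate change that sends the two sewing points to zero and infinity\<close>

lemma vac_form_vir_m1_pow: "j > 0 \<Longrightarrow> \<beta> (vac V) ((vir V (-1) ^^ j) w) = 0"
proof -
  assume "j > 0"
  then obtain n where j: "j = Suc n" by (cases j) auto
  have "vir V 1 (vac V) = 0" by (simp add: vir_def mode_on_vac)
  then have "(vir V 1 ^^ j) (vac V) = 0" unfolding j funpow_Suc_right by simp
  then show ?thesis using form_vir_pow[of j 1 "vac V" w] by simp
qed

text \<open>The vacuum functional is invariant under translations because \<open>L(1)\<close> annihilates the vacuum.\<close>

lemma vacuum_correlator_translate:
  assumes "distinct (map snd ps)"
  shows "correlator (\<beta> (vac V)) (map (\<lambda>(u, y). (u, y + s)) ps) = correlator (\<beta> (vac V)) ps"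
  using correlator_translate[OF restricted_form_right assms, of 0 "vac V" s] by (simp add: vac_form_vir_m1_pow)

text \<open>With \<open>D = Wp - Wm\<close> and \<open>x = 1/(z - Wp)\<close> one has \<open>Z/D = x + 1/D\<close>.  The translation by \<open>-1/D\<close> turns \<open>a\<close> into
\<open>e\<^sup>L\<^sup>(\<^sup>1\<^sup>)\<^sup>/\<^sup>D a\<close> and moves \<open>c\<close> from \<open>0\<close> to \<open>-1/D\<close>.  The inversion sends the points to
\<open>z - Wp\<close>, \<open>c\<close> to \<open>-D = Wm - Wp\<close> and \<open>a\<close> to \<open>0\<close>, and the last translation adds \<open>Wp\<close>.\<close>

lemma correlator_mobius:
  fixes ps :: "('v \<times> complex) list" and m :: int
  assumes len: "length ws = length ps"
    and qp: "\<And>i. i < length ps \<Longrightarrow> quasiprimary V (ws ! i) (fst (ps ! i))"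
    and c: "c \<in> weight_space V m" and J: "\<And>j. j \<ge> J \<Longrightarrow> (vir V 1 ^^ j) c = 0"
    and I: "\<And>i. i > I \<Longrightarrow> (vir V 1 ^^ i) a = 0"
    and dist: "distinct (map snd ps @ [Wp, Wm])"
  shows "correlator (\<lambda>x. \<beta> x a) (map (\<lambda>(u, z). (u, (z - Wm) / (z - Wp) / (Wp - Wm))) ps @ [(c, 0)]) =
    inversion_factor ws (map (\<lambda>z. inverse (z - Wp)) (map snd ps)) *
    (\<Sum>i\<le>I. (1 / (Wp - Wm)) ^ i / fact i * (\<Sum>j<J. (-1) powi m * (- 1 / (Wp - Wm)) powi (int j - 2 * m) / fact j *
      correlator (\<beta> (vac V)) (ps @ [((vir V 1 ^^ i) a, Wp), ((vir V 1 ^^ j) c, Wm)])))"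
proof -
  define D where "D = Wp - Wm"
  have D: "D \<noteq> 0" using dist by (simp add: D_def)
  have nz: "z - Wp \<noteq> 0" "z \<noteq> Wm" if "z \<in> set (map snd ps)" for z
    using dist that by auto
  define qs where "qs = map (\<lambda>(u, z). (u, inverse (z - Wp))) ps"
  have snd_qs: "map snd qs = map (\<lambda>z. inverse (z - Wp)) (map snd ps)"
    by (simp add: qs_def case_prod_beta)
  let ?x0 = "- 1 / D"
  have dqs: "distinct (map snd qs)"
    unfolding snd_qs using dist by (subst distinct_map) (auto simp: inj_on_def)
  have xqs: "?x0 \<notin> set (map snd qs)"
  proof
    assume "?x0 \<in> set (map snd qs)"
    then obtain z where z: "z \<in> set (map snd ps)" "- 1 / D = inverse (z - Wp)"
      unfolding snd_qs by auto
    then have "z - Wp = - D" using D nz(1)[OF z(1)] by (simp add: field_simps)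
    then show False using nz(2)[OF z(1)] by (simp add: D_def)
  qed
  have zqs: "0 \<notin> set (map snd qs)" unfolding snd_qs using nz by force
  have "map (\<lambda>(u, z). (u, (z - Wm) / (z - Wp) / D)) ps = map (\<lambda>(u, y). (u, y + 1 / D)) qs"
  proof -
    have "(z - Wm) / (z - Wp) / D = inverse (z - Wp) + 1 / D" if "z \<in> set (map snd ps)" for z
      using nz(1)[OF that] D by (simp add: field_simps) (simp add: D_def)
    then show ?thesis by (force simp: qs_def)
  qed
  then have "map (\<lambda>(u, z). (u, (z - Wm) / (z - Wp) / D)) ps @ [(c, 0)] = map (\<lambda>(u, y). (u, y + 1 / D)) (qs @ [(c, ?x0)])"
    by simp
  then have "correlator (\<lambda>x. \<beta> x a) (map (\<lambda>(u, z). (u, (z - Wm) / (z - Wp) / D)) ps @ [(c, 0)]) =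
    correlator (\<lambda>x. \<beta> x a) (map (\<lambda>(u, y). (u, y + 1 / D)) (qs @ [(c, ?x0)]))" by simp
  also have "\<dots> = (\<Sum>i\<le>I. (1 / D) ^ i / fact i * correlator (\<lambda>w. \<beta> ((vir V (-1) ^^ i) w) a) (qs @ [(c, ?x0)]))"
    by (rule correlator_translate[OF restricted_form_left])
      (use dqs xqs I in \<open>auto simp: form_vir_pow\<close>)
  also have "\<dots> = (\<Sum>i\<le>I. (1 / D) ^ i / fact i * (inversion_factor ws (map snd qs) *
     (\<Sum>j<J. (-1) powi m * ?x0 powi (int j - 2 * m) / fact j *
      correlator (\<beta> (vac V)) (ps @ [((vir V 1 ^^ i) a, Wp), ((vir V 1 ^^ j) c, Wm)]))))"
  proof (rule sum.cong)
    fix i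
    let ?a = "(vir V 1 ^^ i) a"
    have inverted: "correlator (\<beta> (vac V)) (map (\<lambda>(u, y). (u, inverse y)) qs @ [((vir V 1 ^^ j) c, inverse ?x0), (?a, 0)]) =
      correlator (\<beta> (vac V)) (ps @ [(?a, Wp), ((vir V 1 ^^ j) c, Wm)])" for j
    proof -
      let ?c = "(vir V 1 ^^ j) c"
      let ?l = "map (\<lambda>(u, y). (u, inverse y)) qs @ [(?c, inverse ?x0), (?a, 0)]"
      have l: "?l = map (\<lambda>(u, y). (u, y - Wp)) (ps @ [(?c, Wm), (?a, Wp)])"
        using D by (simp add: qs_def D_def case_prod_beta)
      have pos: "map snd ?l = map (\<lambda>y. y - Wp) (map snd ps @ [Wm, Wp])"
        unfolding l by (simp add: case_prod_beta)
      have "distinct (map snd ?l)"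
        unfolding pos by (subst distinct_map) (use dist in \<open>auto simp: inj_on_def\<close>)
      then have "correlator (\<beta> (vac V)) ?l = correlator (\<beta> (vac V)) (map (\<lambda>(u, y). (u, y + Wp)) ?l)"
        by (rule vacuum_correlator_translate[symmetric])
      also have "map (\<lambda>(u, y). (u, y + Wp)) ?l = (ps @ [(?c, Wm)]) @ (?a, Wp) # []"
        unfolding l by (simp add: case_prod_beta o_def)
      also have "correlator (\<beta> (vac V)) \<dots> = correlator (\<beta> (vac V)) ((?a, Wp) # (ps @ [(?c, Wm)]) @ [])"
        by (rule correlator_move_to_front[OF restricted_form_right]) (use dist in auto)
      also have "\<dots> = correlator (\<beta> (vac V)) (ps @ (?a, Wp) # [(?c, Wm)])"
        by (subst correlator_move_to_front[OF restricted_form_right]) (use dist in auto)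
      finally show ?thesis by simp
    qed
    have "correlator (\<lambda>w. \<beta> ((vir V (-1) ^^ i) w) a) (qs @ [(c, ?x0)]) = correlator (\<lambda>w. \<beta> w ?a) ((c, ?x0) # qs)"
      using correlator_move_to_front[OF restricted_form_left[of ?a], of qs c ?x0 "[]"] dqs xqs by (simp add: form_vir_pow)
    also have "\<dots> = inversion_factor ws (map snd qs) * (\<Sum>j<J. (-1) powi m * ?x0 powi (int j - 2 * m) / fact j *
      correlator (\<beta> (vac V)) (map (\<lambda>(u, y). (u, inverse y)) qs @ [((vir V 1 ^^ j) c, inverse ?x0), (?a, 0)]))"
    proof (rule correlator_inversion[OF _ _ c J])
      fix i assume "i < length qs"
      then show "quasiprimary V (ws ! i) (fst (qs ! i))" using qp by (simp add: qs_def case_prod_beta)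
    qed (use dqs xqs zqs D len in \<open>auto simp: qs_def\<close>)
    finally show "(1 / D) ^ i / fact i * correlator (\<lambda>w. \<beta> ((vir V (-1) ^^ i) w) a) (qs @ [(c, ?x0)]) =
      (1 / D) ^ i / fact i * (inversion_factor ws (map snd qs) *
       (\<Sum>j<J. (-1) powi m * ?x0 powi (int j - 2 * m) / fact j *
        correlator (\<beta> (vac V)) (ps @ [(?a, Wp), ((vir V 1 ^^ j) c, Wm)])))" by (simp only: inverted)
  qed simp
  finally show ?thesis
    by (simp add: snd_qs D_def sum_distrib_left mult_ac)
qed

section \<open>Normal ordering of raising and lowering operators\<close>

text \<open>The power is zero for negative exponents, which lets the sums below run over ranges that do not
depend on the other exponents.\<close>

definition divided_power :: "('v \<Rightarrow> 'v) \<Rightarrow> int \<Rightarrow> 'v \<Rightarrow> 'v" where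
  "divided_power P n v = (if n < 0 then 0 else smul V (1 / fact (nat n)) ((P ^^ nat n) v))"

abbreviation "raise \<equiv> divided_power (vir V (-1))"

abbreviation "lower \<equiv> divided_power (vir V 1)"

lemma divided_power_vir_linear:
  "divided_power (vir V k) n (v + w) = divided_power (vir V k) n v + divided_power (vir V k) n w"
  "divided_power (vir V k) n (smul V c v) = smul V c (divided_power (vir V k) n v)"
  "divided_power (vir V k) n 0 = 0"
  by (simp_all add: divided_power_def vir_pow_add vir_pow_scale scale_right_distrib mult.commute)

lemma raise_weight_space: "v \<in> weight_space V n \<Longrightarrow> raise p v \<in> weight_space V (n + p)"
  using vir_m1_pow_weight_space[of v n "nat p"] by (auto simp: divided_power_def weight_space_scale)

lemma lower_weight_space: "v \<in> weight_space V n \<Longrightarrow> lower p v \<in> weight_space V (n - p)"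
  using vir_1_pow_weight_space[of v n "nat p"] by (auto simp: divided_power_def weight_space_scale)

lemma lower_eq_zero: "v \<in> weight_space V n \<Longrightarrow> p > n \<Longrightarrow> lower p v = 0"
  using negative_weight[OF _ lower_weight_space[of v n p]] by simp

lemma form_raise: "\<beta> (raise p v) w = \<beta> v (lower p w)"
  and form_lower: "\<beta> (lower p v) w = \<beta> v (raise p w)"
  by (simp_all add: divided_power_def form_scale_left form_scale_right form_vir_pow)

lemma vir_1_vir_m1_pow:
  assumes "w \<in> weight_space V N"
  shows "vir V 1 ((vir V (-1) ^^ Suc p) w) = (vir V (-1) ^^ Suc p) (vir V 1 w) +
    smul V (of_nat (Suc p) * (2 * of_int N + of_nat p)) ((vir V (-1) ^^ p) w)"
proof (induction p)
  case 0
  then show ?case using assms by (simp add: virasoro_sl2 weight_space_def)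
next
  case (Suc p)
  have "vir V 0 ((vir V (-1) ^^ Suc p) w) = smul V (of_int (N + int (Suc p))) ((vir V (-1) ^^ Suc p) w)"
    using vir_m1_pow_weight_space[OF assms, of "Suc p"] by (simp only: weight_space_def mem_Collect_eq)
  then have "vir V 1 ((vir V (-1) ^^ Suc (Suc p)) w) = vir V (-1) (vir V 1 ((vir V (-1) ^^ Suc p) w)) +
    smul V (2 * of_int (N + int (Suc p))) ((vir V (-1) ^^ Suc p) w)"
    by (simp only: funpow.simps o_apply virasoro_sl2 scale_scale)
  also have "vir V (-1) (vir V 1 ((vir V (-1) ^^ Suc p) w)) = (vir V (-1) ^^ Suc (Suc p)) (vir V 1 w) +
    smul V (of_nat (Suc p) * (2 * of_int N + of_nat p)) ((vir V (-1) ^^ Suc p) w)"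
    unfolding Suc by (simp add: vir_add vir_scale)
  finally show ?case
    by (simp only: add.assoc scale_left_distrib[symmetric]) (simp add: algebra_simps)
qed

lemma vir_1_raise:
  assumes "w \<in> weight_space V N"
  shows "vir V 1 (raise p w) = raise p (vir V 1 w) + smul V (of_int (2 * N + p - 1)) (raise (p - 1) w)"
proof (cases "p \<le> 0")
  case True
  then show ?thesis by (auto simp: divided_power_def)
next
  case False
  define n where "n = nat p - 1"
  have p: "p = int (Suc n)" "nat p = Suc n" using False by (auto simp: n_def)
  have "vir V 1 (raise p w) = smul V (1 / fact (Suc n)) ((vir V (-1) ^^ Suc n) (vir V 1 w)) +
    smul V (1 / fact (Suc n) * (of_nat (Suc n) * (2 * of_int N + of_nat n))) ((vir V (-1) ^^ n) w)"
  proof -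
    have "raise p w = smul V (1 / fact (Suc n)) ((vir V (-1) ^^ Suc n) w)"
      using False by (simp add: divided_power_def p(2) del: fact_Suc funpow.simps)
    then show ?thesis
      by (simp only: vir_scale vir_1_vir_m1_pow[OF assms] scale_right_distrib scale_scale)
  qed
  also have "1 / fact (Suc n) * (of_nat (Suc n) * (2 * of_int N + of_nat n)) = of_int (2 * N + p - 1) * (1 / fact n :: complex)"
    by (simp add: p divide_simps del: of_nat_Suc) (simp add: algebra_simps)
  finally show ?thesis
    using False by (simp add: divided_power_def p(2)) (simp add: p)
qed

lemma vir_1_lower: "vir V 1 (lower q v) = smul V (of_int (q + 1)) (lower (q + 1) v)"
proof (cases "q < 0")
  case True
  then show ?thesis by (cases "q = -1") (auto simp: divided_power_def)
next
  case False
  then have "nat (q + 1) = Suc (nat q)" by simp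
  moreover have "(of_int (q + 1) :: complex) = of_nat (Suc (nat q))" using False by simp
  ultimately show ?thesis using False
    by (simp add: divided_power_def vir_scale del: of_nat_Suc)
qed

text \<open>The coefficient of \<open>q\<^sup>k\<close> in \<open>(1 - q)\<^sup>-\<^sup>x\<close>.\<close>

definition rising :: "complex \<Rightarrow> nat \<Rightarrow> complex" where
  "rising x k = pochhammer x k / fact k"

lemma rising_0 [simp]: "rising x 0 = 1"
  by (simp add: rising_def)

lemma rising_Suc: "of_nat (Suc k) * rising x (Suc k) = (x + of_nat k) * rising x k"
  by (simp add: rising_def pochhammer_Suc divide_simps del: of_nat_Suc)

lemma rising_shift: "of_nat (Suc k) * rising (x - 1) (Suc k) = (x - 1) * rising x k"
  by (simp add: rising_def pochhammer_rec[of "x - 1"] divide_simps del: of_nat_Suc)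

text \<open>Induction on \<open>i\<close>.  The two ways in which \<open>L(1)\<close> produces the \<open>k\<close>-th term combine by the identity
\<open>(i+1-k) h\<^sub>k(x) + (x-i+k-2) h\<^sub>k\<^sub>-\<^sub>1(x) = (i+1) h\<^sub>k(x-1)\<close> for \<open>h\<^sub>k(x) = rising x k\<close>.\<close>

lemma lower_raise:
  assumes v: "v \<in> weight_space V M"
  shows "lower (int i) (raise j v) =
    (\<Sum>k\<le>i. smul V (rising (of_int (2 * M + j - int i)) k) (raise (j - int k) (lower (int i - int k) v)))"
proof (induction i)
  case 0
  show ?case by (simp add: divided_power_def)
next
  case (Suc i)
  define x :: complex where "x = of_int (2 * M + j - int i)"
  have x1: "of_int (2 * M + j - int (Suc i)) = x - 1" by (simp add: x_def)
  let ?w = "\<lambda>k. raise (j - int k) (lower (int (Suc i) - int k) v)"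
  have "smul V (of_nat (Suc i)) (lower (int (Suc i)) (raise j v)) = vir V 1 (lower (int i) (raise j v))"
    by (simp add: vir_1_lower add.commute)
  also have "\<dots> = (\<Sum>k\<le>i. smul V (rising x k) (vir V 1 (raise (j - int k) (lower (int i - int k) v))))"
    unfolding Suc x_def by (induction "{..i}" rule: infinite_finite_induct) (simp_all add: vir_add vir_scale vir_def mode_sum_right mode_scale_right)
  also have "\<dots> = (\<Sum>k\<le>i. smul V (rising x k * of_nat (Suc i - k)) (?w k) +
     smul V (rising x k * (x - of_nat i + of_nat k - 1)) (?w (Suc k)))"
  proof (rule sum.cong)
    fix k assume "k \<in> {..i}"
    then have k: "k \<le> i" by simp
    have "vir V 1 (raise (j - int k) (lower (int i - int k) v)) =
      raise (j - int k) (smul V (of_int (int i - int k + 1)) (lower (int i - int k + 1) v)) +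
      smul V (of_int (2 * (M - (int i - int k)) + (j - int k) - 1)) (raise (j - int k - 1) (lower (int i - int k) v))"
      unfolding vir_1_raise[OF lower_weight_space[OF v]] vir_1_lower ..
    also have "int i - int k + 1 = int (Suc i) - int k" by simp
    also have "of_int (int (Suc i) - int k) = (of_nat (Suc i - k) :: complex)" using k by (simp add: of_nat_diff)
    also have "of_int (2 * (M - (int i - int k)) + (j - int k) - 1) = x - of_nat i + of_nat k - 1" by (simp add: x_def)
    also have "j - int k - 1 = j - int (Suc k)" by simp
    also have "int i - int k = int (Suc i) - int (Suc k)" by simp
    finally show "smul V (rising x k) (vir V 1 (raise (j - int k) (lower (int i - int k) v))) =
      smul V (rising x k * of_nat (Suc i - k)) (?w k) + smul V (rising x k * (x - of_nat i + of_nat k - 1)) (?w (Suc k))"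
      by (simp add: divided_power_vir_linear scale_right_distrib)
  qed simp
  also have "\<dots> = (\<Sum>k\<le>Suc i. smul V (of_nat (Suc i) * rising (x - 1) k) (?w k))"
  proof -
    let ?p = "\<lambda>k. rising x k * of_nat (Suc i - k)"
      and ?r = "\<lambda>k. case k of 0 \<Rightarrow> 0 | Suc l \<Rightarrow> rising x l * (x - of_nat i + of_nat l - 1)"
    have "(\<Sum>k\<le>i. smul V (?p k) (?w k)) = (\<Sum>k\<le>Suc i. smul V (?p k) (?w k))" by simp
    moreover have "(\<Sum>k\<le>i. smul V (rising x k * (x - of_nat i + of_nat k - 1)) (?w (Suc k))) =
      (\<Sum>k\<le>Suc i. smul V (?r k) (?w k))"
      by (subst sum.atMost_Suc_shift) simp
    moreover have "?p k + ?r k = of_nat (Suc i) * rising (x - 1) k" if "k \<le> Suc i" for k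
    proof (cases k)
      case (Suc l)
      then have l: "l \<le> i" using that by simp
      have "of_nat (Suc l) * (?p k + ?r k) = of_nat (Suc l) * (of_nat (Suc i) * rising (x - 1) k)"
      proof -
        have "of_nat (Suc l) * (?p k + ?r k) = (of_nat (Suc l) * rising x (Suc l)) * of_nat (i - l) +
          of_nat (Suc l) * (rising x l * (x - of_nat i + of_nat l - 1))"
          by (simp add: Suc algebra_simps)
        also have "\<dots> = rising x l * ((x + of_nat l) * (of_nat i - of_nat l) + of_nat (Suc l) * (x - of_nat i + of_nat l - 1))"
          unfolding rising_Suc using l by (simp add: of_nat_diff algebra_simps)
        also have "(x + of_nat l) * (of_nat i - of_nat l) + of_nat (Suc l) * (x - of_nat i + of_nat l - 1) = of_nat (Suc i) * (x - 1)"
          by (simp add: algebra_simps)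
        also have "rising x l * (of_nat (Suc i) * (x - 1)) = of_nat (Suc i) * (of_nat (Suc l) * rising (x - 1) (Suc l))"
          unfolding rising_shift by (simp add: mult_ac)
        finally show ?thesis by (simp add: Suc mult_ac del: of_nat_Suc)
      qed
      then show ?thesis by (simp del: of_nat_Suc)
    qed simp
    ultimately show ?thesis
      by (simp only: sum.distrib) (simp add: sum.distrib[symmetric] scale_left_distrib[symmetric] del: sum.atMost_Suc of_nat_Suc)
  qed
  finally have "smul V (of_nat (Suc i)) (lower (int (Suc i)) (raise j v)) =
    smul V (of_nat (Suc i)) (\<Sum>k\<le>Suc i. smul V (rising (x - 1) k) (?w k))"
    by (simp add: scale_sum_right del: of_nat_Suc sum.atMost_Suc)
  then have "lower (int (Suc i)) (raise j v) = (\<Sum>k\<le>Suc i. smul V (rising (x - 1) k) (?w k))"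
    by (simp only: scale_cancel_left of_nat_eq_0_iff nat.distinct False_implies_equals simp_thms)
  then show ?case unfolding x1 .
qed

lemma vir_m1_raise: "vir V (-1) (raise (int i) v) = smul V (of_nat (Suc i)) (raise (int (Suc i)) v)"
  by (simp add: divided_power_def vir_scale nat_add_distrib del: of_nat_Suc of_nat_add)

section \<open>Correlation functions with two moving points\<close>

text \<open>With the vacuum on the right, the only poles are at coinciding points; so the value is determined even
if one of the points is \<open>0\<close>.\<close>

lemma genus0_eq_correlator:
  assumes "length xs = length us" and "distinct xs"
  shows "genus0 V \<beta> us xs = correlator (\<beta> (vac V)) (zip us xs)"
  unfolding genus0_def
proof (rule rational_extension_eq[OF correlator_zip_rational[OF restricted_form_right refl]])
  fix ys assume ys: "ys \<in> radially_ordered (length us)"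
  then have l: "length ys = length us" by (rule radially_ordered_length)
  have "map snd (zip us ys) \<in> radially_ordered (length (zip us ys))" using ys l by simp
  from correlator_has_sum[OF restricted_form_right this, of "vac V" "vac V"]
  show "((\<lambda>ks. \<beta> (vac V) (insertions V us ys ks (vac V))) has_sum correlator (\<beta> (vac V)) (zip us ys)) {ks. length ks = length us}"
    using l by (simp add: correlator_vac_last[OF restricted_form_right])
qed (use assms in \<open>auto simp: radially_ordered_distinct radially_ordered_length\<close>)

text \<open>The two sewing points move in opposite directions from \<open>Wp\<close> and \<open>Wm\<close>; at \<open>p = q / (1 - q)\<close> they are
\<open>w_pos Wp Wm q\<close> and \<open>w_neg Wp Wm q\<close>.\<close>

definition two_point :: "('v \<times> complex) list \<Rightarrow> complex \<Rightarrow> complex \<Rightarrow> 'v \<Rightarrow> 'v \<Rightarrow> complex \<Rightarrow> complex" where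
  "two_point ps Wp Wm a c p = correlator (\<beta> (vac V)) (ps @ [(a, Wp + (Wp - Wm) * p), (c, Wm - (Wp - Wm) * p)])"

lemma two_point_lin:
  "two_point ps Wp Wm (smul V r a + a') c p = r * two_point ps Wp Wm a c p + two_point ps Wp Wm a' c p"
  "two_point ps Wp Wm a (smul V r c + c') p = r * two_point ps Wp Wm a c p + two_point ps Wp Wm a c' p"
proof -
  let ?x = "Wp + (Wp - Wm) * p" and ?y = "Wm - (Wp - Wm) * p"
  have 0: "map_slot (length ps) A (ps @ [(u, ?x), (c, ?y)]) = ps @ [(A u, ?x), (c, ?y)]"
    and 1: "map_slot (Suc (length ps)) A (ps @ [(a, ?x), (u, ?y)]) = ps @ [(a, ?x), (A u, ?y)]" for A u
    using map_slot_append_right[of ps 0 A "[(u, ?x), (c, ?y)]"] map_slot_append_right[of ps 1 A "[(a, ?x), (u, ?y)]"]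
    by (simp_all add: map_slot_def)
  show "two_point ps Wp Wm (smul V r a + a') c p = r * two_point ps Wp Wm a c p + two_point ps Wp Wm a' c p"
    using correlator_lin_slot[OF restricted_form_right, of "length ps" "ps @ [(a, ?x), (c, ?y)]" "vac V" r "\<lambda>_. a" "\<lambda>_. a'"]
    unfolding two_point_def 0 by simp
  show "two_point ps Wp Wm a (smul V r c + c') p = r * two_point ps Wp Wm a c p + two_point ps Wp Wm a c' p"
    using correlator_lin_slot[OF restricted_form_right, of "Suc (length ps)" "ps @ [(a, ?x), (c, ?y)]" "vac V" r "\<lambda>_. c" "\<lambda>_. c'"]
    unfolding two_point_def 1 by simp
qed

lemma two_point_scale:
  "two_point ps Wp Wm (smul V r a) c p = r * two_point ps Wp Wm a c p"
  "two_point ps Wp Wm a (smul V r c) p = r * two_point ps Wp Wm a c p"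
  using two_point_lin(1)[of ps Wp Wm r a 0 c p] two_point_lin(2)[of ps Wp Wm a r c 0 p]
    two_point_lin(1)[of ps Wp Wm 1 0 0 c p] two_point_lin(2)[of ps Wp Wm a 1 0 0 p] by simp_all

lemma two_point_has_derivative:
  assumes dist: "distinct (map snd ps @ [Wp + (Wp - Wm) * p, Wm - (Wp - Wm) * p])"
  shows "(two_point ps Wp Wm a c has_field_derivative
    (Wp - Wm) * (two_point ps Wp Wm (vir V (-1) a) c p - two_point ps Wp Wm a (vir V (-1) c) p)) (at p)"
proof -
  let ?n = "length ps" and ?D = "Wp - Wm"
  define us where "us = map (\<lambda>(u, z). (u, \<lambda>_ :: complex. z)) ps @ [(a, \<lambda>p. Wp + ?D * p), (c, \<lambda>p. Wm - ?D * p)]"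
  define h' where "h' l = (if l < ?n then 0 else if l = ?n then ?D else - ?D)" for l
  have ev: "map (\<lambda>(u, h). (u, h p)) us = ps @ [(a, Wp + ?D * p), (c, Wm - ?D * p)]" for p
    by (simp add: us_def case_prod_beta o_def)
  have lus: "length us = Suc (Suc ?n)" by (simp add: us_def)
  have us_nth: "snd (us ! l) = (if l < ?n then \<lambda>_. snd (ps ! l) else if l = ?n then \<lambda>p. Wp + ?D * p else (\<lambda>p. Wm - ?D * p))"
    if "l < Suc (Suc ?n)" for l
    using that by (auto simp: us_def nth_append nth_Cons case_prod_beta split: nat.splits)
  have "((\<lambda>p. correlator (\<beta> (vac V)) (map (\<lambda>(u, h). (u, h p)) us)) has_field_derivative
    (\<Sum>l<length us. h' l * correlator (\<beta> (vac V)) (map_slot l (vir V (-1)) (map (\<lambda>(u, h). (u, h p)) us)))) (at p)"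
  proof (rule correlator_has_derivative[OF restricted_form_right])
    fix l assume "l < length us"
    then show "(snd (us ! l) has_field_derivative h' l) (at p)"
      using us_nth[of l] lus by (auto simp: h'_def intro!: derivative_eq_intros)
  next
    fix i j assume ij: "i < j" "j < length us"
    have "(map snd ps @ [Wp + ?D * p, Wm - ?D * p]) ! l = snd (us ! l) p" if "l < Suc (Suc ?n)" for l
      using us_nth[OF that] that by (auto simp: nth_append nth_Cons split: nat.splits)
    then show "snd (us ! i) p \<noteq> snd (us ! j) p"
      using nth_eq_iff_index_eq[OF dist, of i j] ij lus by simp
  qed
  also have "(\<Sum>l<length us. h' l * correlator (\<beta> (vac V)) (map_slot l (vir V (-1)) (map (\<lambda>(u, h). (u, h p)) us))) =
    ?D * (two_point ps Wp Wm (vir V (-1) a) c p - two_point ps Wp Wm a (vir V (-1) c) p)"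
    using map_slot_append_right[of ps 0 "vir V (-1)" "[(a, Wp + ?D * p), (c, Wm - ?D * p)]"]
      map_slot_append_right[of ps 1 "vir V (-1)" "[(a, Wp + ?D * p), (c, Wm - ?D * p)]"]
    unfolding ev lus by (simp add: h'_def two_point_def map_slot_def right_diff_distrib del: minus_diff_eq)
  finally show ?thesis unfolding ev two_point_def[abs_def] .
qed

lemma open_two_point_domain: "open {p. distinct (zs @ [Wp + D * p, Wm - D * p :: complex])}"
proof -
  have "{p. distinct (zs @ [Wp + D * p, Wm - D * p])} =
    (if distinct zs then (\<Inter>z\<in>set zs. {p. Wp + D * p \<noteq> z} \<inter> {p. Wm - D * p \<noteq> z}) \<inter> {p. Wp + D * p \<noteq> Wm - D * p} else {})"
    by auto
  also have "open \<dots>"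
    by (auto intro!: open_INT open_Int open_Collect_neq continuous_intros)
  finally show ?thesis .
qed

text \<open>The binomial theorem for the commuting operators \<open>L(-1) \<otimes> 1\<close> and \<open>-1 \<otimes> L(-1)\<close>; divided powers absorb
the binomial coefficients.\<close>

lemma two_point_higher_deriv:
  assumes "distinct (map snd ps @ [Wp + (Wp - Wm) * p, Wm - (Wp - Wm) * p])"
  shows "(deriv ^^ n) (two_point ps Wp Wm a c) p =
    (Wp - Wm) ^ n * fact n * (\<Sum>i\<le>n. (-1) ^ (n - i) * two_point ps Wp Wm (raise (int i) a) (raise (int (n - i)) c) p)"
  using assms
proof (induction n arbitrary: p)
  case 0
  then show ?case by (simp add: divided_power_def)
next
  case (Suc n)
  let ?D = "Wp - Wm" and ?U = "{p. distinct (map snd ps @ [Wp + (Wp - Wm) * p, Wm - (Wp - Wm) * p])}"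
  let ?H = "two_point ps Wp Wm"
  define S where "S p = ?D ^ n * fact n * (\<Sum>i\<le>n. (-1) ^ (n - i) * ?H (raise (int i) a) (raise (int (n - i)) c) p)" for p
  have "eventually (\<lambda>p. p \<in> ?U) (nhds p)"
    using Suc.prems by (intro eventually_nhds_in_open open_two_point_domain) simp
  then have "eventually (\<lambda>p. (deriv ^^ n) (?H a c) p = S p) (nhds p)"
    by eventually_elim (simp add: Suc.IH S_def)
  then have "(deriv ^^ Suc n) (?H a c) p = deriv S p"
    by (simp add: deriv_cong_ev)
  also have "deriv S p = ?D ^ n * fact n * (\<Sum>i\<le>n. (-1) ^ (n - i) *
      (?D * (?H (vir V (-1) (raise (int i) a)) (raise (int (n - i)) c) p - ?H (raise (int i) a) (vir V (-1) (raise (int (n - i)) c)) p)))"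
    unfolding S_def[abs_def]
    by (intro DERIV_imp_deriv DERIV_cmult DERIV_sum two_point_has_derivative Suc.prems)
  also have "\<dots> = ?D ^ Suc n * fact n * ((\<Sum>i\<le>n. (-1) ^ (n - i) * of_nat (Suc i) * ?H (raise (int (Suc i)) a) (raise (int (n - i)) c) p) +
      (\<Sum>i\<le>n. (-1) ^ (Suc n - i) * of_nat (Suc n - i) * ?H (raise (int i) a) (raise (int (Suc n - i)) c) p))"
    unfolding sum.distrib[symmetric] sum_distrib_left
  proof (rule sum.cong)
    fix i assume "i \<in> {..n}"
    then have "Suc n - i = Suc (n - i)" by auto
    then show "?D ^ n * fact n * ((-1) ^ (n - i) *
      (?D * (?H (vir V (-1) (raise (int i) a)) (raise (int (n - i)) c) p - ?H (raise (int i) a) (vir V (-1) (raise (int (n - i)) c)) p))) =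
      ?D ^ Suc n * fact n * ((-1) ^ (n - i) * of_nat (Suc i) * ?H (raise (int (Suc i)) a) (raise (int (n - i)) c) p +
      (-1) ^ (Suc n - i) * of_nat (Suc n - i) * ?H (raise (int i) a) (raise (int (Suc n - i)) c) p)"
      unfolding vir_m1_raise two_point_scale by (simp add: algebra_simps del: of_nat_Suc)
  qed simp
  also have "(\<Sum>i\<le>n. (-1) ^ (n - i) * of_nat (Suc i) * ?H (raise (int (Suc i)) a) (raise (int (n - i)) c) p) =
    (\<Sum>i\<le>Suc n. (-1) ^ (Suc n - i) * of_nat i * ?H (raise (int i) a) (raise (int (Suc n - i)) c) p)"
    by (subst sum.atMost_Suc_shift) simp
  also have "(\<Sum>i\<le>n. (-1) ^ (Suc n - i) * of_nat (Suc n - i) * ?H (raise (int i) a) (raise (int (Suc n - i)) c) p) =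
    (\<Sum>i\<le>Suc n. (-1) ^ (Suc n - i) * of_nat (Suc n - i) * ?H (raise (int i) a) (raise (int (Suc n - i)) c) p)"
    by simp
  also have "(\<Sum>i\<le>Suc n. (-1) ^ (Suc n - i) * of_nat i * ?H (raise (int i) a) (raise (int (Suc n - i)) c) p) + \<dots> =
    of_nat (Suc n) * (\<Sum>i\<le>Suc n. (-1) ^ (Suc n - i) * ?H (raise (int i) a) (raise (int (Suc n - i)) c) p)"
    unfolding sum.distrib[symmetric] sum_distrib_left
  proof (rule sum.cong)
    fix i assume "i \<in> {..Suc n}"
    then have e: "(of_nat (Suc n - i) :: complex) = of_nat (Suc n) - of_nat i" by (simp add: of_nat_diff)
    have alg: "X * k * h + X * (l - k) * h = l * (X * h)" for X k l h :: complex
      by (simp add: algebra_simps)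
    show "(-1) ^ (Suc n - i) * of_nat i * ?H (raise (int i) a) (raise (int (Suc n - i)) c) p +
      (-1) ^ (Suc n - i) * of_nat (Suc n - i) * ?H (raise (int i) a) (raise (int (Suc n - i)) c) p =
      of_nat (Suc n) * ((-1) ^ (Suc n - i) * ?H (raise (int i) a) (raise (int (Suc n - i)) c) p)"
      unfolding e by (rule alg)
  qed simp
  finally show ?case by (simp add: fact_Suc mult_ac del: of_nat_Suc sum.atMost_Suc)
qed

lemma two_point_fps_expansion:
  assumes "distinct (map snd ps @ [Wp, Wm])"
  obtains A where "two_point ps Wp Wm a c has_fps_expansion A"
    and "\<And>n. fps_nth A n = (Wp - Wm) ^ n *
      (\<Sum>i\<le>n. (-1) ^ (n - i) * two_point ps Wp Wm (raise (int i) a) (raise (int (n - i)) c) 0)"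
proof
  let ?U = "{p. distinct (map snd ps @ [Wp + (Wp - Wm) * p, Wm - (Wp - Wm) * p])}"
  have "two_point ps Wp Wm a c holomorphic_on ?U"
    unfolding holomorphic_on_open[OF open_two_point_domain]
  proof
    fix p assume "p \<in> ?U"
    then have "distinct (map snd ps @ [Wp + (Wp - Wm) * p, Wm - (Wp - Wm) * p])" by (rule CollectD)
    from two_point_has_derivative[OF this]
    show "\<exists>f'. (two_point ps Wp Wm a c has_field_derivative f') (at p)" by blast
  qed
  moreover have "0 \<in> ?U" using assms by simp
  ultimately have "two_point ps Wp Wm a c analytic_on {0}"
    unfolding analytic_at by (intro exI[of _ ?U] conjI open_two_point_domain)
  then show "two_point ps Wp Wm a c has_fps_expansion fps_expansion (two_point ps Wp Wm a c) 0"
    by (rule analytic_at_imp_has_fps_expansion_0)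
  show "fps_nth (fps_expansion (two_point ps Wp Wm a c) 0) n = (Wp - Wm) ^ n *
      (\<Sum>i\<le>n. (-1) ^ (n - i) * two_point ps Wp Wm (raise (int i) a) (raise (int (n - i)) c) 0)" for n
    using two_point_higher_deriv[of ps Wp Wm 0 n a c] assms by (simp add: fps_expansion_def)
qed

end

section \<open>Dual bases, traces and the sewing identity\<close>

locale voa_dual_bases = voa_with_form V \<beta> for V :: "'v::ab_group_add vertex_data" and \<beta> +
  fixes B :: "'v set" and d :: "'v \<Rightarrow> 'v"
  assumes basis: "homogeneous_basis V B" and dual: "dual_basis \<beta> B d"
begin

lemma basis_independent: "independent B"
  and basis_span: "span B = UNIV"
  and basis_homogeneous: "b \<in> B \<Longrightarrow> \<exists>n. b \<in> weight_space V n"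
  using basis unfolding homogeneous_basis_def by blast+

lemma dual_pairing: "b \<in> B \<Longrightarrow> c \<in> B \<Longrightarrow> \<beta> (d b) c = (if b = c then 1 else 0)"
  using dual unfolding dual_basis_def by blast

abbreviation basis_of_weight :: "int \<Rightarrow> 'v set" where
  "basis_of_weight n \<equiv> B \<inter> weight_space V n"

lemma finite_independent_weight_space:
  assumes "independent A"
  shows "finite (A \<inter> weight_space V n)"
proof -
  have "\<forall>n. \<exists>S. finite S \<and> span S = weight_space V n"
    using voa unfolding voa_def by (elim conjE)
  then obtain S where S: "finite S" "span S = weight_space V n" by blast
  have "independent (A \<inter> weight_space V n)"
    by (rule independent_mono[OF assms]) auto
  then show ?thesis
    using independent_span_bound[OF S(1), of "A \<inter> weight_space V n"] S(2) by auto
qed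

lemma finite_basis_of_weight [simp]: "finite (basis_of_weight n)"
  by (rule finite_independent_weight_space[OF basis_independent])

lemma zero_if_form_zero_on_basis:
  assumes "\<And>c. c \<in> B \<Longrightarrow> \<beta> v c = 0"
  shows "v = 0"
proof -
  have "\<beta> v w = 0" for w
  proof -
    have "w \<in> span B" using basis_span by simp
    moreover have "subspace {w. \<beta> v w = 0}"
      by (simp add: subspace_def form_add_right form_scale_right)
    ultimately show ?thesis by (rule span_induct) (use assms in auto)
  qed
  then show ?thesis using nondegenerate unfolding nondegenerate_form_def by blast
qed

lemma zero_if_coordinates_zero:
  assumes "\<And>c. c \<in> B \<Longrightarrow> \<beta> (d c) v = 0"
  shows "v = 0"
proof -
  let ?r = "representation B v"
  have v: "(\<Sum>b | ?r b \<noteq> 0. smul V (?r b) b) = v"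
    by (rule sum_nonzero_representation_eq[OF basis_independent]) (simp add: basis_span)
  have "?r c = 0" for c
  proof (rule ccontr)
    assume c: "?r c \<noteq> 0"
    then have "c \<in> B" by (rule representation_ne_zero)
    have "\<beta> (d c) v = (\<Sum>b | ?r b \<noteq> 0. ?r b * \<beta> (d c) b)"
      by (subst v[symmetric]) (simp add: form_sum_right form_scale_right)
    also have "\<dots> = (\<Sum>b | ?r b \<noteq> 0. if b = c then ?r c else 0)"
      by (rule sum.cong) (use dual_pairing[OF \<open>c \<in> B\<close>] representation_ne_zero in auto)
    also have "\<dots> = ?r c" using c finite_representation[of B v] by simp
    finally show False using assms[OF \<open>c \<in> B\<close>] c by simp
  qed
  then show ?thesis using v by simp
qed

text \<open>Since \<open>L(0)\<close> is self-adjoint, \<open>(L(0) - n) d b\<close> pairs to zero with every basis vector.\<close>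

lemma dual_weight_space:
  assumes "b \<in> basis_of_weight n"
  shows "d b \<in> weight_space V n"
proof -
  have "\<beta> (vir V 0 (d b) - smul V (of_int n) (d b)) c = 0" if c: "c \<in> B" for c
  proof -
    obtain k where k: "c \<in> weight_space V k" using basis_homogeneous[OF c] by blast
    have "\<beta> (vir V 0 (d b) - smul V (of_int n) (d b)) c = \<beta> (d b) (vir V 0 c) - of_int n * \<beta> (d b) c"
      using restricted_diff[OF restricted_form_left, of "vir V 0 (d b)" "smul V (of_int n) (d b)" c]
      by (simp add: form_vir form_scale_left)
    also have "\<dots> = 0"
    proof (cases "b = c")
      case True
      then show ?thesis using assms by (simp add: weight_space_def form_scale_right)
    next
      case False
      then show ?thesis
        using k dual_pairing[of b c] assms c by (simp add: weight_space_def form_scale_right)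
    qed
    finally show ?thesis .
  qed
  then have "vir V 0 (d b) - smul V (of_int n) (d b) = 0" by (rule zero_if_form_zero_on_basis)
  then show ?thesis by (simp add: weight_space_def)
qed

lemma form_weight_mismatch:
  assumes "c \<in> B" and "c \<notin> weight_space V n" and "x \<in> weight_space V n"
  shows "\<beta> (d c) x = 0" and "\<beta> x c = 0"
proof -
  obtain k where k: "c \<in> weight_space V k" using basis_homogeneous[OF assms(1)] by blast
  then have "k \<noteq> n" using assms(2) by auto
  then show "\<beta> (d c) x = 0" "\<beta> x c = 0"
    using form_orthogonal[OF dual_weight_space assms(3), of c k] form_orthogonal[OF assms(3) k] k assms(1) by auto
qed

lemma basis_expansion:
  assumes x: "x \<in> weight_space V n"
  shows "x = (\<Sum>b\<in>basis_of_weight n. smul V (\<beta> (d b) x) b)"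
proof -
  have "\<beta> (d c) (x - (\<Sum>b\<in>basis_of_weight n. smul V (\<beta> (d b) x) b)) = 0" if c: "c \<in> B" for c
  proof -
    have "\<beta> (d c) (x - (\<Sum>b\<in>basis_of_weight n. smul V (\<beta> (d b) x) b)) =
      \<beta> (d c) x - (\<Sum>b\<in>basis_of_weight n. \<beta> (d b) x * \<beta> (d c) b)"
      using restricted_diff[OF restricted_form_right] by (simp add: form_sum_right form_scale_right)
    also have "(\<Sum>b\<in>basis_of_weight n. \<beta> (d b) x * \<beta> (d c) b) = (\<Sum>b\<in>basis_of_weight n. if b = c then \<beta> (d c) x else 0)"
      by (rule sum.cong) (use dual_pairing[OF c] in auto)
    also have "\<dots> = \<beta> (d c) x"
      using form_weight_mismatch[OF c _ x] c by simp
    finally show ?thesis by simp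
  qed
  then have "x - (\<Sum>b\<in>basis_of_weight n. smul V (\<beta> (d b) x) b) = 0" by (rule zero_if_coordinates_zero)
  then show ?thesis by simp
qed

lemma dual_expansion:
  assumes x: "x \<in> weight_space V n"
  shows "x = (\<Sum>b\<in>basis_of_weight n. smul V (\<beta> x b) (d b))"
proof -
  have "\<beta> (x - (\<Sum>b\<in>basis_of_weight n. smul V (\<beta> x b) (d b))) c = 0" if c: "c \<in> B" for c
  proof -
    have "\<beta> (x - (\<Sum>b\<in>basis_of_weight n. smul V (\<beta> x b) (d b))) c =
      \<beta> x c - (\<Sum>b\<in>basis_of_weight n. \<beta> x b * \<beta> (d b) c)"
      using restricted_diff[OF restricted_form_left] by (simp add: form_sum_left form_scale_left)
    also have "(\<Sum>b\<in>basis_of_weight n. \<beta> x b * \<beta> (d b) c) = (\<Sum>b\<in>basis_of_weight n. if b = c then \<beta> x c else 0)"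
      by (rule sum.cong) (use dual_pairing[OF _ c] in auto)
    also have "\<dots> = \<beta> x c"
      using form_weight_mismatch[OF c _ x] c by simp
    finally show ?thesis by simp
  qed
  then have "x - (\<Sum>b\<in>basis_of_weight n. smul V (\<beta> x b) (d b)) = 0" by (rule zero_if_form_zero_on_basis)
  then show ?thesis by simp
qed

definition bilinear_functional :: "('v \<Rightarrow> 'v \<Rightarrow> complex) \<Rightarrow> bool" where
  "bilinear_functional F \<longleftrightarrow> (\<forall>c x x' y. F (smul V c x + x') y = c * F x y + F x' y) \<and>
     (\<forall>c x y y'. F x (smul V c y + y') = c * F x y + F x y')"

lemma bilinear_functional_lin:
  assumes "bilinear_functional F"
  shows "F (smul V c x + x') y = c * F x y + F x' y" and "F x (smul V c y + y') = c * F x y + F x y'"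
  using assms unfolding bilinear_functional_def by blast+

lemma bilinear_functional_zero:
  assumes F: "bilinear_functional F"
  shows "F 0 y = 0" and "F x 0 = 0"
  using bilinear_functional_lin(1)[OF F, of 1 0 0 y] bilinear_functional_lin(2)[OF F, of x 1 0 0] by simp_all

lemma bilinear_functional_sum:
  assumes F: "bilinear_functional F"
  shows "F (\<Sum>a\<in>A. smul V (r a) (g a)) y = (\<Sum>a\<in>A. r a * F (g a) y)"
    and "F x (\<Sum>a\<in>A. smul V (r a) (g a)) = (\<Sum>a\<in>A. r a * F x (g a))"
  by (induction A rule: infinite_finite_induct)
    (simp_all add: bilinear_functional_zero[OF F] bilinear_functional_lin[OF F])

text \<open>Expanding \<open>P b\<close> in the basis and \<open>P' (d c)\<close> in the dual basis gives the same double sum: the Casimir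
element \<open>\<Sum>\<^sub>b b \<otimes> d b\<close> intertwines \<open>P \<otimes> 1\<close> and \<open>1 \<otimes> P'\<close>.\<close>

lemma casimir_transfer:
  assumes F: "bilinear_functional F"
    and P: "\<And>x. x \<in> weight_space V m \<Longrightarrow> P x \<in> weight_space V n"
    and P': "\<And>x. x \<in> weight_space V n \<Longrightarrow> P' x \<in> weight_space V m"
    and adj: "\<And>x y. \<beta> (P' x) y = \<beta> x (P y)"
  shows "(\<Sum>b\<in>basis_of_weight m. F (P b) (d b)) = (\<Sum>c\<in>basis_of_weight n. F c (P' (d c)))"
proof -
  have "(\<Sum>b\<in>basis_of_weight m. F (P b) (d b)) =
    (\<Sum>b\<in>basis_of_weight m. \<Sum>c\<in>basis_of_weight n. \<beta> (d c) (P b) * F c (d b))"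
  proof (rule sum.cong)
    fix b assume "b \<in> basis_of_weight m"
    then have "P b = (\<Sum>c\<in>basis_of_weight n. smul V (\<beta> (d c) (P b)) c)"
      using P by (intro basis_expansion) auto
    then have "F (P b) (d b) = F (\<Sum>c\<in>basis_of_weight n. smul V (\<beta> (d c) (P b)) c) (d b)" by simp
    then show "F (P b) (d b) = (\<Sum>c\<in>basis_of_weight n. \<beta> (d c) (P b) * F c (d b))"
      unfolding bilinear_functional_sum(1)[OF F] .
  qed simp
  also have "\<dots> = (\<Sum>c\<in>basis_of_weight n. \<Sum>b\<in>basis_of_weight m. \<beta> (P' (d c)) b * F c (d b))"
    unfolding adj by (rule sum.swap)
  also have "\<dots> = (\<Sum>c\<in>basis_of_weight n. F c (P' (d c)))"
  proof (rule sum.cong)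
    fix c assume "c \<in> basis_of_weight n"
    then have "P' (d c) = (\<Sum>b\<in>basis_of_weight m. smul V (\<beta> (P' (d c)) b) (d b))"
      by (intro dual_expansion P' dual_weight_space)
    then have "F c (P' (d c)) = F c (\<Sum>b\<in>basis_of_weight m. smul V (\<beta> (P' (d c)) b) (d b))" by simp
    then show "(\<Sum>b\<in>basis_of_weight m. \<beta> (P' (d c)) b * F c (d b)) = F c (P' (d c))"
      unfolding bilinear_functional_sum(2)[OF F] by simp
  qed simp
  finally show ?thesis .
qed

text \<open>The trace does not depend on the homogeneous basis.  Here it is computed in the basis \<open>d b\<close>, whose
coordinate functionals are \<open>w \<mapsto> \<beta> w b\<close>.\<close>

lemma weight_trace_eq:
  assumes T: "\<And>x y. T (x + y) = T x + T y" "\<And>c x. T (smul V c x) = smul V c (T x)"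
  shows "weight_trace V m T = (\<Sum>b\<in>basis_of_weight (int m). \<beta> (T (d b)) b)"
proof -
  define A where "A = (SOME B. homogeneous_basis V B)"
  have A: "homogeneous_basis V A" unfolding A_def by (rule someI[of _ B]) (rule basis)
  then have ind: "independent A" and sp: "span A = UNIV" and hom: "\<And>e. e \<in> A \<Longrightarrow> \<exists>n. e \<in> weight_space V n"
    unfolding homogeneous_basis_def by blast+
  let ?W = "weight_space V (int m)"
  let ?r = "representation A"
  have [simp]: "finite (A \<inter> ?W)" by (rule finite_independent_weight_space[OF ind])
  have T0: "T 0 = 0" using T(2)[of 0 0] by simp
  have Tsum: "T (\<Sum>a\<in>S. smul V (k a) (g a)) = (\<Sum>a\<in>S. smul V (k a) (T (g a)))" for S :: "'v set" and k g
    by (induction S rule: infinite_finite_induct) (simp_all add: T T0)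
  have rsum: "?r (\<Sum>a\<in>S. smul V (k a) (g a)) e = (\<Sum>a\<in>S. k a * ?r (g a) e)" for S :: "'v set" and k g e
    by (simp add: representation_sum[OF ind] representation_scale[OF ind] sp)
  have pair: "(\<Sum>e\<in>A \<inter> ?W. \<beta> e b * ?r y e) = \<beta> y b" if b: "b \<in> basis_of_weight (int m)" for y b
  proof -
    let ?S = "{e. ?r y e \<noteq> 0}"
    have S: "finite ?S" by (rule finite_representation)
    have y: "(\<Sum>e\<in>?S. smul V (?r y e) e) = y"
      by (rule sum_nonzero_representation_eq[OF ind]) (simp add: sp)
    have "\<beta> y b = (\<Sum>e\<in>?S. ?r y e * \<beta> e b)"
      by (subst y[symmetric]) (simp add: form_sum_left form_scale_left)
    also have "\<dots> = (\<Sum>e\<in>?S \<union> (A \<inter> ?W). ?r y e * \<beta> e b)"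
      by (rule sum.mono_neutral_left) (use S in auto)
    also have "\<dots> = (\<Sum>e\<in>A \<inter> ?W. ?r y e * \<beta> e b)"
    proof (rule sum.mono_neutral_right)
      show "\<forall>e\<in>(?S \<union> (A \<inter> ?W)) - (A \<inter> ?W). ?r y e * \<beta> e b = 0"
      proof
        fix e assume e: "e \<in> (?S \<union> (A \<inter> ?W)) - (A \<inter> ?W)"
        then have "e \<in> A" using representation_ne_zero[of A y e] by auto
        then obtain k where k: "e \<in> weight_space V k" using hom by blast
        then have "k \<noteq> int m" using e \<open>e \<in> A\<close> by auto
        then show "?r y e * \<beta> e b = 0" using form_orthogonal[OF k, of b "int m"] b by simp
      qed
    qed (use S in auto)
    finally show ?thesis by (simp add: mult.commute)
  qed
  have "weight_trace V m T = (\<Sum>e\<in>A \<inter> ?W. ?r (T e) e)"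
    by (simp add: weight_trace_def A_def[symmetric])
  also have "\<dots> = (\<Sum>e\<in>A \<inter> ?W. \<Sum>b\<in>basis_of_weight (int m). \<beta> e b * ?r (T (d b)) e)"
  proof (rule sum.cong)
    fix e assume "e \<in> A \<inter> ?W"
    then have "T e = T (\<Sum>b\<in>basis_of_weight (int m). smul V (\<beta> e b) (d b))"
      using dual_expansion[of e "int m"] by auto
    then show "?r (T e) e = (\<Sum>b\<in>basis_of_weight (int m). \<beta> e b * ?r (T (d b)) e)"
      by (simp only: Tsum rsum)
  qed simp
  also have "\<dots> = (\<Sum>b\<in>basis_of_weight (int m). \<Sum>e\<in>A \<inter> ?W. \<beta> e b * ?r (T (d b)) e)"
    by (rule sum.swap)
  also have "\<dots> = (\<Sum>b\<in>basis_of_weight (int m). \<beta> (T (d b)) b)"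
    by (rule sum.cong) (auto intro: pair)
  finally show ?thesis .
qed

text \<open>The left-hand side is the coefficient of \<open>q\<^sup>N\<close> in the trace after the change of coordinates, the right-hand side
that of the sewn genus zero functions.  Both are combinations of the numbers
\<open>G M i j = \<Sum>\<^sub>b F (L(-1)\<^sup>i/i! L(1)\<^sup>j/j! b) (d b)\<close>, the sum being over the basis of weight \<open>M\<close>: the
right-hand side directly, by transferring the second raising operator, and the left-hand side after normal ordering.\<close>

lemma sewing_identity:
  fixes D :: complex and N :: nat
  assumes F: "bilinear_functional F" and D: "D \<noteq> 0"
  shows "(- (D\<^sup>2)) ^ N * (\<Sum>i\<le>N. \<Sum>j\<le>N. (1 / D) ^ i * (- 1 / D) ^ j *
      (\<Sum>b\<in>basis_of_weight (int N). F (lower (int i) b) (lower (int j) (d b)))) =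
    (\<Sum>(m, i, j)\<in>{(m, i, j). m + i + j \<le> N}. (- (D\<^sup>2)) ^ m * D ^ i * (- D) ^ j *
      rising (of_nat (2 * m + i + j)) (N - m - i - j) *
      (\<Sum>b\<in>basis_of_weight (int m). F (raise (int i) b) (raise (int j) (d b))))"
proof -
  define G where "G M i j = (\<Sum>b\<in>basis_of_weight M. F (raise i (lower j b)) (d b))" for M i j :: int
  have G0: "G M i j = 0" if "i < 0 \<or> j < 0 \<or> j > M" for M i j
  proof -
    have "raise i (lower j b) = 0" if "b \<in> basis_of_weight M" for b
      using \<open>i < 0 \<or> j < 0 \<or> j > M\<close> that lower_eq_zero[of b M j] divided_power_vir_linear(3)[of "-1" i]
      by (auto simp: divided_power_def)
    then show ?thesis by (simp add: G_def bilinear_functional_zero[OF F])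
  qed
  have low: "(\<Sum>b\<in>basis_of_weight (int N). F (lower (int i) b) (lower (int j) (d b))) =
      (\<Sum>k\<le>i. rising (of_int (2 * (int N - int j) + int j - int i)) k * G (int N - int j) (int j - int k) (int i - int k))" for i j
  proof -
    let ?M = "int N - int j"
    have bl: "bilinear_functional (\<lambda>x y. F (lower (int i) x) y)"
      unfolding bilinear_functional_def by (simp add: divided_power_vir_linear bilinear_functional_lin[OF F])
    have "(\<Sum>b\<in>basis_of_weight (int N). F (lower (int i) b) (lower (int j) (d b))) =
      (\<Sum>c\<in>basis_of_weight ?M. F (lower (int i) (raise (int j) c)) (d c))"
    proof (rule casimir_transfer[OF bl, symmetric])
      show "raise (int j) x \<in> weight_space V (int N)" if "x \<in> weight_space V ?M" for x
        using raise_weight_space[OF that, of "int j"] by simp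
    qed (auto simp: lower_weight_space form_lower)
    also have "\<dots> = (\<Sum>c\<in>basis_of_weight ?M. \<Sum>k\<le>i. rising (of_int (2 * ?M + int j - int i)) k *
      F (raise (int j - int k) (lower (int i - int k) c)) (d c))"
    proof (rule sum.cong)
      fix c assume "c \<in> basis_of_weight ?M"
      then have "c \<in> weight_space V ?M" by simp
      then show "F (lower (int i) (raise (int j) c)) (d c) = (\<Sum>k\<le>i. rising (of_int (2 * ?M + int j - int i)) k *
        F (raise (int j - int k) (lower (int i - int k) c)) (d c))"
        by (simp only: lower_raise bilinear_functional_sum(1)[OF F])
    qed simp
    also have "\<dots> = (\<Sum>k\<le>i. rising (of_int (2 * ?M + int j - int i)) k * G ?M (int j - int k) (int i - int k))"
      unfolding G_def sum_distrib_left by (rule sum.swap)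
    finally show ?thesis .
  qed
  have high: "(\<Sum>b\<in>basis_of_weight (int m). F (raise (int i) b) (raise (int j) (d b))) = G (int m + int j) (int i) (int j)" for m i j
  proof -
    have bl: "bilinear_functional (\<lambda>x y. F (raise (int i) x) y)"
      unfolding bilinear_functional_def by (simp add: divided_power_vir_linear bilinear_functional_lin[OF F])
    show ?thesis unfolding G_def
    proof (rule casimir_transfer[OF bl, symmetric])
      show "lower (int j) x \<in> weight_space V (int m)" if "x \<in> weight_space V (int m + int j)" for x
        using lower_weight_space[OF that, of "int j"] by simp
    qed (auto simp: raise_weight_space form_raise)
  qed
  define X where "X = (\<lambda>(i, j, k). (- (D\<^sup>2)) ^ N * ((1 / D) ^ i * (- 1 / D) ^ j *
      (rising (of_int (2 * (int N - int j) + int j - int i)) k * G (int N - int j) (int j - int k) (int i - int k))))"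
  \<comment> \<open>The terms with \<open>k > j\<close> or \<open>i - k > N - j\<close> vanish: a negative power of the raising operator, or a power of
    the lowering operator beyond the weight.\<close>
  define U where "U = (SIGMA i:{..N}. SIGMA j:{..N}. {..i})"
  define T where "T = {(i :: nat, j :: nat, k :: nat). k \<le> i \<and> k \<le> j \<and> i + j \<le> N + k}"
  have "(- (D\<^sup>2)) ^ N * (\<Sum>i\<le>N. \<Sum>j\<le>N. (1 / D) ^ i * (- 1 / D) ^ j *
      (\<Sum>b\<in>basis_of_weight (int N). F (lower (int i) b) (lower (int j) (d b)))) =
    (\<Sum>i\<le>N. \<Sum>j\<le>N. \<Sum>k\<le>i. X (i, j, k))"
    unfolding low X_def by (simp add: sum_distrib_left)
  also have "\<dots> = sum X U"
    unfolding U_def by (simp add: sum.Sigma)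
  also have "\<dots> = sum X T"
  proof (rule sum.mono_neutral_right)
    show "finite U" by (simp add: U_def)
    show "T \<subseteq> U" by (auto simp: T_def U_def)
    show "\<forall>t\<in>U - T. X t = 0"
      by (auto simp: U_def T_def X_def intro!: G0)
  qed
  also have "\<dots> = (\<Sum>(m, i, j)\<in>{(m, i, j). m + i + j \<le> N}. (- (D\<^sup>2)) ^ m * D ^ i * (- D) ^ j *
      rising (of_nat (2 * m + i + j)) (N - m - i - j) * G (int m + int j) (int i) (int j))"
  proof (rule sum.reindex_bij_witness[where j = "\<lambda>(i, j, k). (N + k - i - j, j - k, i - k)"
        and i = "\<lambda>(m, i, j). (j + (N - m - i - j), i + (N - m - i - j), N - m - i - j)"])
    fix t assume "t \<in> T"
    then obtain i j k where t: "t = (i, j, k)" "k \<le> i" "k \<le> j" "i + j \<le> N + k"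
      by (auto simp: T_def)
    define m i' j' where "m = N + k - i - j" and "i' = j - k" and "j' = i - k"
    have e: "i = j' + k" "j = i' + k" "N = m + i' + j' + k" using t by (auto simp: m_def i'_def j'_def)
    have "(- (D\<^sup>2)) ^ N * ((1 / D) ^ i * (- 1 / D) ^ j) =
      (- (D\<^sup>2)) ^ m * ((- (D\<^sup>2)) * (- 1 / D)) ^ i' * ((- (D\<^sup>2)) * (1 / D)) ^ j' * ((- (D\<^sup>2)) * (1 / D) * (- 1 / D)) ^ k"
      unfolding e by (simp only: power_add power_mult_distrib mult_ac)
    also have "(- (D\<^sup>2)) * (- 1 / D) = D" using D by (simp add: power2_eq_square)
    also have "(- (D\<^sup>2)) * (1 / D) = - D" using D by (simp add: power2_eq_square)
    also have "- D * (- 1 / D) = 1" using D by simp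
    finally have c: "(- (D\<^sup>2)) ^ N * ((1 / D) ^ i * (- 1 / D) ^ j) = (- (D\<^sup>2)) ^ m * D ^ i' * (- D) ^ j'" by simp
    have r: "2 * (int m + int j') + int j - int i = int (2 * m + i' + j')" by (simp add: e)
    have M: "int N - int j = int m + int j'" "int j - int k = int i'" "int i - int k = int j'" by (simp_all add: e)
    have k: "N - m - i' - j' = k" by (simp add: e)
    have "X t = ((- (D\<^sup>2)) ^ N * ((1 / D) ^ i * (- 1 / D) ^ j)) *
      (rising (of_int (int (2 * m + i' + j'))) k * G (int m + int j') (int i') (int j'))"
      unfolding X_def t(1) prod.case M r by (simp only: mult.assoc)
    also have "\<dots> = (- (D\<^sup>2)) ^ m * D ^ i' * (- D) ^ j' * rising (of_nat (2 * m + i' + j')) (N - m - i' - j') *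
      G (int m + int j') (int i') (int j')"
      unfolding c k of_int_of_nat_eq by (simp only: mult.assoc)
    finally show "(case case t of (i, j, k) \<Rightarrow> (N + k - i - j, j - k, i - k) of
      (m, i, j) \<Rightarrow> (- (D\<^sup>2)) ^ m * D ^ i * (- D) ^ j * rising (of_nat (2 * m + i + j)) (N - m - i - j) *
        G (int m + int j) (int i) (int j)) = X t"
      unfolding t(1) prod.case m_def i'_def j'_def by (rule sym)
  qed (auto simp: T_def)
  finally show ?thesis unfolding high .
qed

lemma two_point_bilinear: "bilinear_functional (\<lambda>a c. two_point ps Wp Wm a c p)"
  unfolding bilinear_functional_def by (simp add: two_point_lin)

end

section \<open>Comparison of the coefficients of powers of q\<close>

lemma geometric_power_nth: "fps_nth (inverse (1 - fps_X :: complex fps) ^ s) k = pochhammer (of_nat s) k / fact k"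
proof (cases "s = 0")
  case True
  then show ?thesis by (cases k) (simp_all add: pochhammer_0_left)
next
  case False
  have "inverse (1 - fps_X :: complex fps) ^ s = inverse ((1 - fps_const 1 * fps_X) ^ s)"
    by (simp add: fps_inverse_power)
  also have "fps_nth \<dots> k = of_nat ((s + k - 1) choose k)"
    using one_minus_const_fps_X_neg_power'[of s "1 :: complex"] False by simp
  also have "\<dots> = (of_nat (s + k - 1) :: complex) gchoose k"
    by (rule binomial_gbinomial)
  also have "\<dots> = pochhammer (of_nat (s + k - 1) - of_nat k + 1) k / fact k"
    by (rule gbinomial_pochhammer')
  also have "of_nat (s + k - 1) - of_nat k + 1 = (of_nat s :: complex)"
    using False by (simp add: of_nat_diff)
  finally show ?thesis .
qed

text \<open>Only finitely many powers of \<open>G\<close> contribute to a coefficient, so composition may be expanded before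
multiplying.\<close>

lemma fps_mult_compose_nth:
  fixes E A G :: "complex fps"
  assumes "fps_nth G 0 = 0"
  shows "fps_nth (E * fps_compose A G) N = (\<Sum>i\<le>N. fps_nth A i * fps_nth (E * G ^ i) N)"
proof -
  have low: "fps_nth (G ^ i) k = 0" if "k < i" for i k
    using startsby_zero_power_prefix[OF assms] that by blast
  have "fps_nth (E * fps_compose A G) N = (\<Sum>l=0..N. fps_nth E l * (\<Sum>i=0..N - l. fps_nth A i * fps_nth (G ^ i) (N - l)))"
    by (simp add: fps_mult_nth fps_compose_nth)
  also have "\<dots> = (\<Sum>l=0..N. fps_nth E l * (\<Sum>i\<le>N. fps_nth A i * fps_nth (G ^ i) (N - l)))"
    by (intro sum.cong refl arg_cong2[of _ _ _ _ "(*)"] sum.mono_neutral_left) (auto simp: low)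
  also have "\<dots> = (\<Sum>l=0..N. \<Sum>i\<le>N. fps_nth A i * (fps_nth E l * fps_nth (G ^ i) (N - l)))"
    by (simp add: sum_distrib_left mult.left_commute)
  also have "\<dots> = (\<Sum>i\<le>N. \<Sum>l=0..N. fps_nth A i * (fps_nth E l * fps_nth (G ^ i) (N - l)))"
    by (rule sum.swap)
  also have "\<dots> = (\<Sum>i\<le>N. fps_nth A i * fps_nth (E * G ^ i) N)"
    by (simp add: fps_mult_nth sum_distrib_left)
  finally show ?thesis .
qed

lemma fps_suminf_nth:
  fixes f :: "nat \<Rightarrow> complex fps"
  assumes "\<And>m N. m > N \<Longrightarrow> fps_nth (f m) N = 0"
  shows "fps_nth (\<Sum>m. f m) N = (\<Sum>m\<le>N. fps_nth (f m) N)"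
proof -
  have "f sums Abs_fps (\<lambda>N. \<Sum>m\<le>N. fps_nth (f m) N)"
    unfolding sums_def
  proof (rule tendsto_fpsI)
    fix N
    have "fps_nth (\<Sum>m<K. f m) N = (\<Sum>m\<le>N. fps_nth (f m) N)" if "K > N" for K
      unfolding fps_sum_nth by (rule sum.mono_neutral_right) (use that assms in auto)
    then show "\<forall>\<^sub>F K in sequentially. fps_nth (\<Sum>m<K. f m) N = fps_nth (Abs_fps (\<lambda>N. \<Sum>m\<le>N. fps_nth (f m) N)) N"
      by (auto simp: eventually_at_top_dense)
  qed
  then show ?thesis by (simp add: sums_iff)
qed

context voa_dual_bases
begin

text \<open>The vectors inserted at \<open>y\<^sub>i\<close> carry the factor \<open>y\<^sub>i\<^sup>w\<close>, and the trace is the sum of the matrix elements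
between \<open>d b\<close> and \<open>b\<close>.\<close>

lemma zhu_coefficient:
  fixes Zs :: "complex list"
  assumes "length Zs = length vs" and "length wts = length vs" and "distinct Zs" and "0 \<notin> set Zs"
  shows "rational_extension (length vs) (\<lambda>ys ks. weight_trace V m
        (insertions V (map (\<lambda>i. smul V ((ys ! i) ^ (wts ! i)) (vs ! i)) [0..<length vs]) ys ks)) Zs =
    (\<Prod>i<length vs. Zs ! i ^ (wts ! i)) *
    (\<Sum>b\<in>basis_of_weight (int m). correlator (\<lambda>x. \<beta> x b) (zip vs Zs @ [(d b, 0)]))"
proof -
  let ?n = "length vs"
  define D where "D = {ys :: complex list. length ys = ?n \<and> distinct ys \<and> 0 \<notin> set ys}"
  let ?g = "\<lambda>ys. (\<Prod>i<?n. ys ! i ^ (wts ! i)) *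
    (\<Sum>b\<in>basis_of_weight (int m). correlator (\<lambda>x. \<beta> x b) (zip vs ys @ [(d b, 0)]))"
  have rat: "rational_on ?n D (\<lambda>ys. correlator (\<lambda>x. \<beta> x b) (zip vs ys @ [(c, 0)]))" for b c
  proof -
    let ?us = "map (\<lambda>i. (vs ! i, \<lambda>ys :: complex list. ys ! i)) [0..<?n] @ [(c, \<lambda>_. 0)]"
    have "rational_on ?n D (\<lambda>ys. correlator (\<lambda>x. \<beta> x b) (map (\<lambda>(u, h). (u, h ys)) ?us))"
    proof (rule correlator_rational[OF restricted_form_left])
      fix j assume "j < length ?us"
      then show "rational_on ?n D (snd (?us ! j))"
        by (cases "j = ?n") (auto simp: nth_append)
    next
      fix i j and ys :: "complex list" assume ij: "i < j" "j < length ?us" and ys: "ys \<in> D"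
      then have i: "i < ?n" by simp
      have "ys ! i \<in> set ys" "0 \<notin> set ys" using ys i by (auto simp: D_def)
      then have "ys ! i \<noteq> 0" by auto
      moreover have "ys ! i \<noteq> ys ! j" if "j < ?n"
        using ys ij that by (auto simp: D_def nth_eq_iff_index_eq)
      ultimately show "snd (?us ! i) ys \<noteq> snd (?us ! j) ys"
        using ij i by (cases "j = ?n") (auto simp: nth_append)
    qed
    then show ?thesis
    proof (rule rational_on_cong)
      fix ys :: "complex list" assume "ys \<in> D"
      then have "zip vs ys @ [(c, 0)] = map (\<lambda>(u, h). (u, h ys)) ?us"
        by (intro nth_equalityI) (auto simp: D_def nth_append)
      then show "correlator (\<lambda>x. \<beta> x b) (zip vs ys @ [(c, 0)]) = correlator (\<lambda>x. \<beta> x b) (map (\<lambda>(u, h). (u, h ys)) ?us)"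
        by simp
    qed
  qed
  show ?thesis
  proof (rule rational_extension_eq)
    show "rational_on ?n D ?g"
      by (intro rational_on_mult rational_on_prod rational_on_power rational_on_sum rat rational_on_nth) auto
    show "Zs \<in> D" "length Zs = ?n" using assms by (simp_all add: D_def)
    show "radially_ordered ?n \<subseteq> D"
      by (auto simp: D_def radially_ordered_length radially_ordered_distinct radially_ordered_nonzero)
    fix ys assume ys: "ys \<in> radially_ordered ?n"
    then have l: "length ys = ?n" by (rule radially_ordered_length)
    let ?c = "\<Prod>i<?n. ys ! i ^ (wts ! i)"
    have "((\<lambda>ks. ?c * (\<Sum>b\<in>basis_of_weight (int m). \<beta> (insertions V vs ys ks (d b)) b)) has_sum ?g ys) {ks. length ks = ?n}"
    proof (intro has_sum_cmult_right has_sum_finite_sum)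
      fix b
      have "map snd (zip vs ys) \<in> radially_ordered (length (zip vs ys))" using ys l by simp
      from correlator_has_sum[OF restricted_form_left this, of "d b" b]
      show "((\<lambda>ks. \<beta> (insertions V vs ys ks (d b)) b) has_sum correlator (\<lambda>x. \<beta> x b) (zip vs ys @ [(d b, 0)])) {ks. length ks = ?n}"
        using l by simp
    qed
    also have "?this \<longleftrightarrow> ((\<lambda>ks. weight_trace V m
        (insertions V (map (\<lambda>i. smul V ((ys ! i) ^ (wts ! i)) (vs ! i)) [0..<?n]) ys ks)) has_sum ?g ys) {ks. length ks = ?n}"
    proof (rule has_sum_cong)
      fix ks :: "int list" assume "ks \<in> {ks. length ks = ?n}"
      then have lk: "length ks = ?n" by simp
      let ?cs = "map (\<lambda>i. ys ! i ^ (wts ! i)) [0..<?n]"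
      have scaled: "map (\<lambda>i. smul V ((ys ! i) ^ (wts ! i)) (vs ! i)) [0..<?n] = map2 (\<lambda>c u. smul V c u) ?cs vs"
        by (rule nth_equalityI) auto
      have "prod_list ?cs = ?c"
        by (simp add: prod.list_conv_set_nth atLeast0LessThan)
      then have T: "insertions V (map (\<lambda>i. smul V ((ys ! i) ^ (wts ! i)) (vs ! i)) [0..<?n]) ys ks x = smul V ?c (insertions V vs ys ks x)" for x
        unfolding scaled using insertions_scaled[of vs ys ?cs ks x] l lk by simp
      have lin: "insertions V vs ys ks (x + y) = insertions V vs ys ks x + insertions V vs ys ks y"
        "insertions V vs ys ks (smul V r x) = smul V r (insertions V vs ys ks x)" for x y r
        using product_term_add[of "zip vs ys" ks x y] product_term_scale[of "zip vs ys" ks r x] l by simp_all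
      have "weight_trace V m (insertions V (map (\<lambda>i. smul V ((ys ! i) ^ (wts ! i)) (vs ! i)) [0..<?n]) ys ks) =
        (\<Sum>b\<in>basis_of_weight (int m). \<beta> (insertions V (map (\<lambda>i. smul V ((ys ! i) ^ (wts ! i)) (vs ! i)) [0..<?n]) ys ks (d b)) b)"
        by (rule weight_trace_eq) (simp_all add: T lin scale_right_distrib mult.commute)
      then show "?c * (\<Sum>b\<in>basis_of_weight (int m). \<beta> (insertions V vs ys ks (d b)) b) =
        weight_trace V m (insertions V (map (\<lambda>i. smul V ((ys ! i) ^ (wts ! i)) (vs ! i)) [0..<?n]) ys ks)"
        by (simp add: T form_scale_left sum_distrib_left)
    qed
    finally show "((\<lambda>ks. weight_trace V m
        (insertions V (map (\<lambda>i. smul V ((ys ! i) ^ (wts ! i)) (vs ! i)) [0..<?n]) ys ks)) has_sum ?g ys) {ks. length ks = ?n}" .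
  qed
qed

text \<open>On a single weight space the operator \<open>(-x\<^sup>-\<^sup>2)\<^sup>L\<^sup>(\<^sup>0\<^sup>)\<close> of \<open>correlator_mobius\<close> at \<open>x = -1/D\<close> is the scalar
\<open>(-D\<^sup>2)\<^sup>m\<close>.  Scaling replaces the points \<open>Z/D\<close> by \<open>Z\<close>.\<close>

lemma trace_correlator_mobius:
  fixes ps :: "('v \<times> complex) list" and m :: nat
  assumes len: "length ws = length ps"
    and qp: "\<And>i. i < length ps \<Longrightarrow> quasiprimary V (ws ! i) (fst (ps ! i))"
    and dist: "distinct (map snd ps @ [Wp, Wm])" and b: "b \<in> basis_of_weight (int m)"
  shows "correlator (\<lambda>x. \<beta> x b) (map (\<lambda>(u, z). (u, (z - Wm) / (z - Wp))) ps @ [(d b, 0)]) =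
    (1 / (Wp - Wm)) ^ sum_list ws * inversion_factor ws (map (\<lambda>z. inverse (z - Wp)) (map snd ps)) *
    ((- ((Wp - Wm)\<^sup>2)) ^ m * (\<Sum>i\<le>m. \<Sum>j\<le>m. (1 / (Wp - Wm)) ^ i * (- 1 / (Wp - Wm)) ^ j *
      two_point ps Wp Wm (lower (int i) b) (lower (int j) (d b)) 0))"
proof -
  let ?D = "Wp - Wm"
  have D: "?D \<noteq> 0" using dist by auto
  have bw: "b \<in> weight_space V (int m)" "d b \<in> weight_space V (int m)"
    using b dual_weight_space[OF b] by auto
  let ?Z = "\<lambda>z. (z - Wm) / (z - Wp)"
  let ?l = "map (\<lambda>(u, z). (u, ?Z z / ?D)) ps @ [(d b, 0)]"
  have "map (\<lambda>(u, z). (u, ?Z z)) ps @ [(d b, 0)] = map (\<lambda>(u, y). (u, ?D * y)) ?l"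
    using D by (simp add: case_prod_beta)
  then have "correlator (\<lambda>x. \<beta> x b) (map (\<lambda>(u, z). (u, ?Z z)) ps @ [(d b, 0)]) =
    correlator (\<lambda>x. \<beta> x b) (map (\<lambda>(u, y). (u, ?D * y)) ?l)" by (simp only:)
  also have "\<dots> = ?D powi (int m - sum_list (map int ws @ [int m])) * correlator (\<lambda>x. \<beta> x b) ?l"
  proof (rule correlator_scale[OF restricted_form_left])
    show "\<beta> v b = 0" if "n \<noteq> int m" "v \<in> weight_space V n" for n v
      using form_orthogonal[OF that(2) bw(1) that(1)] .
    show "fst (?l ! j) \<in> weight_space V ((map int ws @ [int m]) ! j)" if "j < length ?l" for j
    proof (cases "j < length ps")
      case True
      then show ?thesis using qp[OF True] len by (simp add: nth_append quasiprimary_def case_prod_beta)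
    next
      case False
      then have "j = length ps" using that by simp
      then show ?thesis using bw len by (simp add: nth_append)
    qed
  qed (use len D in auto)
  also have "int m - sum_list (map int ws @ [int m]) = - int (sum_list ws)"
  proof -
    have "sum_list (map int ws) = int (sum_list ws)" by (induction ws) auto
    then show ?thesis by simp
  qed
  also have "?D powi (- int (sum_list ws)) = (1 / ?D) ^ sum_list ws"
    by (simp add: power_int_minus power_int_of_nat power_one_over inverse_eq_divide)
  also have "correlator (\<lambda>x. \<beta> x b) ?l = inversion_factor ws (map (\<lambda>z. inverse (z - Wp)) (map snd ps)) *
    (\<Sum>i\<le>m. (1 / ?D) ^ i / fact i * (\<Sum>j<Suc m. (-1) powi int m * (- 1 / ?D) powi (int j - 2 * int m) / fact j *
      correlator (\<beta> (vac V)) (ps @ [((vir V 1 ^^ i) b, Wp), ((vir V 1 ^^ j) (d b), Wm)])))"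
  proof (rule correlator_mobius[OF len qp bw(2) _ _ dist])
    show "(vir V 1 ^^ j) (d b) = 0" if "j \<ge> Suc m" for j
      by (rule negative_weight[OF _ vir_1_pow_weight_space[OF bw(2)]]) (use that in simp)
    show "(vir V 1 ^^ j) b = 0" if "j > m" for j
      by (rule negative_weight[OF _ vir_1_pow_weight_space[OF bw(1)]]) (use that in simp)
  qed
  also have "(\<Sum>i\<le>m. (1 / ?D) ^ i / fact i * (\<Sum>j<Suc m. (-1) powi int m * (- 1 / ?D) powi (int j - 2 * int m) / fact j *
      correlator (\<beta> (vac V)) (ps @ [((vir V 1 ^^ i) b, Wp), ((vir V 1 ^^ j) (d b), Wm)]))) =
    (- (?D\<^sup>2)) ^ m * (\<Sum>i\<le>m. \<Sum>j\<le>m. (1 / ?D) ^ i * (- 1 / ?D) ^ j *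
      two_point ps Wp Wm (lower (int i) b) (lower (int j) (d b)) 0)"
    unfolding sum_distrib_left lessThan_Suc_atMost
  proof (intro sum.cong refl)
    fix i j
    have "(- 1 / ?D) powi (int j - 2 * int m) = (- 1 / ?D) ^ j * ((?D\<^sup>2)) ^ m"
    proof -
      have "(- 1 / ?D) powi (int j - 2 * int m) = (- 1 / ?D) powi int j * (- 1 / ?D) powi (- (int (2 * m)))"
        using D by (subst power_int_add[symmetric]) auto
      also have "(- 1 / ?D) powi (- (int (2 * m))) = inverse ((- 1 / ?D) ^ (2 * m))"
        by (simp only: power_int_minus power_int_of_nat)
      also have "\<dots> = (?D\<^sup>2) ^ m" using D
        by (simp add: power_mult power_divide inverse_eq_divide)
      finally show ?thesis by (simp only: power_int_of_nat)
    qed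
    moreover have "(-1) powi int m = ((-1) ^ m :: complex)" by (simp only: power_int_of_nat)
    moreover have "(- (?D\<^sup>2)) ^ m = (-1) ^ m * (?D\<^sup>2) ^ m" by (rule power_minus)
    moreover have "two_point ps Wp Wm (lower (int i) b) (lower (int j) (d b)) 0 =
      1 / fact i * (1 / fact j * correlator (\<beta> (vac V)) (ps @ [((vir V 1 ^^ i) b, Wp), ((vir V 1 ^^ j) (d b), Wm)]))"
      by (simp add: divided_power_def two_point_scale) (simp add: two_point_def)
    ultimately show "(1 / ?D) ^ i / fact i * ((-1) powi int m * (- 1 / ?D) powi (int j - 2 * int m) / fact j *
      correlator (\<beta> (vac V)) (ps @ [((vir V 1 ^^ i) b, Wp), ((vir V 1 ^^ j) (d b), Wm)])) =
      (- (?D\<^sup>2)) ^ m * ((1 / ?D) ^ i * (- 1 / ?D) ^ j *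
      two_point ps Wp Wm (lower (int i) b) (lower (int j) (d b)) 0)"
      by (simp only:) (simp only: times_divide_eq_left times_divide_eq_right mult_1 mult_ac)
  qed
  finally show ?thesis by (simp only: mult.assoc)
qed

text \<open>In terms of \<open>D = Wp - Wm\<close> one has \<open>\<rho> = -D\<^sup>2 q / (1-q)\<^sup>2\<close>, and the sewing points are at \<open>p = q / (1-q)\<close>.  The term of
order \<open>n\<close> in \<open>p\<close> of the \<open>m\<close>-th summand therefore contributes \<open>q\<^sup>m\<^sup>+\<^sup>n (1-q)\<^sup>-\<^sup>2\<^sup>m\<^sup>-\<^sup>n\<close>, whose coefficients are rising
factorials.\<close>

lemma genus1_coefficient:
  assumes len: "length zs = length vs" and dist: "distinct (zs @ [Wp, Wm])"
  shows "fps_nth (genus1_form V \<beta> B d Wp Wm vs zs) N =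
    (\<Sum>(m, i, j)\<in>{(m, i, j). m + i + j \<le> N}. (- ((Wp - Wm)\<^sup>2)) ^ m * (Wp - Wm) ^ i * (- (Wp - Wm)) ^ j *
      rising (of_nat (2 * m + i + j)) (N - m - i - j) *
      (\<Sum>b\<in>basis_of_weight (int m). two_point (zip vs zs) Wp Wm (raise (int i) b) (raise (int j) (d b)) 0))"
proof -
  let ?D = "Wp - Wm" and ?ps = "zip vs zs"
  let ?F = "\<lambda>a c. two_point ?ps Wp Wm a c 0"
  let ?K = "\<lambda>m n N. (- (?D\<^sup>2)) ^ m * rising (of_nat (2 * m + n)) (N - m - n)"
  let ?T = "\<lambda>m n i :: nat. (\<Sum>b\<in>basis_of_weight (int m). ?F (raise (int i) b) (raise (int (n - i)) (d b)))"
  have ps: "map snd ?ps = zs" using len by simp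
  define Y :: "complex fps" where "Y = inverse (1 - fps_X)"
  have Y: "(\<lambda>q. inverse (1 - q)) has_fps_expansion Y"
    unfolding Y_def by (intro fps_expansion_intros) auto
  have XY: "(\<lambda>q. q * inverse (1 - q)) has_fps_expansion fps_X * Y"
    by (intro fps_expansion_intros Y)
  define h where "h m q = rho Wp Wm q ^ m * (\<Sum>b\<in>basis_of_weight (int m).
     genus0 V \<beta> (vs @ [b, d b]) (zs @ [w_pos Wp Wm q, w_neg Wp Wm q]))" for m q
  have nth_h: "fps_nth (fps_expansion (h m) 0) N = (if m \<le> N then (- (?D\<^sup>2)) ^ m * (\<Sum>n\<le>N - m. rising (of_nat (2 * m + n)) (N - m - n) *
      (\<Sum>i\<le>n. ?D ^ i * (- ?D) ^ (n - i) * ?T m n i)) else 0)" for m N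
  proof -
  \<comment> \<open>The Taylor series of the two-point function in \<open>p\<close>.\<close>
    define A where "A b = (SOME A. two_point ?ps Wp Wm b (d b) has_fps_expansion A \<and>
      (\<forall>n. fps_nth A n = ?D ^ n * (\<Sum>i\<le>n. (-1) ^ (n - i) * ?F (raise (int i) b) (raise (int (n - i)) (d b)))))" for b
    have A: "two_point ?ps Wp Wm b (d b) has_fps_expansion A b \<and>
      (\<forall>n. fps_nth (A b) n = ?D ^ n * (\<Sum>i\<le>n. (-1) ^ (n - i) * ?F (raise (int i) b) (raise (int (n - i)) (d b))))" for b
      unfolding A_def by (rule someI_ex, rule two_point_fps_expansion[of ?ps Wp Wm b "d b"])
        (use dist ps in auto)
    let ?E = "(fps_const (- (?D\<^sup>2)) * fps_X * Y ^ 2) ^ m"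
    have exp: "(\<lambda>q. (- (?D\<^sup>2) * q * inverse (1 - q) ^ 2) ^ m * (\<Sum>b\<in>basis_of_weight (int m). (two_point ?ps Wp Wm b (d b) \<circ> (\<lambda>q. q * inverse (1 - q))) q))
      has_fps_expansion ?E * (\<Sum>b\<in>basis_of_weight (int m). fps_compose (A b) (fps_X * Y))"
      by (intro fps_expansion_intros has_fps_expansion_compose conjunct1[OF A] XY Y) auto
    have ev: "\<forall>\<^sub>F q in nhds 0. h m q = (- (?D\<^sup>2) * q * inverse (1 - q) ^ 2) ^ m * (\<Sum>b\<in>basis_of_weight (int m). (two_point ?ps Wp Wm b (d b) \<circ> (\<lambda>q. q * inverse (1 - q))) q)"
    proof -
      let ?U = "{p. distinct (zs @ [Wp + ?D * p, Wm - ?D * p])}"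
      have "isCont (\<lambda>q :: complex. q * inverse (1 - q)) 0" by (intro continuous_intros) auto
      then have "((\<lambda>q :: complex. q * inverse (1 - q)) \<longlongrightarrow> 0) (nhds 0)"
        using tendsto_at_iff_tendsto_nhds[of "\<lambda>q :: complex. q * inverse (1 - q)" 0] by (simp add: isCont_def)
      then have "\<forall>\<^sub>F q in nhds 0. q * inverse (1 - q) \<in> ?U"
        by (rule topological_tendstoD[OF _ open_two_point_domain]) (use dist in simp)
      moreover have "\<forall>\<^sub>F q in nhds (0 :: complex). q \<in> - {1}"
        by (intro eventually_nhds_in_open) auto
      ultimately show ?thesis
      proof eventually_elim
        case (elim q)
        then have q: "1 - q \<noteq> 0" by auto
        let ?p = "q * inverse (1 - q)"
        have wp: "w_pos Wp Wm q = Wp + ?D * ?p" and wm: "w_neg Wp Wm q = Wm - ?D * ?p"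
          unfolding w_pos_def w_neg_def using q by (simp_all add: field_simps)
        have rh: "rho Wp Wm q = - (?D\<^sup>2) * q * inverse (1 - q) ^ 2"
          unfolding rho_def by (simp add: field_simps power2_commute[of Wm Wp])
        have "genus0 V \<beta> (vs @ [b, d b]) (zs @ [w_pos Wp Wm q, w_neg Wp Wm q]) = two_point ?ps Wp Wm b (d b) ?p" for b
        proof -
          have "distinct (zs @ [Wp + ?D * ?p, Wm - ?D * ?p])" using elim(1) by (rule CollectD)
          then show ?thesis
            unfolding two_point_def wp wm using len by (subst genus0_eq_correlator) (simp_all only:, simp_all)
        qed
        then show ?case unfolding h_def rh by simp
      qed
    qed
    have "h m has_fps_expansion ?E * (\<Sum>b\<in>basis_of_weight (int m). fps_compose (A b) (fps_X * Y))"
      by (subst has_fps_expansion_cong[OF ev refl]) (rule exp)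
    then have "fps_expansion (h m) 0 = ?E * (\<Sum>b\<in>basis_of_weight (int m). fps_compose (A b) (fps_X * Y))"
      by (rule fps_expansion_eqI)
    note expansion = this
    have coeff_geom: "fps_nth (?E * (fps_X * Y) ^ n) N = (if m + n \<le> N then ?K m n N else 0)" for n
    proof -
      have "?E * (fps_X * Y) ^ n = fps_const ((- (?D\<^sup>2)) ^ m) * (fps_X ^ (m + n) * Y ^ (2 * m + n))"
        by (simp add: power_mult_distrib power_add power_mult[symmetric] mult_ac)
      then show ?thesis
        by (simp add: fps_X_power_mult_nth Y_def geometric_power_nth rising_def)
    qed
    have coeff_A: "(\<Sum>b\<in>basis_of_weight (int m). fps_nth (A b) n) =
      (\<Sum>i\<le>n. ?D ^ i * (- ?D) ^ (n - i) * ?T m n i)" for n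
    proof -
      have "(\<Sum>b\<in>basis_of_weight (int m). fps_nth (A b) n) =
        (\<Sum>b\<in>basis_of_weight (int m). \<Sum>i\<le>n. ?D ^ i * (- ?D) ^ (n - i) * ?F (raise (int i) b) (raise (int (n - i)) (d b)))"
      proof (rule sum.cong)
        fix b
        have "?D ^ n * (-1) ^ (n - i) = ?D ^ i * (- ?D) ^ (n - i)" if "i \<le> n" for i
          using that by (subst power_minus[of ?D]) (simp add: power_add[symmetric] mult.left_commute[of "?D ^ i"])
        then show "fps_nth (A b) n = (\<Sum>i\<le>n. ?D ^ i * (- ?D) ^ (n - i) * ?F (raise (int i) b) (raise (int (n - i)) (d b)))"
          unfolding conjunct2[OF A, rule_format] sum_distrib_left mult.assoc[symmetric] by (intro sum.cong) simp_all
      qed simp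
      also have "\<dots> = (\<Sum>i\<le>n. ?D ^ i * (- ?D) ^ (n - i) * ?T m n i)"
        unfolding sum_distrib_left by (rule sum.swap)
      finally show ?thesis .
    qed
    from expansion have "fps_nth (fps_expansion (h m) 0) N = (\<Sum>b\<in>basis_of_weight (int m). \<Sum>n\<le>N. fps_nth (A b) n * fps_nth (?E * (fps_X * Y) ^ n) N)"
      by (simp add: sum_distrib_left fps_sum_nth fps_mult_compose_nth)
    also have "\<dots> = (\<Sum>b\<in>basis_of_weight (int m). \<Sum>n\<le>N. fps_nth (A b) n * (if m + n \<le> N then ?K m n N else 0))"
      by (simp only: coeff_geom)
    also have "\<dots> =
      (\<Sum>n\<le>N. if m + n \<le> N then ?K m n N * (\<Sum>b\<in>basis_of_weight (int m). fps_nth (A b) n) else 0)"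
    proof (subst sum.swap, rule sum.cong[OF refl])
      fix n
      have factor: "(\<Sum>b\<in>basis_of_weight (int m). fps_nth (A b) n * k) = (\<Sum>b\<in>basis_of_weight (int m). fps_nth (A b) n) * k" for k
        by (simp only: sum_distrib_right)
      show "(\<Sum>b\<in>basis_of_weight (int m). fps_nth (A b) n * (if m + n \<le> N then ?K m n N else 0)) =
        (if m + n \<le> N then ?K m n N * (\<Sum>b\<in>basis_of_weight (int m). fps_nth (A b) n) else 0)"
        unfolding factor by simp
    qed
    also have "\<dots> = (if m \<le> N then (\<Sum>n\<le>N - m. ?K m n N * (\<Sum>b\<in>basis_of_weight (int m). fps_nth (A b) n)) else 0)"
    proof (cases "m \<le> N")
      case True
      have "(\<Sum>n\<le>N. if m + n \<le> N then ?K m n N * (\<Sum>b\<in>basis_of_weight (int m). fps_nth (A b) n) else 0) =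
        (\<Sum>n\<le>N - m. if m + n \<le> N then ?K m n N * (\<Sum>b\<in>basis_of_weight (int m). fps_nth (A b) n) else 0)"
        by (rule sum.mono_neutral_right) (use True in auto)
      also have "\<dots> = (\<Sum>n\<le>N - m. ?K m n N * (\<Sum>b\<in>basis_of_weight (int m). fps_nth (A b) n))"
        by (rule sum.cong) (use True in auto)
      finally show ?thesis using True by simp
    qed (auto intro!: sum.neutral)
    finally show ?thesis unfolding coeff_A by (simp add: sum_distrib_left mult.assoc)
  qed
  define X where "X = (\<lambda>(m, n, i). (- (?D\<^sup>2)) ^ m * (rising (of_nat (2 * m + n)) (N - m - n) *
      (?D ^ i * (- ?D) ^ (n - i) * ?T m n i)))"
  have "fps_nth (genus1_form V \<beta> B d Wp Wm vs zs) N = fps_nth (\<Sum>m. fps_expansion (h m) 0) N"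
    unfolding genus1_form_def h_def[abs_def] ..
  also have "\<dots> = (\<Sum>m\<le>N. fps_nth (fps_expansion (h m) 0) N)"
    by (rule fps_suminf_nth) (simp add: nth_h)
  also have "\<dots> = (\<Sum>m\<le>N. \<Sum>n\<le>N - m. \<Sum>i\<le>n. (- (?D\<^sup>2)) ^ m * (rising (of_nat (2 * m + n)) (N - m - n) *
      (?D ^ i * (- ?D) ^ (n - i) * ?T m n i)))"
    by (rule sum.cong) (simp_all add: nth_h sum_distrib_left)
  also have "\<dots> = (\<Sum>m\<le>N. \<Sum>n\<le>N - m. \<Sum>i\<le>n. X (m, n, i))"
    by (simp only: X_def prod.case)
  also have "\<dots> = sum X (SIGMA m:{..N}. SIGMA n:{..N - m}. {..n})"
    by (simp add: sum.Sigma)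
  also have "\<dots> = (\<Sum>(m, i, j)\<in>{(m, i, j). m + i + j \<le> N}. (- (?D\<^sup>2)) ^ m * ?D ^ i * (- ?D) ^ j *
      rising (of_nat (2 * m + i + j)) (N - m - i - j) *
      (\<Sum>b\<in>basis_of_weight (int m). ?F (raise (int i) b) (raise (int j) (d b))))"
    by (rule sum.reindex_bij_witness[where j = "\<lambda>(m, n, i). (m, i, n - i)" and i = "\<lambda>(m, i, j). (m, i + j, i)"])
      (auto simp: X_def mult_ac)
  finally show ?thesis .
qed

end

theorem theorem4p1:
  fixes V :: "'v::ab_group_add vertex_data"
    and \<beta> :: "'v \<Rightarrow> 'v \<Rightarrow> complex"
    and B :: "'v set" and d :: "'v \<Rightarrow> 'v"
    and vs :: "'v list" and wts :: "nat list"
    and zs :: "complex list" and Wp Wm :: complex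
    and \<zeta> :: "nat \<Rightarrow> complex \<Rightarrow> complex"
  assumes "voa V" and "simple_voa V" and "strong_cft_type V" and "self_contragredient V"
    and "invariant_form V \<beta>" and "nondegenerate_form \<beta>" and "\<beta> (vac V) (vac V) = 1"
    and "homogeneous_basis V B" and "dual_basis \<beta> B d"
    and "length wts = length vs" and "length zs = length vs"
    and "\<And>i. i < length vs \<Longrightarrow> quasiprimary V (wts ! i) (vs ! i)"
    and "Wp \<noteq> Wm" and "distinct zs" and "Wp \<notin> set zs" and "Wm \<notin> set zs"
    and "\<And>i. i < length vs \<Longrightarrow> \<zeta> i analytic_on {zs ! i}"
    and "\<And>i. i < length vs \<Longrightarrow>
           \<forall>\<^sub>F z in nhds (zs ! i). exp (\<zeta> i z) = (z - Wm) / (z - Wp)"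
  shows "genus1_form V \<beta> B d Wp Wm vs zs =
           zhu_trace V wts vs (map (\<lambda>i. \<zeta> i (zs ! i)) [0..<length vs]) *
           fps_const (\<Prod>i<length vs. deriv (\<zeta> i) (zs ! i) ^ (wts ! i))"
proof -
  interpret voa_dual_bases V \<beta> B d
  proof unfold_locales
    show "v = 0" if "n < 0" "v \<in> weight_space V n" for n v
      using assms(3) that unfolding strong_cft_type_def by blast
  qed (fact assms)+
  let ?n = "length vs" and ?D = "Wp - Wm" and ?ps = "zip vs zs"
  let ?Z = "\<lambda>z. (z - Wm) / (z - Wp)"
  have D: "?D \<noteq> 0" using assms(13) by simp
  have ps: "map snd ?ps = zs" "length ?ps = ?n" using assms(11) by simp_all
  have dist: "distinct (zs @ [Wp, Wm])" using assms(13-16) by auto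
  have z: "zs ! i - Wp \<noteq> 0" "zs ! i - Wm \<noteq> 0" if "i < ?n" for i
    using that nth_mem[of i zs] assms(11,15,16) by auto
  define Zs where "Zs = map (\<lambda>i. ?Z (zs ! i)) [0..<?n]"
  have expz: "exp (\<zeta> i (zs ! i)) = ?Z (zs ! i)" if "i < ?n" for i
    using eventually_nhds_x_imp_x[OF assms(18)[OF that]] .
  have Zs: "map exp (map (\<lambda>i. \<zeta> i (zs ! i)) [0..<?n]) = Zs"
    by (simp add: Zs_def expz)
  have Zinj: "i = j" if "?Z (zs ! i) = ?Z (zs ! j)" "i < ?n" "j < ?n" for i j
  proof -
    have "(zs ! i - Wm) * (zs ! j - Wp) = (zs ! j - Wm) * (zs ! i - Wp)"
      using that(1) z(1)[OF that(2)] z(1)[OF that(3)] by (simp add: frac_eq_eq)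
    moreover have "?D * (zs ! i - zs ! j) = (zs ! j - Wm) * (zs ! i - Wp) - (zs ! i - Wm) * (zs ! j - Wp)"
      by (simp add: algebra_simps)
    ultimately have "?D * (zs ! i - zs ! j) = 0" by simp
    then have "zs ! i = zs ! j" using D by simp
    then show ?thesis using that(2,3) assms(11,14) by (simp add: nth_eq_iff_index_eq)
  qed
  have Zs_ok: "length Zs = ?n" "distinct Zs" "0 \<notin> set Zs"
    using Zinj z by (auto simp: Zs_def distinct_map inj_on_def)
  have zipZ: "zip vs Zs = map (\<lambda>(u, z). (u, ?Z z)) ?ps"
    by (rule nth_equalityI) (auto simp: Zs_def assms(11))
  have qp: "quasiprimary V (wts ! i) (fst (?ps ! i))" if "i < length ?ps" for i
    using assms(12)[of i] that assms(11) by simp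
  have dz: "deriv (\<zeta> i) (zs ! i) = - ?D / (zs ! i - Wp)\<^sup>2 / ?Z (zs ! i)" if i: "i < ?n" for i
  proof -
    let ?z = "zs ! i"
    have "\<zeta> i field_differentiable at ?z"
      using assms(17)[OF i] by (rule analytic_on_imp_differentiable_at) simp
    then have "(\<zeta> i has_field_derivative deriv (\<zeta> i) ?z) (at ?z)"
      by (simp add: field_differentiable_derivI)
    then have "((\<lambda>z. exp (\<zeta> i z)) has_field_derivative exp (\<zeta> i ?z) * deriv (\<zeta> i) ?z) (at ?z)"
      by (auto intro!: derivative_eq_intros)
    then have "(?Z has_field_derivative ?Z ?z * deriv (\<zeta> i) ?z) (at ?z)"
      using DERIV_cong_ev[OF refl assms(18)[OF i] refl] expz[OF i] by simp
    moreover have "(?Z has_field_derivative - ?D / (?z - Wp)\<^sup>2) (at ?z)"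
      using z[OF i] by (auto intro!: derivative_eq_intros simp: power2_eq_square field_simps)
    ultimately have "?Z ?z * deriv (\<zeta> i) ?z = - ?D / (?z - Wp)\<^sup>2" by (rule DERIV_unique)
    then show ?thesis using z[OF i] by (simp add: field_simps)
  qed
  \<comment> \<open>The product of the factors \<open>Z\<^sup>w\<close> of the trace, \<open>D\<^sup>-\<^sup>w\<close> of the scaling, \<open>(-(z - Wp)\<^sup>2)\<^sup>w\<close> of the
    inversion and \<open>\<zeta>'\<^sup>w\<close> is \<open>1\<close>, because \<open>\<zeta>' = Z'/Z = -D / ((z - Wp)\<^sup>2 Z)\<close>.\<close>
  have jac: "(\<Prod>i<?n. Zs ! i ^ (wts ! i)) * ((1 / ?D) ^ sum_list wts *
      inversion_factor wts (map (\<lambda>z. inverse (z - Wp)) zs)) * (\<Prod>i<?n. deriv (\<zeta> i) (zs ! i) ^ (wts ! i)) = 1"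
  proof -
    have "(1 / ?D) ^ sum_list wts = (\<Prod>i<?n. (1 / ?D) ^ (wts ! i))"
      using assms(10) by (simp add: power_sum[symmetric] sum_list_sum_nth atLeast0LessThan)
    moreover have "inversion_factor wts (map (\<lambda>z. inverse (z - Wp)) zs) =
      (\<Prod>i<?n. (-1) ^ (wts ! i) * ((zs ! i - Wp)\<^sup>2) ^ (wts ! i))"
      unfolding inversion_factor_def
    proof (rule prod.cong)
      fix i assume "i \<in> {..<?n}"
      then have i: "i < length zs" using assms(11) by simp
      have "inverse (zs ! i - Wp) powi (- 2 * int (wts ! i)) = (zs ! i - Wp) powi (int (2 * wts ! i))"
        by (simp add: power_int_minus power_int_inverse)
      also have "\<dots> = ((zs ! i - Wp)\<^sup>2) ^ (wts ! i)" by (simp only: power_int_of_nat power_mult)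
      finally show "(-1) ^ (wts ! i) * map (\<lambda>z. inverse (z - Wp)) zs ! i powi (- 2 * int (wts ! i)) =
        (-1) ^ (wts ! i) * ((zs ! i - Wp)\<^sup>2) ^ (wts ! i)" using i by simp
    qed (simp add: assms(11))
    moreover have "Zs ! i ^ (wts ! i) * ((1 / ?D) ^ (wts ! i) * ((-1) ^ (wts ! i) * ((zs ! i - Wp)\<^sup>2) ^ (wts ! i))) *
        deriv (\<zeta> i) (zs ! i) ^ (wts ! i) = 1" if i: "i < ?n" for i
    proof -
      have "Zs ! i * ((1 / ?D) * ((-1) * (zs ! i - Wp)\<^sup>2)) * deriv (\<zeta> i) (zs ! i) = 1"
        unfolding dz[OF i] using z[OF i] D i by (simp add: Zs_def) (simp add: field_simps)
      then show ?thesis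
        unfolding power_mult_distrib[symmetric] by simp
    qed
    ultimately show ?thesis
      by (simp add: prod.distrib[symmetric])
  qed
  show ?thesis
  proof (rule fps_ext)
    fix N
    let ?F = "\<lambda>a c. two_point ?ps Wp Wm a c 0"
    let ?zhu = "zhu_trace V wts vs (map (\<lambda>i. \<zeta> i (zs ! i)) [0..<?n])" and ?fac = "(1 / ?D) ^ sum_list wts * inversion_factor wts (map (\<lambda>z. inverse (z - Wp)) zs)"
    let ?M = "\<lambda>b. (\<Sum>i\<le>N. \<Sum>j\<le>N. (1 / ?D) ^ i * (- 1 / ?D) ^ j * ?F (lower (int i) b) (lower (int j) (d b)))"
    let ?S = "(- (?D\<^sup>2)) ^ N * (\<Sum>i\<le>N. \<Sum>j\<le>N. (1 / ?D) ^ i * (- 1 / ?D) ^ j *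
      (\<Sum>b\<in>basis_of_weight (int N). ?F (lower (int i) b) (lower (int j) (d b))))"
    have "fps_nth (genus1_form V \<beta> B d Wp Wm vs zs) N = ?S"
      unfolding genus1_coefficient[OF assms(11) dist] sewing_identity[OF two_point_bilinear D] ..
    have "fps_nth (?zhu) N =
      (\<Prod>i<?n. Zs ! i ^ (wts ! i)) * (\<Sum>b\<in>basis_of_weight (int N). correlator (\<lambda>x. \<beta> x b) (zip vs Zs @ [(d b, 0)]))"
      unfolding zhu_trace_def fps_nth_Abs_fps Zs by (rule zhu_coefficient[OF Zs_ok(1) assms(10) Zs_ok(2,3)])
    also have "(\<Sum>b\<in>basis_of_weight (int N). correlator (\<lambda>x. \<beta> x b) (zip vs Zs @ [(d b, 0)])) =
      (\<Sum>b\<in>basis_of_weight (int N). ?fac *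
       ((- (?D\<^sup>2)) ^ N * ?M b))"
      unfolding zipZ
    proof (rule sum.cong[OF refl])
      fix b assume b: "b \<in> basis_of_weight (int N)"
      show "correlator (\<lambda>x. \<beta> x b) (map (\<lambda>(u, z). (u, ?Z z)) ?ps @ [(d b, 0)]) =
        ?fac *
       ((- (?D\<^sup>2)) ^ N * ?M b)"
        using trace_correlator_mobius[OF _ qp _ b, of Wp Wm] dist assms(10) unfolding ps by simp
    qed
    also have "\<dots> = ?fac * ?S"
    proof -
      have "(\<Sum>b\<in>basis_of_weight (int N). \<Sum>i\<le>N. \<Sum>j\<le>N. (1 / ?D) ^ i * (- 1 / ?D) ^ j * ?F (lower (int i) b) (lower (int j) (d b))) =
        (\<Sum>i\<le>N. \<Sum>j\<le>N. (1 / ?D) ^ i * (- 1 / ?D) ^ j * (\<Sum>b\<in>basis_of_weight (int N). ?F (lower (int i) b) (lower (int j) (d b))))"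
        unfolding sum_distrib_left by (subst sum.swap) (intro sum.cong refl sum.swap)
      then show ?thesis by (simp only: sum_distrib_left[symmetric])
    qed
    finally have zhu: "fps_nth (?zhu) N =
      (\<Prod>i<?n. Zs ! i ^ (wts ! i)) * (?fac * ?S)" .
    have cancel: "P * (Q * S) * J = S" if "P * Q * J = 1" for P Q S J :: complex
    proof -
      have "P * (Q * S) * J = P * Q * J * S" by simp
      then show ?thesis using that by simp
    qed
    show "fps_nth (genus1_form V \<beta> B d Wp Wm vs zs) N =
      fps_nth (?zhu *
        fps_const (\<Prod>i<?n. deriv (\<zeta> i) (zs ! i) ^ (wts ! i))) N"
      unfolding \<open>fps_nth (genus1_form V \<beta> B d Wp Wm vs zs) N = ?S\<close> fps_mult_right_const_nth zhu
      by (rule cancel[OF jac, symmetric])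
  qed
qed

end
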